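(* (Working in $\mathsf{ZF}$.) Let $n>0$ be a natural number. If $\delta$ is the least Berkeley cardinal, then for every set $z$ there exists a strictly increasing sequence $\vec\lambda=\langle\lambda_m:m<\omega\rangle$ of cardinals with supremum less than $\delta$ such that $\sqrt{\mathrm{ESR}}_{\mathcal{C}}(\vec\lambda)$ holds for every class $\mathcal{C}$ of $\mathcal{L}$-structures that is definable by a $\Sigma_n$-formula with parameter $z$.
   Context: An ordinal $\delta$ is a Berkeley cardinal if for every transitive set $M$ with $\delta\in M$ and every $\eta<\delta$ there is a non-trivial elementary embedding $j\colon M\to M$ with $\eta<\mathrm{crit}(j)<\delta$. $\mathcal{L}$ is a first-order language containing unary predicate symbols $\dot P_m$ ($m<\omega$). Given a sequence $\vec\lambda=\langle\lambda_m:m<\omega\rangle$ of cardinals with supremum $\lambda$, an $\mathcal{L}$-structure $A$ has type $\vec\lambda$ if its universe has rank $\lambda$ and $\mathrm{rank}(\dot P_m^A)=\lambda_m$ for all $m$. For a limit ordinal $\lambda$ and $f\colon V_\lambda\to V_\lambda$, define $f_+\colon V_{\lambda+1}\to V_{\lambda+1}$ by $f_+(A)=\bigcup\{f(A\cap V_\alpha):\alpha<\lambda\}$; a square root of $f$ is a function $r\colon V_\lambda\to V_\lambda$ with $r_+(r)=f$. For a class $\mathcal{C}$ of $\mathcal{L}$-structures and a strictly increasing sequence $\vec\lambda$ of cardinals with supremum $\lambda$, $\sqrt{\mathrm{ESR}}_{\mathcal{C}}(\vec\lambda)$ states: there is $f\colon V_\lambda\to V_\lambda$ such that for every $B\in\mathcal{C}$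 of type $\langle\lambda_{m+1}:m<\omega\rangle$ there exist $A\in\mathcal{C}$ of type $\langle\lambda_m:m<\omega\rangle$ and a square root $r$ of $f$ whose restriction to the universe of $A$ is an elementary embedding of $A$ into $B$.
   Formalization: The language 𝓛 is assumed to have an injection of its symbols into some V_α with α<δ (e.g. countable), since the claim fails if 𝓛 has a constant for every element of V_δ; Berkeley cardinals are taken to be nonzero. *)

theory Defs
  imports Main
begin

text \<open>
  HOL satisfies the axiom of choice, so a result of ZF about cardinals that refute choice cannot
  be read off the HOL universe.  It is stated as a result about an arbitrary
  model of first-order ZF: a type with a binary relation \<open>E\<close> satisfying the axioms, where the
  schemas range over genuine first-order formulas.  The model need not be well-founded or
  \<open>\<omega>\<close>-standard from the outside, so every set-theoretic notion below (ordinals, functions,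
  formulas, satisfaction, ...) is the one internal to the model.
\<close>

section \<open>Models of ZF\<close>

datatype fm = FIn nat nat | FEq nat nat | FNot fm | FAnd fm fm | FEx nat fm

primrec holds :: "('v \<Rightarrow> 'v \<Rightarrow> bool) \<Rightarrow> fm \<Rightarrow> (nat \<Rightarrow> 'v) \<Rightarrow> bool" where
  "holds E (FIn i k) s = E (s i) (s k)"
| "holds E (FEq i k) s = (s i = s k)"
| "holds E (FNot p) s = (\<not> holds E p s)"
| "holds E (FAnd p q) s = (holds E p s \<and> holds E q s)"
| "holds E (FEx i p) s = (\<exists>x. holds E p (s(i := x)))"

text \<open>Parameters of the schemas are supplied by the assignment \<open>s\<close>.\<close>

locale ZF =
  fixes E :: "'v \<Rightarrow> 'v \<Rightarrow> bool" (infix "\<epsilon>" 50)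
  assumes extensionality: "(\<forall>u. u \<epsilon> x \<longleftrightarrow> u \<epsilon> y) \<Longrightarrow> x = y"
    and foundation: "u \<epsilon> x \<Longrightarrow> \<exists>y. y \<epsilon> x \<and> \<not> (\<exists>w. w \<epsilon> x \<and> w \<epsilon> y)"
    and pairing: "\<exists>z. \<forall>u. u \<epsilon> z \<longleftrightarrow> u = x \<or> u = y"
    and union: "\<exists>z. \<forall>u. u \<epsilon> z \<longleftrightarrow> (\<exists>y. y \<epsilon> x \<and> u \<epsilon> y)"
    and power_set: "\<exists>z. \<forall>u. u \<epsilon> z \<longleftrightarrow> (\<forall>w. w \<epsilon> u \<longrightarrow> w \<epsilon> x)"
    and infinity: "\<exists>w. (\<exists>e. e \<epsilon> w \<and> (\<forall>u. \<not> u \<epsilon> e)) \<and>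
      (\<forall>x. x \<epsilon> w \<longrightarrow> (\<exists>y. y \<epsilon> w \<and> (\<forall>u. u \<epsilon> y \<longleftrightarrow> u \<epsilon> x \<or> u = x)))"
    and separation: "\<exists>b. \<forall>x. x \<epsilon> b \<longleftrightarrow> x \<epsilon> a \<and> holds (\<epsilon>) p (s(0 := x))"
    and replacement: "(\<forall>x. x \<epsilon> a \<longrightarrow> (\<exists>!y. holds (\<epsilon>) p (s(0 := x, 1 := y)))) \<Longrightarrow>
      \<exists>b. \<forall>y. y \<epsilon> b \<longleftrightarrow> (\<exists>x. x \<epsilon> a \<and> holds (\<epsilon>) p (s(0 := x, 1 := y)))"

text \<open>
  A first-order language is given by disjoint sets (of the model) of relation and function symbols
  and an arity function; constants are function symbols of arity \<open>0\<close>.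
\<close>

datatype 'v language = Language (rels: 'v) (funs: 'v) (arity: 'v)

locale membership =
  fixes E :: "'v \<Rightarrow> 'v \<Rightarrow> bool" (infix "\<epsilon>" 50)
begin

section \<open>Basic set theory inside the model\<close>

text \<open>
  \<open>setof Q\<close> is the element of the model with extension \<open>Q\<close>; it is unspecified if \<open>Q\<close> is not
  the extension of a set.
\<close>

definition setof :: "('v \<Rightarrow> bool) \<Rightarrow> 'v" where
  "setof Q = (THE y. \<forall>x. x \<epsilon> y \<longleftrightarrow> Q x)"

definition empty :: 'v where "empty = setof (\<lambda>x. False)"
definition upair :: "'v \<Rightarrow> 'v \<Rightarrow> 'v" where "upair a b = setof (\<lambda>x. x = a \<or> x = b)"
definition opair :: "'v \<Rightarrow> 'v \<Rightarrow> 'v" where "opair a b = upair (upair a a) (upair a b)"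
definition union2 :: "'v \<Rightarrow> 'v \<Rightarrow> 'v" where "union2 a b = setof (\<lambda>x. x \<epsilon> a \<or> x \<epsilon> b)"
definition inter2 :: "'v \<Rightarrow> 'v \<Rightarrow> 'v" where "inter2 a b = setof (\<lambda>x. x \<epsilon> a \<and> x \<epsilon> b)"
definition succ :: "'v \<Rightarrow> 'v" where "succ a = setof (\<lambda>x. x \<epsilon> a \<or> x = a)"

primrec num :: "nat \<Rightarrow> 'v" where
  "num 0 = empty"
| "num (Suc k) = succ (num k)"

text \<open>Functions are sets of ordered pairs.\<close>

definition func :: "'v \<Rightarrow> 'v \<Rightarrow> 'v \<Rightarrow> bool" where
  "func f A B \<longleftrightarrow>
    (\<forall>p. p \<epsilon> f \<longrightarrow> (\<exists>x y. x \<epsilon> A \<and> y \<epsilon> B \<and> p = opair x y)) \<and>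
    (\<forall>x. x \<epsilon> A \<longrightarrow> (\<exists>!y. opair x y \<epsilon> f))"

definition app :: "'v \<Rightarrow> 'v \<Rightarrow> 'v" where
  "app f x = (THE y. opair x y \<epsilon> f)"

definition lam :: "'v \<Rightarrow> ('v \<Rightarrow> 'v) \<Rightarrow> 'v" where
  "lam A F = setof (\<lambda>p. \<exists>x. x \<epsilon> A \<and> p = opair x (F x))"

definition injective :: "'v \<Rightarrow> 'v \<Rightarrow> bool" where
  "injective f A \<longleftrightarrow> (\<forall>x y. x \<epsilon> A \<longrightarrow> y \<epsilon> A \<longrightarrow> app f x = app f y \<longrightarrow> x = y)"

definition surjective :: "'v \<Rightarrow> 'v \<Rightarrow> 'v \<Rightarrow> bool" where
  "surjective f A B \<longleftrightarrow> (\<forall>y. y \<epsilon> B \<longrightarrow> (\<exists>x. x \<epsilon> A \<and> app f x = y))"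

definition transitive :: "'v \<Rightarrow> bool" where
  "transitive x \<longleftrightarrow> (\<forall>y u. y \<epsilon> x \<longrightarrow> u \<epsilon> y \<longrightarrow> u \<epsilon> x)"

definition ordinal :: "'v \<Rightarrow> bool" where
  "ordinal x \<longleftrightarrow> transitive x \<and> (\<forall>y. y \<epsilon> x \<longrightarrow> transitive y)"

text \<open>In the absence of choice, cardinals are initial ordinals.\<close>

definition cardinal :: "'v \<Rightarrow> bool" where
  "cardinal \<kappa> \<longleftrightarrow> ordinal \<kappa> \<and>
    \<not> (\<exists>\<alpha> g. \<alpha> \<epsilon> \<kappa> \<and> func g \<alpha> \<kappa> \<and> injective g \<alpha> \<and> surjective g \<alpha> \<kappa>)"

definition natural :: "'v \<Rightarrow> bool" where
  "natural x \<longleftrightarrow> ordinal x \<and>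
    (\<forall>y. y \<epsilon> succ x \<longrightarrow> y = empty \<or> (\<exists>w. ordinal w \<and> y = succ w))"

definition omega :: 'v where "omega = setof natural"

text \<open>\<open>rank y = \<Union>{rank w + 1 | w \<in> y}\<close>, by recursion along a transitive set containing \<open>x\<close>.\<close>

definition is_rank :: "'v \<Rightarrow> 'v \<Rightarrow> bool" where
  "is_rank x \<alpha> \<longleftrightarrow> (\<exists>T B f. transitive T \<and> x \<epsilon> T \<and> func f T B \<and>
    (\<forall>y. y \<epsilon> T \<longrightarrow> app f y = setof (\<lambda>u. \<exists>w. w \<epsilon> y \<and> u \<epsilon> succ (app f w))) \<and>
    \<alpha> = app f x)"

definition rank :: "'v \<Rightarrow> 'v" where
  "rank x = (THE \<alpha>. is_rank x \<alpha>)"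

definition V :: "'v \<Rightarrow> 'v" where
  "V \<alpha> = setof (\<lambda>x. rank x \<epsilon> \<alpha>)"

section \<open>First-order languages, structures and satisfaction\<close>

definition symbols :: "'v language \<Rightarrow> 'v" where
  "symbols L = union2 (rels L) (funs L)"

definition is_language :: "'v language \<Rightarrow> bool" where
  "is_language L \<longleftrightarrow> \<not> (\<exists>x. x \<epsilon> rels L \<and> x \<epsilon> funs L) \<and> func (arity L) (symbols L) omega"

definition ar :: "'v language \<Rightarrow> 'v \<Rightarrow> 'v" where
  "ar L x = app (arity L) x"

text \<open>\<open>k\<close>-tuples are functions with domain \<open>k\<close>.\<close>

definition tuples :: "'v \<Rightarrow> 'v \<Rightarrow> 'v" where
  "tuples k U = setof (\<lambda>s. func s k U)"

definition univ :: "'v \<Rightarrow> 'v" where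
  "univ A = (THE U. \<exists>I. A = opair U I)"

definition interp :: "'v \<Rightarrow> 'v \<Rightarrow> 'v" where
  "interp A x = app (THE I. \<exists>U. A = opair U I) x"

definition is_structure :: "'v language \<Rightarrow> 'v \<Rightarrow> bool" where
  "is_structure L A \<longleftrightarrow> (\<exists>U I B. A = opair U I \<and> (\<exists>x. x \<epsilon> U) \<and> func I (symbols L) B \<and>
    (\<forall>R. R \<epsilon> rels L \<longrightarrow> (\<forall>s. s \<epsilon> app I R \<longrightarrow> func s (ar L R) U)) \<and>
    (\<forall>F. F \<epsilon> funs L \<longrightarrow> func (app I F) (tuples (ar L F) U) U))"

text \<open>Codes of terms and formulas; variables are indexed by elements of \<open>omega\<close>.\<close>

definition tvar :: "'v \<Rightarrow> 'v" where "tvar k = opair (num 0) k"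
definition tapp :: "'v \<Rightarrow> 'v \<Rightarrow> 'v" where "tapp F ts = opair (num 1) (opair F ts)"

definition is_term :: "'v language \<Rightarrow> 'v \<Rightarrow> bool" where
  "is_term L t \<longleftrightarrow> (\<forall>X.
    (\<forall>k. k \<epsilon> omega \<longrightarrow> tvar k \<epsilon> X) \<and>
    (\<forall>F ts. F \<epsilon> funs L \<longrightarrow> func ts (ar L F) X \<longrightarrow> tapp F ts \<epsilon> X)
    \<longrightarrow> t \<epsilon> X)"

definition all_terms :: "'v language \<Rightarrow> 'v" where
  "all_terms L = setof (is_term L)"

definition feq :: "'v \<Rightarrow> 'v \<Rightarrow> 'v" where "feq t u = opair (num 0) (opair t u)"
definition frel :: "'v \<Rightarrow> 'v \<Rightarrow> 'v" where "frel R ts = opair (num 1) (opair R ts)"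
definition fneg :: "'v \<Rightarrow> 'v" where "fneg c = opair (num 2) c"
definition fconj :: "'v \<Rightarrow> 'v \<Rightarrow> 'v" where "fconj c d = opair (num 3) (opair c d)"
definition fex :: "'v \<Rightarrow> 'v \<Rightarrow> 'v" where "fex k c = opair (num 4) (opair k c)"
definition fall :: "'v \<Rightarrow> 'v \<Rightarrow> 'v" where "fall k c = fneg (fex k (fneg c))"

definition is_formula :: "'v language \<Rightarrow> 'v \<Rightarrow> bool" where
  "is_formula L c \<longleftrightarrow> (\<forall>X.
    (\<forall>t u. is_term L t \<longrightarrow> is_term L u \<longrightarrow> feq t u \<epsilon> X) \<and>
    (\<forall>R ts. R \<epsilon> rels L \<longrightarrow> func ts (ar L R) (all_terms L) \<longrightarrow> frel R ts \<epsilon> X) \<and>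
    (\<forall>d. d \<epsilon> X \<longrightarrow> fneg d \<epsilon> X) \<and>
    (\<forall>d e. d \<epsilon> X \<longrightarrow> e \<epsilon> X \<longrightarrow> fconj d e \<epsilon> X) \<and>
    (\<forall>k d. k \<epsilon> omega \<longrightarrow> d \<epsilon> X \<longrightarrow> fex k d \<epsilon> X)
    \<longrightarrow> c \<epsilon> X)"

text \<open>Assignments are functions with domain \<open>omega\<close>.\<close>

definition upd :: "'v \<Rightarrow> 'v \<Rightarrow> 'v \<Rightarrow> 'v" where
  "upd s k a = lam omega (\<lambda>m. if m = k then a else app s m)"

definition evaluates :: "'v language \<Rightarrow> 'v \<Rightarrow> 'v \<Rightarrow> 'v \<Rightarrow> bool" where
  "evaluates L A s e \<longleftrightarrow> func e (all_terms L) (univ A) \<and>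
    (\<forall>k. k \<epsilon> omega \<longrightarrow> app e (tvar k) = app s k) \<and>
    (\<forall>F ts. F \<epsilon> funs L \<longrightarrow> func ts (ar L F) (all_terms L) \<longrightarrow>
      app e (tapp F ts) = app (interp A F) (lam (ar L F) (\<lambda>i. app e (app ts i))))"

definition tval :: "'v language \<Rightarrow> 'v \<Rightarrow> 'v \<Rightarrow> 'v \<Rightarrow> 'v" where
  "tval L A s t = (THE a. \<exists>e. evaluates L A s e \<and> a = app e t)"

text \<open>\<open>S\<close> satisfies the Tarski clauses as a set of pairs (formula code, assignment).\<close>

definition tarski :: "'v language \<Rightarrow> 'v \<Rightarrow> 'v \<Rightarrow> bool" where
  "tarski L A S \<longleftrightarrow> (\<forall>s. func s omega (univ A) \<longrightarrow>
    (\<forall>t u. is_term L t \<longrightarrow> is_term L u \<longrightarrow>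
      (opair (feq t u) s \<epsilon> S \<longleftrightarrow> tval L A s t = tval L A s u)) \<and>
    (\<forall>R ts. R \<epsilon> rels L \<longrightarrow> func ts (ar L R) (all_terms L) \<longrightarrow>
      (opair (frel R ts) s \<epsilon> S \<longleftrightarrow>
        lam (ar L R) (\<lambda>i. tval L A s (app ts i)) \<epsilon> interp A R)) \<and>
    (\<forall>c. is_formula L c \<longrightarrow> (opair (fneg c) s \<epsilon> S \<longleftrightarrow> \<not> opair c s \<epsilon> S)) \<and>
    (\<forall>c d. is_formula L c \<longrightarrow> is_formula L d \<longrightarrow>
      (opair (fconj c d) s \<epsilon> S \<longleftrightarrow> opair c s \<epsilon> S \<and> opair d s \<epsilon> S)) \<and>
    (\<forall>k c. k \<epsilon> omega \<longrightarrow> is_formula L c \<longrightarrow>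
      (opair (fex k c) s \<epsilon> S \<longleftrightarrow> (\<exists>a. a \<epsilon> univ A \<and> opair c (upd s k a) \<epsilon> S))))"

definition sat :: "'v language \<Rightarrow> 'v \<Rightarrow> 'v \<Rightarrow> 'v \<Rightarrow> bool" where
  "sat L A c s \<longleftrightarrow> (\<exists>S. tarski L A S \<and> opair c s \<epsilon> S)"

definition elementary :: "'v language \<Rightarrow> 'v \<Rightarrow> 'v \<Rightarrow> 'v \<Rightarrow> bool" where
  "elementary L A B h \<longleftrightarrow> func h (univ A) (univ B) \<and>
    (\<forall>c s. is_formula L c \<longrightarrow> func s omega (univ A) \<longrightarrow>
      (sat L A c s \<longleftrightarrow> sat L B c (lam omega (\<lambda>m. app h (app s m)))))"

section \<open>Berkeley cardinals\<close>

text \<open>The language of set theory has the single binary relation symbol \<open>empty\<close>.\<close>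

definition in_lang :: "'v language" where
  "in_lang = Language (upair empty empty) empty (lam (upair empty empty) (\<lambda>x. num 2))"

definition in_struct :: "'v \<Rightarrow> 'v" where
  "in_struct M = opair M (lam (upair empty empty) (\<lambda>x.
    setof (\<lambda>s. func s (num 2) M \<and> app s (num 0) \<epsilon> app s (num 1))))"

definition is_crit :: "'v \<Rightarrow> 'v \<Rightarrow> 'v \<Rightarrow> bool" where
  "is_crit M j \<kappa> \<longleftrightarrow> ordinal \<kappa> \<and> \<kappa> \<epsilon> M \<and> app j \<kappa> \<noteq> \<kappa> \<and> (\<forall>\<alpha>. \<alpha> \<epsilon> \<kappa> \<longrightarrow> app j \<alpha> = \<alpha>)"

text \<open>
  Nonemptiness is part of the definition because \<open>0\<close> would satisfy the remaining clause vacuously.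
\<close>

definition berkeley :: "'v \<Rightarrow> bool" where
  "berkeley \<delta> \<longleftrightarrow> ordinal \<delta> \<and> (\<exists>x. x \<epsilon> \<delta>) \<and>
    (\<forall>M \<eta>. transitive M \<longrightarrow> \<delta> \<epsilon> M \<longrightarrow> \<eta> \<epsilon> \<delta> \<longrightarrow>
      (\<exists>j \<kappa>. elementary in_lang (in_struct M) (in_struct M) j \<and>
        (\<exists>x. x \<epsilon> M \<and> app j x \<noteq> x) \<and> is_crit M j \<kappa> \<and> \<eta> \<epsilon> \<kappa> \<and> \<kappa> \<epsilon> \<delta>))"

definition least_berkeley :: "'v \<Rightarrow> bool" where
  "least_berkeley \<delta> \<longleftrightarrow> berkeley \<delta> \<and> (\<forall>\<alpha>. \<alpha> \<epsilon> \<delta> \<longrightarrow> \<not> berkeley \<alpha>)"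

section \<open>Classes definable by formulas of the Levy hierarchy\<close>

text \<open>
  Formulas are codes in the model, so that a single set of the model can be asserted to work for
  all definable classes at once.  All codes of actual formulas are included.  The level \<open>n\<close> of the
  hierarchy is an actual natural number, and truth of \<open>\<Sigma>\<^sub>n\<close>-formulas in the universe is given by the
  usual partial truth predicates, starting from satisfaction of \<open>\<Delta>\<^sub>0\<close>-formulas in transitive sets.
\<close>

definition fmem :: "'v \<Rightarrow> 'v \<Rightarrow> 'v" where
  "fmem i k = frel empty (lam (num 2) (\<lambda>m. if m = num 0 then tvar i else tvar k))"

definition is_delta0 :: "'v \<Rightarrow> bool" where
  "is_delta0 c \<longleftrightarrow> (\<forall>X.
    (\<forall>i k. i \<epsilon> omega \<longrightarrow> k \<epsilon> omega \<longrightarrow> feq (tvar i) (tvar k) \<epsilon> X) \<and>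
    (\<forall>i k. i \<epsilon> omega \<longrightarrow> k \<epsilon> omega \<longrightarrow> fmem i k \<epsilon> X) \<and>
    (\<forall>d. d \<epsilon> X \<longrightarrow> fneg d \<epsilon> X) \<and>
    (\<forall>d e. d \<epsilon> X \<longrightarrow> e \<epsilon> X \<longrightarrow> fconj d e \<epsilon> X) \<and>
    (\<forall>i k d. i \<epsilon> omega \<longrightarrow> k \<epsilon> omega \<longrightarrow> i \<noteq> k \<longrightarrow> d \<epsilon> X \<longrightarrow> fex i (fconj (fmem i k) d) \<epsilon> X)
    \<longrightarrow> c \<epsilon> X)"

fun is_sigma :: "nat \<Rightarrow> 'v \<Rightarrow> bool" and is_pi :: "nat \<Rightarrow> 'v \<Rightarrow> bool" where
  "is_sigma 0 c = is_delta0 c"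
| "is_sigma (Suc n) c = (\<exists>k d. k \<epsilon> omega \<and> is_pi n d \<and> c = fex k d)"
| "is_pi 0 c = is_delta0 c"
| "is_pi (Suc n) c = (\<exists>k d. k \<epsilon> omega \<and> is_sigma n d \<and> c = fall k d)"

definition delta0_true :: "'v \<Rightarrow> 'v \<Rightarrow> bool" where
  "delta0_true c s \<longleftrightarrow> (\<exists>T. transitive T \<and> func s omega T \<and> sat in_lang (in_struct T) c s)"

fun sigma_true :: "nat \<Rightarrow> 'v \<Rightarrow> 'v \<Rightarrow> bool" and pi_true :: "nat \<Rightarrow> 'v \<Rightarrow> 'v \<Rightarrow> bool" where
  "sigma_true 0 c s = delta0_true c s"
| "sigma_true (Suc n) c s = (\<exists>k d. k \<epsilon> omega \<and> c = fex k d \<and> (\<exists>x. pi_true n d (upd s k x)))"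
| "pi_true 0 c s = delta0_true c s"
| "pi_true (Suc n) c s = (\<exists>k d. k \<epsilon> omega \<and> c = fall k d \<and> (\<forall>x. sigma_true n d (upd s k x)))"

text \<open>The variable \<open>0\<close> stands for the candidate element, every other free variable for \<open>z\<close>.\<close>

definition sigma_definable :: "nat \<Rightarrow> 'v \<Rightarrow> ('v \<Rightarrow> bool) \<Rightarrow> bool" where
  "sigma_definable n z C \<longleftrightarrow> (\<exists>c. is_sigma n c \<and>
    (\<forall>x. C x \<longleftrightarrow> sigma_true n c (lam omega (\<lambda>m. if m = num 0 then x else z))))"

section \<open>Square roots and exact structural reflection\<close>

text \<open>\<open>P\<close> enumerates the distinguished unary predicate symbols, without repetitions.\<close>

definition unary_predicates :: "'v language \<Rightarrow> 'v \<Rightarrow> bool" where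
  "unary_predicates L P \<longleftrightarrow> func P omega (rels L) \<and> injective P omega \<and>
    (\<forall>m. m \<epsilon> omega \<longrightarrow> ar L (app P m) = num 1)"

text \<open>
  The language has no more than \<open>V\<^bsub>\<alpha>\<^esub>\<close> many symbols for some \<open>\<alpha> < \<delta>\<close>; for instance, it is
  countable.  Without such a bound even the interpretation of every element of \<open>V\<^bsub>\<delta>\<^esub>\<close> by a
  constant of its own would be allowed, which rules out all elementary embeddings but the identity.
\<close>

definition small_language :: "'v language \<Rightarrow> 'v \<Rightarrow> bool" where
  "small_language L \<delta> \<longleftrightarrow>
    (\<exists>\<alpha> i. \<alpha> \<epsilon> \<delta> \<and> func i (symbols L) (V \<alpha>) \<and> injective i (symbols L))"

text \<open>
  A unary relation is interpreted by a set of 1-tuples; \<open>pred_ext\<close> is the corresponding subset of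
  the universe, so that its rank does not depend on the coding of tuples.
\<close>

definition pred_ext :: "'v \<Rightarrow> 'v \<Rightarrow> 'v" where
  "pred_ext A R = setof (\<lambda>a. a \<epsilon> univ A \<and> lam (num 1) (\<lambda>i. a) \<epsilon> interp A R)"

definition card_sequence :: "'v \<Rightarrow> bool" where
  "card_sequence l \<longleftrightarrow> (\<exists>B. func l omega B) \<and>
    (\<forall>m. m \<epsilon> omega \<longrightarrow> cardinal (app l m)) \<and>
    (\<forall>m k. k \<epsilon> omega \<longrightarrow> m \<epsilon> k \<longrightarrow> app l m \<epsilon> app l k)"

definition seq_sup :: "'v \<Rightarrow> 'v" where
  "seq_sup l = setof (\<lambda>x. \<exists>m. m \<epsilon> omega \<and> x \<epsilon> app l m)"

definition shift :: "'v \<Rightarrow> 'v" where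
  "shift l = lam omega (\<lambda>m. app l (succ m))"

definition has_type :: "'v \<Rightarrow> 'v \<Rightarrow> 'v \<Rightarrow> bool" where
  "has_type P A l \<longleftrightarrow> rank (univ A) = seq_sup l \<and>
    (\<forall>m. m \<epsilon> omega \<longrightarrow> rank (pred_ext A (app P m)) = app l m)"

text \<open>\<open>f\<^sub>+(A)\<close> for \<open>f: V\<^bsub>\<theta>\<^esub> \<rightarrow> V\<^bsub>\<theta>\<^esub>\<close>\<close>

definition plus_ext :: "'v \<Rightarrow> 'v \<Rightarrow> 'v \<Rightarrow> 'v" where
  "plus_ext \<theta> f A = setof (\<lambda>y. \<exists>\<alpha>. \<alpha> \<epsilon> \<theta> \<and> y \<epsilon> app f (inter2 A (V \<alpha>)))"

definition square_root :: "'v \<Rightarrow> 'v \<Rightarrow> 'v \<Rightarrow> bool" where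
  "square_root \<theta> f r \<longleftrightarrow> func r (V \<theta>) (V \<theta>) \<and> plus_ext \<theta> r r = f"

definition sqrt_ESR :: "'v language \<Rightarrow> 'v \<Rightarrow> ('v \<Rightarrow> bool) \<Rightarrow> 'v \<Rightarrow> bool" where
  "sqrt_ESR L P C l \<longleftrightarrow> (\<exists>f. func f (V (seq_sup l)) (V (seq_sup l)) \<and>
    (\<forall>B. C B \<longrightarrow> has_type P B (shift l) \<longrightarrow>
      (\<exists>A r. C A \<and> has_type P A l \<and> square_root (seq_sup l) f r \<and>
        elementary L A B (lam (univ A) (app r)))))"

end

end

theory Submission imports Defs begin

text \<open>
  Let \<open>j: V\<^bsub>\<theta>\<^esub> \<rightarrow> V\<^bsub>\<theta>\<^esub>\<close> be elementary with critical sequence \<open>\<lambda>\<^sub>0 < \<lambda>\<^sub>1 < \<dots>\<close> of supremum \<open>\<lambda> < \<delta>\<close>, let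
  \<open>r = j \<restriction> V\<^bsub>\<lambda>\<^esub>\<close>, and use \<open>f = r\<close>.  If \<open>B \<in> C\<close> has type \<open>(\<lambda>\<^sub>m\<^sub>+\<^sub>1)\<^sub>m = j((\<lambda>\<^sub>m)\<^sub>m)\<close>, then \<open>r\<close> is a square root of
  \<open>j(f) = r\<^sub>+(r)\<close> and embeds \<open>B\<close> elementarily into \<open>j(B)\<close>.  So there are \<open>A \<in> C\<close> of type \<open>j((\<lambda>\<^sub>m)\<^sub>m)\<close> and a square root
  of \<open>j(f)\<close> that embeds \<open>A\<close> into \<open>j(B)\<close>, namely \<open>B\<close> and \<open>r\<close>; pulling this back along \<open>j\<close> gives \<open>A \<in> C\<close> of type
  \<open>(\<lambda>\<^sub>m)\<^sub>m\<close> and a square root of \<open>f\<close> that embeds \<open>A\<close> into \<open>B\<close>.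

  The pullback needs no reflection theorem: the restriction to \<open>V\<^bsub>\<theta>\<^esub>\<close> of any definable relation is a
  set, and a Berkeley embedding of the transitive closure of \<open>{t}\<close> fixes \<open>t\<close>.  Hence \<open>j\<close> can be chosen to
  preserve finitely many arbitrary definable relations.
\<close>

section \<open>Definability\<close>

text \<open>The axiom schemas of the model speak only about first-order formulas, whereas its
  notions are HOL definitions built with \<open>THE\<close>. So each set that is formed by a schema
  and each internal induction needs a certificate of definability, which the calculus of
  \<open>dfp\<close> and \<open>dft\<close> provides. The natural numbers of the model may be
  nonstandard, so tuples and codes of formulas are treated by induction inside the model; only the
  level \<open>n\<close> is an actual number, which makes \<open>sigma_true n\<close> a single
  definable relation. One sequence has to serve all classes at once.\<close>

primrec ren :: "(nat \<Rightarrow> nat) \<Rightarrow> fm \<Rightarrow> fm" where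
  "ren f (FIn i k) = FIn (f i) (f k)"
| "ren f (FEq i k) = FEq (f i) (f k)"
| "ren f (FNot p) = FNot (ren f p)"
| "ren f (FAnd p q) = FAnd (ren f p) (ren f q)"
| "ren f (FEx i p) = FEx (f i) (ren f p)"

text \<open>Injectivity excludes variable capture: an update at \<open>f i\<close> is seen through
  \<open>f\<close> as an update at \<open>i\<close> only.\<close>

lemma holds_ren: "inj f \<Longrightarrow> holds E (ren f p) s = holds E p (\<lambda>i. s (f i))"
proof (induction p arbitrary: s)
  case (FEx i p)
  have "(\<lambda>k. (s(f i := x)) (f k)) = (\<lambda>k. s (f k))(i := x)" for x
    using FEx.prems by (auto simp: fun_eq_iff inj_eq)
  then show ?case using FEx by simp
qed auto

primrec vbound :: "fm \<Rightarrow> nat" where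
  "vbound (FIn i k) = Suc (max i k)"
| "vbound (FEq i k) = Suc (max i k)"
| "vbound (FNot p) = vbound p"
| "vbound (FAnd p q) = max (vbound p) (vbound q)"
| "vbound (FEx i p) = vbound p"

text \<open>Serves two purposes: a constantly true \<open>M\<close> gives back \<open>holds\<close>,
  and membership in a set of the model gives the external truth with which the internal
  \<open>sat\<close> is compared.\<close>

primrec rholds :: "('v \<Rightarrow> 'v \<Rightarrow> bool) \<Rightarrow> ('v \<Rightarrow> bool) \<Rightarrow> fm \<Rightarrow> (nat \<Rightarrow> 'v) \<Rightarrow> bool" where
  "rholds E M (FIn i k) s = E (s i) (s k)"
| "rholds E M (FEq i k) s = (s i = s k)"
| "rholds E M (FNot p) s = (\<not> rholds E M p s)"
| "rholds E M (FAnd p q) s = (rholds E M p s \<and> rholds E M q s)"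
| "rholds E M (FEx i p) s = (\<exists>x. M x \<and> rholds E M p (s(i := x)))"

lemma rholds_UNIV: "rholds E (\<lambda>_. True) p s = holds E p s"
  by (induction p arbitrary: s) simp_all

lemma rholds_vbound: "(\<And>i. i < vbound p \<Longrightarrow> s i = s' i) \<Longrightarrow> rholds E M p s = rholds E M p s'"
proof (induction p arbitrary: s s')
  case (FIn i k)
  have "s i = s' i" "s k = s' k" by (rule FIn; simp)+
  then show ?case by simp
next
  case (FEq i k)
  have "s i = s' i" "s k = s' k" by (rule FEq; simp)+
  then show ?case by simp
next
  case (FNot p)
  have "rholds E M p s = rholds E M p s'" by (rule FNot.IH, rule FNot.prems) simp
  then show ?case by simp
next
  case (FAnd p q)
  have "rholds E M p s = rholds E M p s'" by (rule FAnd.IH, rule FAnd.prems) simp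
  moreover have "rholds E M q s = rholds E M q s'" by (rule FAnd.IH, rule FAnd.prems) simp
  ultimately show ?case by simp
next
  case (FEx i p)
  have "rholds E M p (s(i := x)) = rholds E M p (s'(i := x))" for x
    by (rule FEx.IH) (simp add: FEx.prems)
  then show ?case by simp
qed

lemma holds_vbound: "(\<And>i. i < vbound p \<Longrightarrow> s i = s' i) \<Longrightarrow> holds E p s = holds E p s'"
  unfolding rholds_UNIV[symmetric] by (rule rholds_vbound)

text \<open>Variables occupy the even slots and parameters the odd ones, so that a formula may use
  arbitrary parameters without disturbing the numbering of its variables.\<close>

definition mix :: "(nat \<Rightarrow> 'v) \<Rightarrow> (nat \<Rightarrow> 'v) \<Rightarrow> nat \<Rightarrow> 'v" where
  "mix s c i = (if even i then s (i div 2) else c (i div 2))"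

definition definable :: "('v \<Rightarrow> 'v \<Rightarrow> bool) \<Rightarrow> ((nat \<Rightarrow> 'v) \<Rightarrow> bool) \<Rightarrow> bool" where
  "definable E Q \<longleftrightarrow> (\<exists>p c. \<forall>s. Q s = holds E p (mix s c))"

lemma definable_cong: "definable E Q \<Longrightarrow> (\<And>s. Q s = R s) \<Longrightarrow> definable E R"
  by (simp add: definable_def)

lemma nat_parity_cases:
  obtains k where "(i::nat) = 2 * k" | k where "i = 2 * k + 1" by (metis evenE oddE)

lemma definable_inj:
  assumes "definable E Q" "inj f" shows "definable E (\<lambda>s. Q (\<lambda>i. s (f i)))"
proof -
  obtain p c where p: "\<And>s. Q s = holds E p (mix s c)" using assms(1) by (auto simp: definable_def)
  define g where "g i = (if even i then 2 * f (i div 2) else i)" for i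
  have "inj g"
  proof (rule injI)
    fix x y assume "g x = g y"
    then show "x = y" by (cases x rule: nat_parity_cases; cases y rule: nat_parity_cases)
        (simp_all add: g_def inj_eq[OF assms(2)] Suc_double_not_eq_double double_not_eq_Suc_double)
  qed
  moreover have "(\<lambda>i. mix s c (g i)) = mix (\<lambda>i. s (f i)) c" for s
    by (auto simp: g_def mix_def fun_eq_iff)
  ultimately have "Q (\<lambda>i. s (f i)) = holds E (ren g p) (mix s c)" for s
    by (simp add: holds_ren p)
  then show ?thesis by (auto simp: definable_def)
qed

lemma definable_not: "definable E Q \<Longrightarrow> definable E (\<lambda>s. \<not> Q s)"
  unfolding definable_def by (metis holds.simps(3))

lemma definable_conj:
  assumes "definable E Q" "definable E R" shows "definable E (\<lambda>s. Q s \<and> R s)"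
proof -
  obtain p c where p: "\<And>s. Q s = holds E p (mix s c)" using assms(1) by (auto simp: definable_def)
  obtain q d where q: "\<And>s. R s = holds E q (mix s d)" using assms(2) by (auto simp: definable_def)
  \<comment> \<open>The two parameter lists are interleaved as well: those of \<open>p\<close> move
    to the slots 4k+1 and those of \<open>q\<close> to the slots 4k+3.\<close>
  define g where "g i = (if even i then i else 4 * (i div 2) + 1)" for i :: nat
  define h where "h i = (if even i then i else 4 * (i div 2) + 3)" for i :: nat
  define e where "e i = (if even i then c (i div 2) else d (i div 2))" for i
  have "inj g"
  proof (rule injI)
    fix x y assume "g x = g y"
    then show "x = y" by (cases x rule: nat_parity_cases; cases y rule: nat_parity_cases)
        (simp_all add: g_def, arith+)
  qed
  moreover have "inj h"
  proof (rule injI)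
    fix x y assume "h x = h y"
    then show "x = y" by (cases x rule: nat_parity_cases; cases y rule: nat_parity_cases)
        (simp_all add: h_def, arith+)
  qed
  moreover have "(4 * b + 3) div 2 = Suc (2 * b)" for b :: nat by presburger
  then have "(\<lambda>i. mix s e (g i)) = mix s c" "(\<lambda>i. mix s e (h i)) = mix s d" for s
    by (auto simp: g_def h_def e_def mix_def fun_eq_iff elim!: oddE)
  ultimately have "(Q s \<and> R s) = holds E (FAnd (ren g p) (ren h q)) (mix s e)" for s
    by (simp add: holds_ren p q)
  then show ?thesis unfolding definable_def by blast
qed

lemma definable_ex:
  assumes "definable E Q" shows "definable E (\<lambda>s. \<exists>x. Q (case_nat x s))"
proof -
  obtain p c where p: "\<And>s. Q s = holds E p (mix s c)" using assms(1) by (auto simp: definable_def)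
  \<comment> \<open>The quantified variable goes to slot 1, the first parameter slot, which is
    vacated by moving all parameters up by one; the other variables move down by one.\<close>
  define g where "g i = (if i = 0 then 1 else if even i then i - 2 else i + 2)" for i :: nat
  have "inj g"
  proof (rule injI)
    fix x y assume "g x = g y"
    then show "x = y" by (cases x rule: nat_parity_cases; cases y rule: nat_parity_cases)
        (simp_all add: g_def split: if_splits, arith+)
  qed
  have *: "(\<lambda>i. ((mix s (case_nat undefined c))(1 := x)) (g i)) = mix (case_nat x s) c" for s x
  proof
    fix i
    consider "i = 0" | k where "i = 2 * Suc k" | k where "i = 2 * k + 1"
      by (metis mult_0_right nat_parity_cases not0_implies_Suc)
    then show "((mix s (case_nat undefined c))(1 := x)) (g i) = mix (case_nat x s) c i"
      by cases (simp_all add: g_def mix_def)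
  qed
  have "(\<exists>x. Q (case_nat x s)) = holds E (FEx 1 (ren g p)) (mix s (case_nat undefined c))" for s
    unfolding holds.simps holds_ren[OF \<open>inj g\<close>] * p ..
  then show ?thesis unfolding definable_def by blast
qed

lemma definable_mem: "definable E (\<lambda>s. E (s i) (s k))"
  unfolding definable_def by (rule exI[of _ "FIn (2*i) (2*k)"]) (simp add: mix_def)

lemma definable_eq: "definable E (\<lambda>s. s i = s k)"
  unfolding definable_def by (rule exI[of _ "FEq (2*i) (2*k)"]) (simp add: mix_def)

lemma definable_eq_const: "definable E (\<lambda>s. s i = c)"
  unfolding definable_def
  by (rule exI[of _ "FEq (2*i) 1"], rule exI[of _ "\<lambda>_. c"]) (simp add: mix_def)

lemma definable_support:
  assumes "definable E Q"
  obtains N where "\<And>s s'. (\<And>i. i < N \<Longrightarrow> s i = s' i) \<Longrightarrow> Q s = Q s'"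
proof -
  obtain p c where p: "\<And>s. Q s = holds E p (mix s c)" using assms(1) by (auto simp: definable_def)
  have "Q s = Q s'" if "\<And>i. i < vbound p \<Longrightarrow> s i = s' i" for s s'
    unfolding p by (rule holds_vbound) (use that in \<open>auto simp: mix_def intro!: that\<close>)
  then show ?thesis using that by blast
qed

text \<open>Only finitely many variables matter (\<open>definable_support\<close>), so the
  simultaneous substitution reduces to finitely many eliminations of the form
  \<open>\<exists>y. y = t N s \<and> ...\<close>, carried out from the highest variable
  downwards.\<close>

lemma definable_subst:
  assumes Q: "definable E Q" and t: "\<And>i. definable E (\<lambda>s. s 0 = t i (\<lambda>k. s (Suc k)))"
  shows "definable E (\<lambda>s. Q (\<lambda>i. t i s))"
proof -
  have *: "definable E (\<lambda>s. W (\<lambda>i. if i < N then t i s else s (i - N)))" if "definable E W" for W N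
    using that
  proof (induction N arbitrary: W)
    case (Suc N)
    define f where "f i = (if i < N then Suc i else if i = N then 0 else i)" for i
    define g where "g i = (case i of 0 \<Rightarrow> 0 | Suc k \<Rightarrow> Suc (k + N))" for i
    have "inj f" "inj g" by (rule injI; auto simp: f_def g_def split: if_splits nat.splits)+
    note d = definable_ex[OF definable_conj[OF definable_inj[OF t[of N] \<open>inj g\<close>]
        definable_inj[OF Suc.prems \<open>inj f\<close>]]]
    have "definable E (\<lambda>u. \<exists>y. y = t N (\<lambda>k. u (k + N)) \<and>
        W (\<lambda>i. if i < N then u i else if i = N then y else u (i - 1)))"
      by (rule definable_cong[OF d])
        (intro arg_cong[of _ _ Ex] ext conj_cong arg_cong[of _ _ W], auto simp: f_def g_def split: nat.splits)
    note d = Suc.IH[OF this]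
    have e: "(if i < N then if i < N then t i s else s (i - N) else if i = N then t N s
        else if i - 1 < N then t (i - 1) s else s (i - 1 - N)) = (if i < Suc N then t i s else s (i - Suc N))" for i s
      by (cases "i < N"; cases "i = N") auto
    show ?case
      by (rule definable_cong[OF d]) (simp only: simp_thms not_add_less2 if_False add_diff_cancel_right' e)
  qed (use that in simp)
  obtain N where N: "\<And>s s'. (\<And>i. i < N \<Longrightarrow> s i = s' i) \<Longrightarrow> Q s = Q s'"
    by (rule definable_support[OF Q]) blast
  show ?thesis
    by (rule back_subst[of "definable E", OF *[OF Q, of N]]) (auto simp: fun_eq_iff intro!: N)
qed

text \<open>
  Definite descriptions have unknown, possibly undefinable values outside their domain.
  Definability is therefore taken relative to a guard \<open>G\<close>.
  Assignments are read as de Bruijn environments: under a binder, \<open>s 0\<close> is the bound variable and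
  \<open>\<lambda>i. s (Suc i)\<close> the outer assignment.
\<close>

definition dfp :: "('v \<Rightarrow> 'v \<Rightarrow> bool) \<Rightarrow> ((nat \<Rightarrow> 'v) \<Rightarrow> bool) \<Rightarrow> ((nat \<Rightarrow> 'v) \<Rightarrow> bool) \<Rightarrow> bool" where
  "dfp E G Q \<longleftrightarrow> (\<exists>Q'. definable E Q' \<and> (\<forall>s. G s \<longrightarrow> Q s = Q' s))"

definition dft :: "('v \<Rightarrow> 'v \<Rightarrow> bool) \<Rightarrow> ((nat \<Rightarrow> 'v) \<Rightarrow> bool) \<Rightarrow> ((nat \<Rightarrow> 'v) \<Rightarrow> 'v) \<Rightarrow> bool" where
  "dft E G t \<longleftrightarrow> (\<exists>t'. definable E (\<lambda>s. s 0 = t' (\<lambda>k. s (Suc k))) \<and> (\<forall>s. G s \<longrightarrow> t s = t' s))"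

text \<open>Closure rules of the calculus. Applied with \<open>intro\<close>, they reduce
  definability of a concrete notion to side conditions saying that its partial operations are used
  where they are defined.\<close>

named_theorems dfi

lemma dft_const [dfi]: "dft E G (\<lambda>s. c)"
  unfolding dft_def using definable_eq_const by fast

lemma dft_var [dfi]: "dft E G (\<lambda>s. s k)"
  unfolding dft_def by (rule exI[of _ "\<lambda>s. s k"]) (simp add: definable_eq)

lemma dfp_weaken: "dfp E H Q \<Longrightarrow> (\<And>s. G s \<Longrightarrow> H s) \<Longrightarrow> dfp E G Q"
  unfolding dfp_def by blast

lemma dft_weaken: "dft E H t \<Longrightarrow> (\<And>s. G s \<Longrightarrow> H s) \<Longrightarrow> dft E G t"
  unfolding dft_def by blast

lemma dfp_cong: "dfp E G R \<Longrightarrow> (\<And>s. G s \<Longrightarrow> Q s = R s) \<Longrightarrow> dfp E G Q"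
  unfolding dfp_def by blast

lemma dfp_subst:
  assumes "dfp E H Q" "\<And>i. dft E G (t i)" "\<And>s. G s \<Longrightarrow> H (\<lambda>i. t i s)"
  shows "dfp E G (\<lambda>s. Q (\<lambda>i. t i s))"
proof -
  obtain Q' where Q': "definable E Q'" "\<And>s. H s \<Longrightarrow> Q s = Q' s" using assms(1) by (auto simp: dfp_def)
  obtain t' where t': "\<And>i. definable E (\<lambda>s. s 0 = t' i (\<lambda>k. s (Suc k)))" "\<And>i s. G s \<Longrightarrow> t i s = t' i s"
    using choice[of "\<lambda>i t'. definable E (\<lambda>s. s 0 = t' (\<lambda>k. s (Suc k))) \<and> (\<forall>s. G s \<longrightarrow> t i s = t' s)"]
      assms(2) unfolding dft_def by blast
  show ?thesis unfolding dfp_def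
    using definable_subst[of E Q' t', OF Q'(1) t'(1)] Q'(2) t'(2) assms(3)
    by (intro exI[of _ "\<lambda>s. Q' (\<lambda>i. t' i s)"]) auto
qed

lemma dft_subst:
  assumes "dft E H u" "\<And>i. dft E G (t i)" "\<And>s. G s \<Longrightarrow> H (\<lambda>i. t i s)"
  shows "dft E G (\<lambda>s. u (\<lambda>i. t i s))"
proof -
  obtain u' where u': "definable E (\<lambda>s. s 0 = u' (\<lambda>k. s (Suc k)))" "\<And>s. H s \<Longrightarrow> u s = u' s"
    using assms(1) by (auto simp: dft_def)
  obtain t' where t': "\<And>i. definable E (\<lambda>s. s 0 = t' i (\<lambda>k. s (Suc k)))" "\<And>i s. G s \<Longrightarrow> t i s = t' i s"
    using choice[of "\<lambda>i t'. definable E (\<lambda>s. s 0 = t' (\<lambda>k. s (Suc k))) \<and> (\<forall>s. G s \<longrightarrow> t i s = t' s)"]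
      assms(2) unfolding dft_def by blast
  define r where "r i = (case i of 0 \<Rightarrow> (\<lambda>s. s 0) | Suc k \<Rightarrow> \<lambda>s. t' k (\<lambda>m. s (Suc m)))" for i
  have "definable E (\<lambda>s. s 0 = r i (\<lambda>k. s (Suc k)))" for i
  proof (cases i)
    case 0 then show ?thesis by (simp add: r_def definable_eq)
  next
    case (Suc k)
    have "inj (\<lambda>m. case m of 0 \<Rightarrow> 0 | Suc q \<Rightarrow> Suc (Suc q))" by (rule injI) (auto split: nat.splits)
    from definable_inj[OF t'(1)[of k] this] Suc show ?thesis by (simp add: r_def)
  qed
  from definable_subst[of E "\<lambda>s. s 0 = u' (\<lambda>k. s (Suc k))" r, OF u'(1) this]
  have "definable E (\<lambda>s. s 0 = u' (\<lambda>k. t' k (\<lambda>m. s (Suc m))))" by (simp add: r_def)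
  then show ?thesis unfolding dft_def using u'(2) t'(2) assms(3)
    by (intro exI[of _ "\<lambda>s. u' (\<lambda>i. t' i s)"]) auto
qed

lemma dfp_shift:
  assumes "dfp E (\<lambda>s. G (\<lambda>i. s (Suc i)) (s 0)) (\<lambda>s. Q (\<lambda>i. s (Suc i)) (s 0))"
  shows "dfp E (\<lambda>s. G (\<lambda>i. s (Suc (Suc i))) (s 0)) (\<lambda>s. Q (\<lambda>i. s (Suc (Suc i))) (s 0))"
  using dfp_subst[OF assms, of "\<lambda>s. G (\<lambda>i. s (Suc (Suc i))) (s 0)"
    "\<lambda>i s. s (case i of 0 \<Rightarrow> 0 | Suc k \<Rightarrow> Suc (Suc k))"] by (simp add: dft_var)

lemma dft_shift:
  assumes "dft E (\<lambda>s. G (\<lambda>i. s (Suc i)) (s 0)) (\<lambda>s. Q (\<lambda>i. s (Suc i)) (s 0))"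
  shows "dft E (\<lambda>s. G (\<lambda>i. s (Suc (Suc i))) (s 0)) (\<lambda>s. Q (\<lambda>i. s (Suc (Suc i))) (s 0))"
  using dft_subst[OF assms, of "\<lambda>s. G (\<lambda>i. s (Suc (Suc i))) (s 0)"
    "\<lambda>i s. s (case i of 0 \<Rightarrow> 0 | Suc k \<Rightarrow> Suc (Suc k))"] by (simp add: dft_var)

text \<open>This rule and its variants turn definability of a notion in plain variables, under a
  condition \<open>H\<close> on its arguments, into a closure rule for arbitrary terms as
  arguments.\<close>

lemma dfp_sub1:
  assumes "dfp E (\<lambda>s. H (s 0)) (\<lambda>s. R (s 0))" "dft E G a" "\<And>s. G s \<Longrightarrow> H (a s)"
  shows "dfp E G (\<lambda>s. R (a s))"
  using dfp_subst[OF assms(1), of G "\<lambda>i s. a s"] assms by simp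

lemma dft_sub1:
  assumes "dft E (\<lambda>s. H (s 0)) (\<lambda>s. R (s 0))" "dft E G a" "\<And>s. G s \<Longrightarrow> H (a s)"
  shows "dft E G (\<lambda>s. R (a s))"
  using dft_subst[OF assms(1), of G "\<lambda>i s. a s"] assms by simp

lemma dfp_sub2:
  assumes "dfp E (\<lambda>s. H (s 0) (s (Suc 0))) (\<lambda>s. R (s 0) (s (Suc 0)))" "dft E G a" "dft E G b"
    "\<And>s. G s \<Longrightarrow> H (a s) (b s)"
  shows "dfp E G (\<lambda>s. R (a s) (b s))"
proof -
  let ?t = "(case_nat a (\<lambda>_. b))"
  have "dft E G (?t i)" for i using assms(2-3) by (simp split: nat.split)
  then have "dfp E G (\<lambda>s. R (?t 0 s) (?t (Suc 0) s))"
    by (rule dfp_subst[OF assms(1), where t = ?t]) (simp add: assms(4))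
  then show ?thesis by simp
qed

lemma dft_sub2:
  assumes "dft E (\<lambda>s. H (s 0) (s (Suc 0))) (\<lambda>s. R (s 0) (s (Suc 0)))" "dft E G a" "dft E G b"
    "\<And>s. G s \<Longrightarrow> H (a s) (b s)"
  shows "dft E G (\<lambda>s. R (a s) (b s))"
proof -
  let ?t = "(case_nat a (\<lambda>_. b))"
  have "dft E G (?t i)" for i using assms(2-3) by (simp split: nat.split)
  then have "dft E G (\<lambda>s. R (?t 0 s) (?t (Suc 0) s))"
    by (rule dft_subst[OF assms(1), where t = ?t]) (simp add: assms(4))
  then show ?thesis by simp
qed

lemma dfp_sub3:
  assumes "dfp E (\<lambda>s. H (s 0) (s (Suc 0)) (s (Suc (Suc 0)))) (\<lambda>s. R (s 0) (s (Suc 0)) (s (Suc (Suc 0))))"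
    "dft E G a" "dft E G b" "dft E G c" "\<And>s. G s \<Longrightarrow> H (a s) (b s) (c s)"
  shows "dfp E G (\<lambda>s. R (a s) (b s) (c s))"
proof -
  let ?t = "(case_nat a (case_nat b (\<lambda>_. c)))"
  have "dft E G (?t i)" for i using assms(2-4) by (simp split: nat.split)
  then have "dfp E G (\<lambda>s. R (?t 0 s) (?t (Suc 0) s) (?t (Suc (Suc 0)) s))"
    by (rule dfp_subst[OF assms(1), where t = ?t]) (simp add: assms(5))
  then show ?thesis by simp
qed

lemma dft_sub3:
  assumes "dft E (\<lambda>s. H (s 0) (s (Suc 0)) (s (Suc (Suc 0)))) (\<lambda>s. R (s 0) (s (Suc 0)) (s (Suc (Suc 0))))"
    "dft E G a" "dft E G b" "dft E G c" "\<And>s. G s \<Longrightarrow> H (a s) (b s) (c s)"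
  shows "dft E G (\<lambda>s. R (a s) (b s) (c s))"
proof -
  let ?t = "(case_nat a (case_nat b (\<lambda>_. c)))"
  have "dft E G (?t i)" for i using assms(2-4) by (simp split: nat.split)
  then have "dft E G (\<lambda>s. R (?t 0 s) (?t (Suc 0) s) (?t (Suc (Suc 0)) s))"
    by (rule dft_subst[OF assms(1), where t = ?t]) (simp add: assms(5))
  then show ?thesis by simp
qed

lemma dfp_sub4:
  assumes "dfp E (\<lambda>s. H (s 0) (s (Suc 0)) (s (Suc (Suc 0))) (s (Suc (Suc (Suc 0)))))
      (\<lambda>s. R (s 0) (s (Suc 0)) (s (Suc (Suc 0))) (s (Suc (Suc (Suc 0)))))"
    "dft E G a" "dft E G b" "dft E G c" "dft E G d" "\<And>s. G s \<Longrightarrow> H (a s) (b s) (c s) (d s)"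
  shows "dfp E G (\<lambda>s. R (a s) (b s) (c s) (d s))"
proof -
  let ?t = "(case_nat a (case_nat b (case_nat c (\<lambda>_. d))))"
  have "dft E G (?t i)" for i using assms(2-5) by (simp split: nat.split)
  then have "dfp E G (\<lambda>s. R (?t 0 s) (?t (Suc 0) s) (?t (Suc (Suc 0)) s) (?t (Suc (Suc (Suc 0))) s))"
    by (rule dfp_subst[OF assms(1), where t = ?t]) (simp add: assms(6))
  then show ?thesis by simp
qed

lemma dfp_tot1: "dfp E (\<lambda>_. True) (\<lambda>s. R (s 0)) \<Longrightarrow> dft E G a \<Longrightarrow> dfp E G (\<lambda>s. R (a s))"
  by (rule dfp_sub1[where H = "\<lambda>_. True"]) simp_all

lemma dft_tot1: "dft E (\<lambda>_. True) (\<lambda>s. R (s 0)) \<Longrightarrow> dft E G a \<Longrightarrow> dft E G (\<lambda>s. R (a s))"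
  by (rule dft_sub1[where H = "\<lambda>_. True"]) simp_all

lemma dfp_tot2: "dfp E (\<lambda>_. True) (\<lambda>s. R (s 0) (s (Suc 0))) \<Longrightarrow> dft E G a \<Longrightarrow> dft E G b \<Longrightarrow>
    dfp E G (\<lambda>s. R (a s) (b s))" by (rule dfp_sub2[where H = "\<lambda>_ _. True"]) simp_all

lemma dft_tot2: "dft E (\<lambda>_. True) (\<lambda>s. R (s 0) (s (Suc 0))) \<Longrightarrow> dft E G a \<Longrightarrow> dft E G b \<Longrightarrow>
    dft E G (\<lambda>s. R (a s) (b s))" by (rule dft_sub2[where H = "\<lambda>_ _. True"]) simp_all

section \<open>Closure under atomic formulas, connectives, quantifiers and descriptions\<close>

lemma dfp_mem [dfi]: "dft E G a \<Longrightarrow> dft E G b \<Longrightarrow> dfp E G (\<lambda>s. E (a s) (b s))"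
proof -
  have "dfp E (\<lambda>_. True) (\<lambda>s. E (s 0) (s (Suc 0)))"
    unfolding dfp_def using definable_mem by blast
  from dfp_tot2[OF this] show "dft E G a \<Longrightarrow> dft E G b \<Longrightarrow> ?thesis" by blast
qed

lemma dfp_eq [dfi]: "dft E G a \<Longrightarrow> dft E G b \<Longrightarrow> dfp E G (\<lambda>s. a s = b s)"
proof -
  have "dfp E (\<lambda>_. True) (\<lambda>s. s 0 = s (Suc 0))"
    unfolding dfp_def using definable_eq by blast
  from dfp_tot2[OF this] show "dft E G a \<Longrightarrow> dft E G b \<Longrightarrow> ?thesis" by blast
qed

lemma dfp_const [dfi]: "dfp E G (\<lambda>s. B)"
proof (cases B)
  case True then show ?thesis using dfp_eq[of E G "\<lambda>s. undefined" "\<lambda>s. undefined"] by (simp add: dft_const)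
next
  case False
  have "dfp E G (\<lambda>s. True)" using dfp_eq[of E G "\<lambda>s. undefined" "\<lambda>s. undefined"] by (simp add: dft_const)
  then obtain Q where "definable E Q" "\<And>s. G s \<Longrightarrow> Q s" by (auto simp: dfp_def)
  then show ?thesis using False definable_not by (auto simp: dfp_def)
qed

lemma dfp_not [dfi]: "dfp E G Q \<Longrightarrow> dfp E G (\<lambda>s. \<not> Q s)"
  unfolding dfp_def using definable_not by blast

text \<open>The first conjunct joins the guard of the second. This is what makes bounded statements
  work, where \<open>app f x\<close> is meaningful only after \<open>x \<epsilon> A\<close> is
  known.\<close>

lemma dfp_conj [dfi]: "dfp E G P \<Longrightarrow> dfp E (\<lambda>s. G s \<and> P s) Q \<Longrightarrow> dfp E G (\<lambda>s. P s \<and> Q s)"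
proof -
  assume "dfp E G P" "dfp E (\<lambda>s. G s \<and> P s) Q"
  then obtain P' Q' where "definable E P'" "\<And>s. G s \<Longrightarrow> P s = P' s"
    "definable E Q'" "\<And>s. G s \<Longrightarrow> P s \<Longrightarrow> Q s = Q' s" by (auto simp: dfp_def)
  then show ?thesis unfolding dfp_def using definable_conj[of E P' Q'] by blast
qed

lemma dfp_imp [dfi]: "dfp E G P \<Longrightarrow> dfp E (\<lambda>s. G s \<and> P s) Q \<Longrightarrow> dfp E G (\<lambda>s. P s \<longrightarrow> Q s)"
  using dfp_not[OF dfp_conj[of E G P, OF _ dfp_not]] by simp

lemma dfp_disj [dfi]: "dfp E G P \<Longrightarrow> dfp E (\<lambda>s. G s \<and> \<not> P s) Q \<Longrightarrow> dfp E G (\<lambda>s. P s \<or> Q s)"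
  using dfp_imp[OF dfp_not, of E G P Q] by (simp add: disj_imp)

lemma dfp_iff [dfi]: "dfp E G P \<Longrightarrow> dfp E G Q \<Longrightarrow> dfp E G (\<lambda>s. P s \<longleftrightarrow> Q s)"
proof -
  assume a: "dfp E G P" "dfp E G Q"
  have "dfp E G (\<lambda>s. (P s \<longrightarrow> Q s) \<and> (Q s \<longrightarrow> P s))"
    by (intro dfp_conj dfp_imp dfp_weaken[OF a(1)] dfp_weaken[OF a(2)]) auto
  then show ?thesis by (rule dfp_cong) auto
qed

lemma dfp_ex [dfi]: "dfp E (\<lambda>s. G (\<lambda>i. s (Suc i))) (\<lambda>s. Q (\<lambda>i. s (Suc i)) (s 0)) \<Longrightarrow> dfp E G (\<lambda>s. \<exists>x. Q s x)"
proof -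
  assume "dfp E (\<lambda>s. G (\<lambda>i. s (Suc i))) (\<lambda>s. Q (\<lambda>i. s (Suc i)) (s 0))"
  then obtain Q' where Q': "definable E Q'" "\<And>s. G (\<lambda>i. s (Suc i)) \<Longrightarrow> Q (\<lambda>i. s (Suc i)) (s 0) = Q' s"
    by (auto simp: dfp_def)
  have "G s \<Longrightarrow> Q s x = Q' (case_nat x s)" for s x using Q'(2)[of "case_nat x s"] by simp
  then show ?thesis unfolding dfp_def using definable_ex[OF Q'(1)] by blast
qed

lemma dfp_all [dfi]: "dfp E (\<lambda>s. G (\<lambda>i. s (Suc i))) (\<lambda>s. Q (\<lambda>i. s (Suc i)) (s 0)) \<Longrightarrow> dfp E G (\<lambda>s. \<forall>x. Q s x)"
  using dfp_not[OF dfp_ex[OF dfp_not]] by simp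

lemma dfp_ex1 [dfi]:
  assumes "dfp E (\<lambda>s. G (\<lambda>i. s (Suc i))) (\<lambda>s. Q (\<lambda>i. s (Suc i)) (s 0))"
  shows "dfp E G (\<lambda>s. \<exists>!x. Q s x)"
proof -
  note dfp_shift[where G = "\<lambda>s _. G s", OF assms]
  then show ?thesis unfolding Ex1_def
    by (intro dfp_ex dfp_conj dfp_all dfp_imp dfp_eq dft_var dfp_weaken[OF assms]) (auto elim: dfp_weaken)
qed

lemma dftI:
  assumes "dfp E (\<lambda>s. G (\<lambda>i. s (Suc i))) (\<lambda>s. s 0 = t (\<lambda>i. s (Suc i)))"
  shows "dft E G t"
proof -
  obtain Q' where Q': "definable E Q'" "\<And>s. G (\<lambda>i. s (Suc i)) \<Longrightarrow> (s 0 = t (\<lambda>i. s (Suc i))) = Q' s"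
    using assms by (auto simp: dfp_def)
  have q: "Q' (case_nat y s) \<longleftrightarrow> y = t s" if "G s" for s y using Q'(2)[of "case_nat y s"] that by simp
  \<comment> \<open>Outside the guard \<open>Q'\<close> need not determine a value. The total term
    \<open>t'\<close> then takes the constant value \<open>undefined\<close>, which enters as a
    parameter.\<close>
  define t' where "t' s = (if \<exists>!y. Q' (case_nat y s) then THE y. Q' (case_nat y s) else undefined)" for s
  have u: "dfp E (\<lambda>_. True) Q'" using Q'(1) by (auto simp: dfp_def)
  define r where "r i = (case i of 0 \<Rightarrow> 0 | Suc k \<Rightarrow> Suc (Suc k))" for i :: nat
  have u2: "dfp E (\<lambda>_. True) (\<lambda>s. \<exists>!y. Q' (case_nat y (\<lambda>i. s (Suc i))))"
  proof -
    have "(case_nat (s 0) (\<lambda>i. s (Suc (Suc i)))) = (\<lambda>i. s (r i))" for s :: "nat \<Rightarrow> 'a"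
      by (auto simp: fun_eq_iff r_def split: nat.splits)
    then show ?thesis
      by (intro dfp_ex1) (use dfp_subst[OF u, of "\<lambda>s. True" "\<lambda>i s. s (r i)"] in \<open>auto intro: dft_var\<close>)
  qed
  have "dfp E (\<lambda>_. True) (\<lambda>s. (Q' s \<and> (\<exists>!y. Q' (case_nat y (\<lambda>i. s (Suc i))))) \<or>
      ((\<not> (\<exists>!y. Q' (case_nat y (\<lambda>i. s (Suc i))))) \<and> s 0 = undefined))"
    by (intro dfp_disj dfp_conj dfp_not dfp_eq dft_var dft_const dfp_weaken[OF u] dfp_weaken[OF u2]; simp)
  then have "dfp E (\<lambda>_. True) (\<lambda>s. s 0 = t' (\<lambda>i. s (Suc i)))"
  proof (rule dfp_cong)
    fix s :: "nat \<Rightarrow> 'a"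
    have "case_nat (s 0) (\<lambda>i. s (Suc i)) = s" by (auto simp: fun_eq_iff split: nat.splits)
    then show "(s 0 = t' (\<lambda>i. s (Suc i))) = ((Q' s \<and> (\<exists>!y. Q' (case_nat y (\<lambda>i. s (Suc i))))) \<or>
      ((\<not> (\<exists>!y. Q' (case_nat y (\<lambda>i. s (Suc i))))) \<and> s 0 = undefined))"
      unfolding t'_def using theI'[of "\<lambda>y. Q' (case_nat y (\<lambda>i. s (Suc i)))"]
      by (cases "\<exists>!y. Q' (case_nat y (\<lambda>i. s (Suc i)))") (simp, metis, simp)
  qed
  then have "definable E (\<lambda>s. s 0 = t' (\<lambda>i. s (Suc i)))" by (auto simp: dfp_def definable_def)
  moreover have "G s \<Longrightarrow> t s = t' s" for s by (simp add: t'_def q)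
  ultimately show ?thesis unfolding dft_def by blast
qed

lemma dft_if [dfi]:
  assumes "dfp E G c" "dft E (\<lambda>s. G s \<and> c s) a" "dft E (\<lambda>s. G s \<and> \<not> c s) b"
  shows "dft E G (\<lambda>s. if c s then a s else b s)"
proof -
  obtain c' where c': "definable E c'" "\<And>s. G s \<Longrightarrow> c s = c' s" using assms(1) by (auto simp: dfp_def)
  obtain a' where a': "definable E (\<lambda>s. s 0 = a' (\<lambda>k. s (Suc k)))" "\<And>s. G s \<Longrightarrow> c s \<Longrightarrow> a s = a' s"
    using assms(2) by (auto simp: dft_def)
  obtain b' where b': "definable E (\<lambda>s. s 0 = b' (\<lambda>k. s (Suc k)))" "\<And>s. G s \<Longrightarrow> \<not> c s \<Longrightarrow> b s = b' s"
    using assms(3) by (auto simp: dft_def)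
  have c'': "definable E (\<lambda>s. c' (\<lambda>k. s (Suc k)))" using definable_inj[OF c'(1), of Suc] by simp
  have "definable E (\<lambda>s. \<not> (\<not> (c' (\<lambda>k. s (Suc k)) \<and> s 0 = a' (\<lambda>k. s (Suc k))) \<and>
      \<not> (\<not> c' (\<lambda>k. s (Suc k)) \<and> s 0 = b' (\<lambda>k. s (Suc k)))))"
    by (intro definable_not definable_conj a' b' c'')
  then have "definable E (\<lambda>s. s 0 = (if c' (\<lambda>k. s (Suc k)) then a' (\<lambda>k. s (Suc k)) else b' (\<lambda>k. s (Suc k))))"
    by (rule definable_cong) auto
  then show ?thesis unfolding dft_def using c' a' b'
    by (intro exI[of _ "\<lambda>s. if c' s then a' s else b' s"]) auto
qed

lemma dft_the:
  assumes "dfp E (\<lambda>s. G (\<lambda>i. s (Suc i))) (\<lambda>s. Q (\<lambda>i. s (Suc i)) (s 0))" "\<And>s. G s \<Longrightarrow> \<exists>!x. Q s x"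
  shows "dft E G (\<lambda>s. THE x. Q s x)"
  by (rule dftI, rule dfp_cong[OF assms(1)]) (metis assms(2) theI')

lemma dfp_holds: "dfp E G Q \<Longrightarrow> \<exists>p c. \<forall>s. G s \<longrightarrow> Q s = holds E p (mix s c)"
  unfolding dfp_def definable_def by metis

sublocale ZF \<subseteq> membership E .

context ZF
begin

section \<open>Sets of the model\<close>

lemma sep:
  assumes "dfp E (\<lambda>s. s 0 \<epsilon> a) (\<lambda>s. Q (s 0))"
  shows "\<exists>b. \<forall>x. x \<epsilon> b \<longleftrightarrow> x \<epsilon> a \<and> Q x"
proof -
  obtain p c where p: "\<And>s. s 0 \<epsilon> a \<Longrightarrow> Q (s 0) = holds E p (mix s c)"
    using dfp_holds[OF assms] by blast
  obtain b where b: "\<And>x. x \<epsilon> b \<longleftrightarrow> x \<epsilon> a \<and> holds E p ((mix (\<lambda>_. undefined) c)(0 := x))"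
    using separation[of a p "mix (\<lambda>_. undefined) c"] by auto
  have e: "(mix (\<lambda>_. undefined) c)(0 := x) = mix ((\<lambda>_. undefined)(0 := x)) c" for x
    by (auto simp: fun_eq_iff mix_def)
  have "x \<epsilon> b \<longleftrightarrow> x \<epsilon> a \<and> Q x" for x
    unfolding b e using p[of "(\<lambda>_. undefined)(0 := x)"] unfolding fun_upd_same by blast
  then show ?thesis by blast
qed

lemma repl:
  assumes "dfp E (\<lambda>s. s 0 \<epsilon> a) (\<lambda>s. R (s 0) (s (Suc 0)))" "\<And>x. x \<epsilon> a \<Longrightarrow> \<exists>!y. R x y"
  shows "\<exists>b. \<forall>y. y \<epsilon> b \<longleftrightarrow> (\<exists>x. x \<epsilon> a \<and> R x y)"
proof -
  obtain p c where p: "\<And>s. s 0 \<epsilon> a \<Longrightarrow> R (s 0) (s (Suc 0)) = holds E p (mix s c)"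
    using dfp_holds[OF assms(1)] by blast
  \<comment> \<open>The schema reads its two variables in slots 0 and 1, while \<open>mix\<close>
    stores them in slots 0 and 2; \<open>f\<close> exchanges slots 1 and 2.\<close>
  define f where "f i = (if i = 1 then 2 else if i = 2 then 1 else i)" for i :: nat
  have "f (f i) = i" for i by (simp add: f_def)
  then have f: "inj f" by (metis injI)
  define u where "u = (\<lambda>i. mix (\<lambda>_. undefined) c (f i))"
  have "(\<lambda>i. (u(0 := x, 1 := y)) (f i)) = mix ((\<lambda>_. undefined)(0 := x, Suc 0 := y)) c" for x y
  proof
    fix i show "(u(0 := x, 1 := y)) (f i) = mix ((\<lambda>_. undefined)(0 := x, Suc 0 := y)) c i"
      by (cases i rule: nat_parity_cases) (auto simp: mix_def f_def u_def)
  qed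
  then have q: "holds E (ren f p) (u(0 := x, 1 := y)) \<longleftrightarrow> R x y" if "x \<epsilon> a" for x y
    using p[of "(\<lambda>_. undefined)(0 := x, Suc 0 := y)"] that by (simp add: holds_ren[OF f])
  show ?thesis
    using replacement[of a "ren f p" u] assms(2) by (simp only: q cong: conj_cong imp_cong) blast
qed

definition isset :: "('v \<Rightarrow> bool) \<Rightarrow> bool" where
  "isset Q \<longleftrightarrow> (\<exists>y. \<forall>x. x \<epsilon> y \<longleftrightarrow> Q x)"

lemma setof_eqI: "(\<And>x. x \<epsilon> y \<longleftrightarrow> Q x) \<Longrightarrow> setof Q = y"
  unfolding setof_def by (rule the_equality) (auto intro: extensionality)

lemma mem_setof: "isset Q \<Longrightarrow> x \<epsilon> setof Q \<longleftrightarrow> Q x"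
  using setof_eqI[of _ Q] by (auto simp: isset_def)

lemma isset_sep: "dfp E (\<lambda>s. s 0 \<epsilon> a) (\<lambda>s. Q (s 0)) \<Longrightarrow> (\<And>x. Q x \<Longrightarrow> x \<epsilon> a) \<Longrightarrow> isset Q"
  using sep[of a Q] unfolding isset_def by blast

lemma isset_repl:
  assumes "dft E (\<lambda>s. s 0 \<epsilon> a) (\<lambda>s. F (s 0))"
  shows "isset (\<lambda>y. \<exists>x. x \<epsilon> a \<and> y = F x)"
proof -
  have "dft E (\<lambda>s. s 0 \<epsilon> a) (\<lambda>s. F (s 0))" by fact
  then have "dfp E (\<lambda>s. s 0 \<epsilon> a) (\<lambda>s. s (Suc 0) = F (s 0))" by (intro dfi)
  from repl[OF this] show ?thesis unfolding isset_def by auto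
qed

text \<open>No existence of the set is required as a guard: if there is none, the predicate under
  \<open>THE\<close> is constantly false, and \<open>setof\<close> has the fixed value
  \<open>THE x. False\<close>, which serves as a parameter.\<close>

lemma dft_setof [dfi]:
  assumes "dfp E (\<lambda>s. G (\<lambda>i. s (Suc i))) (\<lambda>s. Q (\<lambda>i. s (Suc i)) (s 0))"
  shows "dft E G (\<lambda>s. setof (\<lambda>x. Q s x))"
proof -
  note q = dfp_shift[where G = "\<lambda>s _. G s", OF assms]
  note q' = dfp_shift[where G = "\<lambda>s _. G (\<lambda>i. s (Suc i))" and Q = "\<lambda>s. Q (\<lambda>i. s (Suc i))", OF q]
  have "dfp E (\<lambda>s. G (\<lambda>i. s (Suc i))) (\<lambda>s. (\<forall>x. x \<epsilon> s 0 \<longleftrightarrow> Q (\<lambda>i. s (Suc i)) x) \<or>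
    (\<not> (\<exists>y. \<forall>x. x \<epsilon> y \<longleftrightarrow> Q (\<lambda>i. s (Suc i)) x) \<and> s 0 = (THE x. False)))"
    by (intro dfp_disj dfp_conj dfp_not dfp_ex dfp_all dfp_iff dfp_mem dfp_eq dft_var dft_const
        dfp_weaken[OF q] dfp_weaken[OF q']; simp)
  then show ?thesis
  proof (rule dftI[OF dfp_cong])
    fix s :: "nat \<Rightarrow> 'v"
    show "(s 0 = setof (Q (\<lambda>i. s (Suc i)))) = ((\<forall>x. x \<epsilon> s 0 \<longleftrightarrow> Q (\<lambda>i. s (Suc i)) x) \<or>
      (\<not> (\<exists>y. \<forall>x. x \<epsilon> y \<longleftrightarrow> Q (\<lambda>i. s (Suc i)) x) \<and> s 0 = (THE x. False)))"
    proof (cases "isset (Q (\<lambda>i. s (Suc i)))")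
      case True
      then show ?thesis using mem_setof[OF True] by (auto simp: isset_def intro: extensionality)
    next
      case False
      then have "(\<lambda>y. \<forall>x. x \<epsilon> y \<longleftrightarrow> Q (\<lambda>i. s (Suc i)) x) = (\<lambda>_. False)"
        by (auto simp: isset_def fun_eq_iff)
      then have "setof (Q (\<lambda>i. s (Suc i))) = (THE x. False)" unfolding setof_def by simp
      then show ?thesis using False unfolding isset_def by auto
    qed
  qed
qed

definition sub :: "'v \<Rightarrow> 'v \<Rightarrow> bool" where "sub x y \<longleftrightarrow> (\<forall>u. u \<epsilon> x \<longrightarrow> u \<epsilon> y)"
definition Cup :: "'v \<Rightarrow> 'v" where "Cup x = setof (\<lambda>u. \<exists>y. y \<epsilon> x \<and> u \<epsilon> y)"
definition pset :: "'v \<Rightarrow> 'v" where "pset x = setof (\<lambda>u. sub u x)"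

lemma isset_upair: "isset (\<lambda>x. x = a \<or> x = b)" unfolding isset_def by (rule pairing)
lemma isset_Cup: "isset (\<lambda>u. \<exists>y. y \<epsilon> x \<and> u \<epsilon> y)" unfolding isset_def by (rule union)
lemma isset_pset: "isset (\<lambda>u. sub u x)" unfolding isset_def sub_def by (rule power_set)

lemma mem_upair [simp]: "x \<epsilon> upair a b \<longleftrightarrow> x = a \<or> x = b"
  unfolding upair_def by (rule mem_setof[OF isset_upair])

lemma mem_Cup [simp]: "u \<epsilon> Cup x \<longleftrightarrow> (\<exists>y. y \<epsilon> x \<and> u \<epsilon> y)"
  unfolding Cup_def by (rule mem_setof[OF isset_Cup])

lemma mem_pset [simp]: "u \<epsilon> pset x \<longleftrightarrow> sub u x"
  unfolding pset_def by (rule mem_setof[OF isset_pset])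

lemma isset_union2: "isset (\<lambda>x. x \<epsilon> a \<or> x \<epsilon> b)"
  unfolding isset_def by (rule exI[of _ "Cup (upair a b)"]) auto

lemma mem_union2 [simp]: "x \<epsilon> union2 a b \<longleftrightarrow> x \<epsilon> a \<or> x \<epsilon> b"
  unfolding union2_def by (rule mem_setof[OF isset_union2])

lemma mem_succ [simp]: "x \<epsilon> succ a \<longleftrightarrow> x \<epsilon> a \<or> x = a"
proof -
  have "isset (\<lambda>x. x \<epsilon> a \<or> x = a)"
    unfolding isset_def by (rule exI[of _ "union2 a (upair a a)"]) auto
  then show ?thesis unfolding succ_def by (rule mem_setof)
qed

lemma mem_inter2 [simp]: "x \<epsilon> inter2 a b \<longleftrightarrow> x \<epsilon> a \<and> x \<epsilon> b"
  unfolding inter2_def by (rule mem_setof[OF isset_sep[of a]]) (intro dfi, auto)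

lemma mem_empty [simp]: "\<not> x \<epsilon> empty"
proof -
  have "isset (\<lambda>x. False)" by (rule isset_sep[of undefined]) (intro dfi, auto)
  then show ?thesis unfolding empty_def by (simp add: mem_setof)
qed

lemma eq_empty: "x = empty \<longleftrightarrow> (\<forall>u. \<not> u \<epsilon> x)"
  using extensionality[of x empty] by auto

lemma opair_inj [simp]: "opair a b = opair c d \<longleftrightarrow> a = c \<and> b = d"
proof
  assume "opair a b = opair c d"
  then have "\<And>x. x = upair a a \<or> x = upair a b \<longleftrightarrow> x = upair c c \<or> x = upair c d"
    unfolding opair_def by (metis mem_upair)
  moreover have "upair x y = upair u v \<longleftrightarrow> (\<forall>z. z = x \<or> z = y \<longleftrightarrow> z = u \<or> z = v)" for x y u v
    by (metis extensionality mem_upair)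
  ultimately show "a = c \<and> b = d" by metis
qed simp

lemma dft_upair [dfi]: "dft E G a \<Longrightarrow> dft E G b \<Longrightarrow> dft E G (\<lambda>s. upair (a s) (b s))"
  by (rule dft_tot2[where R = upair]) (unfold upair_def, intro dfi, auto)

lemma dft_opair [dfi]: "dft E G a \<Longrightarrow> dft E G b \<Longrightarrow> dft E G (\<lambda>s. opair (a s) (b s))"
  unfolding opair_def by (intro dfi)

lemma dft_inter2 [dfi]: "dft E G a \<Longrightarrow> dft E G b \<Longrightarrow> dft E G (\<lambda>s. inter2 (a s) (b s))"
  by (rule dft_tot2[where R = inter2]) (unfold inter2_def, intro dfi, auto)

lemma dft_succ [dfi]: "dft E G a \<Longrightarrow> dft E G (\<lambda>s. succ (a s))"
  by (rule dft_tot1[where R = succ]) (unfold succ_def, intro dfi, auto)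

lemma dft_Cup [dfi]: "dft E G a \<Longrightarrow> dft E G (\<lambda>s. Cup (a s))"
  by (rule dft_tot1[where R = Cup]) (unfold Cup_def, intro dfi, auto)

lemma dfp_sub [dfi]: "dft E G a \<Longrightarrow> dft E G b \<Longrightarrow> dfp E G (\<lambda>s. sub (a s) (b s))"
  by (rule dfp_tot2[where R = sub]) (unfold sub_def, intro dfi, auto)

lemma dft_pset [dfi]: "dft E G a \<Longrightarrow> dft E G (\<lambda>s. pset (a s))"
  by (rule dft_tot1[where R = pset]) (unfold pset_def, intro dfi, auto)

lemma dfp_func [dfi]: "dft E G a \<Longrightarrow> dft E G b \<Longrightarrow> dft E G c \<Longrightarrow> dfp E G (\<lambda>s. func (a s) (b s) (c s))"
  by (rule dfp_sub3[where R = func and H = "\<lambda>_ _ _. True"]) (unfold func_def, intro dfi, auto)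

lemma dfp_transitive [dfi]: "dft E G a \<Longrightarrow> dfp E G (\<lambda>s. transitive (a s))"
  by (rule dfp_tot1[where R = transitive]) (unfold transitive_def, intro dfi, auto)

lemma dfp_ordinal [dfi]: "dft E G a \<Longrightarrow> dfp E G (\<lambda>s. ordinal (a s))"
  by (rule dfp_tot1[where R = ordinal]) (unfold ordinal_def, intro dfi, auto)

lemma dfp_natural [dfi]: "dft E G a \<Longrightarrow> dfp E G (\<lambda>s. natural (a s))"
  by (rule dfp_tot1[where R = natural]) (unfold natural_def, intro dfi, auto)

section \<open>Functions\<close>

lemma func_ex1: "func f A B \<Longrightarrow> x \<epsilon> A \<Longrightarrow> \<exists>!y. opair x y \<epsilon> f"
  by (simp add: func_def)

lemma func_pair: "func f A B \<Longrightarrow> p \<epsilon> f \<Longrightarrow> \<exists>x y. x \<epsilon> A \<and> y \<epsilon> B \<and> p = opair x y"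
  unfolding func_def by (drule conjunct1, erule allE, erule mp)

lemma func_mem: "func f A B \<Longrightarrow> opair x y \<epsilon> f \<longleftrightarrow> x \<epsilon> A \<and> y = app f x"
proof -
  assume f: "func f A B"
  have "x \<epsilon> A" if "opair x y \<epsilon> f" using func_pair[OF f that] by auto
  moreover have "opair x y \<epsilon> f \<longleftrightarrow> y = app f x" if "x \<epsilon> A"
    using func_ex1[OF f that] theI'[OF func_ex1[OF f that]] unfolding app_def by auto
  ultimately show ?thesis by blast
qed

lemma func_app: "func f A B \<Longrightarrow> x \<epsilon> A \<Longrightarrow> app f x \<epsilon> B"
proof -
  assume f: "func f A B" and x: "x \<epsilon> A"
  then have "opair x (app f x) \<epsilon> f" by (simp add: func_mem)
  from func_pair[OF f this] show ?thesis by auto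
qed

lemma func_iff: "func f A B \<Longrightarrow> p \<epsilon> f \<longleftrightarrow> (\<exists>x. x \<epsilon> A \<and> p = opair x (app f x))"
proof -
  assume f: "func f A B"
  show ?thesis using func_pair[OF f, of p] func_mem[OF f] by auto
qed

lemma func_eqI: "func f A B \<Longrightarrow> func g A C \<Longrightarrow> (\<And>x. x \<epsilon> A \<Longrightarrow> app f x = app g x) \<Longrightarrow> f = g"
  by (rule extensionality) (auto simp: func_iff)

lemma func_cod: "func f A B \<Longrightarrow> (\<And>x. x \<epsilon> A \<Longrightarrow> app f x \<epsilon> C) \<Longrightarrow> func f A C"
proof -
  assume f: "func f A B" and C: "\<And>x. x \<epsilon> A \<Longrightarrow> app f x \<epsilon> C"
  show ?thesis
    unfolding func_def using func_ex1[OF f] C by (auto simp: func_iff[OF f])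
qed

text \<open>The guard under which the description in \<open>app\<close> denotes.\<close>

definition fdef :: "'v \<Rightarrow> 'v \<Rightarrow> bool" where "fdef f x \<longleftrightarrow> (\<exists>!y. opair x y \<epsilon> f)"

lemma func_fdef: "func f A B \<Longrightarrow> x \<epsilon> A \<Longrightarrow> fdef f x"
  unfolding fdef_def by (rule func_ex1)

lemma dft_app [dfi]:
  "dft E G f \<Longrightarrow> dft E G x \<Longrightarrow> (\<And>s. G s \<Longrightarrow> fdef (f s) (x s)) \<Longrightarrow> dft E G (\<lambda>s. app (f s) (x s))"
  by (rule dft_sub2[where R = app and H = fdef]) (unfold app_def fdef_def, intro dfi dft_the, auto)

text \<open>A total variant of \<open>app\<close>, definable without a guard.\<close>

definition appt :: "'v \<Rightarrow> 'v \<Rightarrow> 'v" where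
  "appt f x = (if fdef f x then app f x else empty)"

lemma dft_appt [dfi]: "dft E G a \<Longrightarrow> dft E G b \<Longrightarrow> dft E G (\<lambda>s. appt (a s) (b s))"
  by (rule dft_tot2[where R = appt]) (unfold appt_def fdef_def, intro dfi, auto simp: fdef_def)

lemma appt_eq: "func f A B \<Longrightarrow> x \<epsilon> A \<Longrightarrow> appt f x = app f x"
  by (simp add: appt_def func_fdef)

lemma dft_lam [dfi]:
  assumes A: "dft E G A" and F: "dft E (\<lambda>s. G (\<lambda>i. s (Suc i)) \<and> s 0 \<epsilon> A (\<lambda>i. s (Suc i))) (\<lambda>s. F (\<lambda>i. s (Suc i)) (s 0))"
  shows "dft E G (\<lambda>s. lam (A s) (\<lambda>x. F s x))"
proof -
  note q = dft_shift[where G = "\<lambda>s x. G s \<and> x \<epsilon> A s" and Q = F, OF F]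
  have a: "dft E (\<lambda>s. G (\<lambda>i. s (Suc (Suc i)))) (\<lambda>s. A (\<lambda>i. s (Suc (Suc i))))"
    using dft_subst[OF A, of "\<lambda>s. G (\<lambda>i. s (Suc (Suc i)))" "\<lambda>i s. s (Suc (Suc i))"] by (simp add: dft_var)
  show ?thesis unfolding lam_def
    by (intro dft_setof dfp_ex dfp_conj dfp_mem dfp_eq dft_opair dft_var dft_weaken[OF a] dft_weaken[OF q]; simp)
qed

lemma lam_cong: "(\<And>x. x \<epsilon> A \<Longrightarrow> F x = G x) \<Longrightarrow> lam A F = lam A G"
  unfolding lam_def by (rule arg_cong[of _ _ setof]) (auto simp: fun_eq_iff)

lemma mem_lam:
  assumes "dft E (\<lambda>s. s 0 \<epsilon> A) (\<lambda>s. F (s 0))"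
  shows "p \<epsilon> lam A F \<longleftrightarrow> (\<exists>x. x \<epsilon> A \<and> p = opair x (F x))"
proof -
  have "dft E (\<lambda>s. s 0 \<epsilon> A) (\<lambda>s. opair (s 0) (F (s 0)))" by (intro dfi assms)
  from isset_repl[OF this] show ?thesis unfolding lam_def by (rule mem_setof)
qed

lemma func_lam:
  assumes "dft E (\<lambda>s. s 0 \<epsilon> A) (\<lambda>s. F (s 0))" "\<And>x. x \<epsilon> A \<Longrightarrow> F x \<epsilon> B"
  shows "func (lam A F) A B"
  unfolding func_def mem_lam[OF assms(1)] using assms(2) by auto

lemma app_lam:
  assumes "dft E (\<lambda>s. s 0 \<epsilon> A) (\<lambda>s. F (s 0))" "x \<epsilon> A"
  shows "app (lam A F) x = F x"
  unfolding app_def mem_lam[OF assms(1)] using assms(2) by auto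

lemma lam_ex_cod:
  assumes "dft E (\<lambda>s. s 0 \<epsilon> A) (\<lambda>s. F (s 0))"
  shows "\<exists>B. func (lam A F) A B"
proof -
  from isset_repl[OF assms] obtain B where "\<And>y. y \<epsilon> B \<longleftrightarrow> (\<exists>x. x \<epsilon> A \<and> y = F x)"
    by (auto simp: isset_def)
  then show ?thesis using func_lam[OF assms] by blast
qed

lemma lam_app: "func f A B \<Longrightarrow> lam A (app f) = f"
proof -
  assume f: "func f A B"
  have "dft E (\<lambda>s. s 0 \<epsilon> A) (\<lambda>s. app f (s 0))" by (intro dfi) (rule func_fdef[OF f])
  then show ?thesis by (intro extensionality) (auto simp: mem_lam func_iff[OF f])
qed

section \<open>Foundation and ordinals\<close>

lemma min_in:
  assumes "dfp E (\<lambda>s. s 0 \<epsilon> a) (\<lambda>s. Q (s 0))" "x \<epsilon> a" "Q x"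
  obtains y where "y \<epsilon> a" "Q y" "\<And>w. w \<epsilon> a \<Longrightarrow> w \<epsilon> y \<Longrightarrow> \<not> Q w"
proof -
  obtain b where "\<And>x. x \<epsilon> b \<longleftrightarrow> x \<epsilon> a \<and> Q x" using sep[OF assms(1)] by auto
  then show ?thesis using foundation[of x b] assms(2,3) that by blast
qed

lemma not_mem_self [simp]: "\<not> x \<epsilon> x"
  using foundation[of x "upair x x"] by auto

lemma no_mem_cycle: "x \<epsilon> y \<Longrightarrow> \<not> y \<epsilon> x"
  using foundation[of x "upair x y"] by auto

lemma transitiveD: "transitive x \<Longrightarrow> y \<epsilon> x \<Longrightarrow> u \<epsilon> y \<Longrightarrow> u \<epsilon> x"
  by (auto simp: transitive_def)

lemma ordinal_trans: "ordinal x \<Longrightarrow> y \<epsilon> x \<Longrightarrow> u \<epsilon> y \<Longrightarrow> u \<epsilon> x"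
  unfolding ordinal_def by (blast intro: transitiveD)

lemma ordinal_mem: "ordinal x \<Longrightarrow> y \<epsilon> x \<Longrightarrow> ordinal y"
  unfolding ordinal_def using transitiveD by blast

lemma ordinal_succ:
  assumes "ordinal x" shows "ordinal (succ x)"
proof -
  have "transitive (succ x)"
    unfolding transitive_def mem_succ using ordinal_trans[OF assms] by blast
  then show ?thesis using assms unfolding ordinal_def mem_succ by blast
qed

lemma ordinal_empty: "ordinal empty" by (simp add: ordinal_def transitive_def)

text \<open>A least counterexample in \<open>succ a\<close> exists only for a definable
  \<open>P\<close>. Accordingly the first case of every internal induction is a definability
  obligation.\<close>

lemma ordinal_induct [consumes 1]:
  assumes "ordinal a" "dfp E (\<lambda>s. ordinal (s 0)) (\<lambda>s. P (s 0))"
    and step: "\<And>a. ordinal a \<Longrightarrow> (\<And>b. b \<epsilon> a \<Longrightarrow> P b) \<Longrightarrow> P a"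
  shows "P a"
proof (rule ccontr)
  assume "\<not> P a"
  have "dfp E (\<lambda>s. s 0 \<epsilon> succ a) (\<lambda>s. \<not> P (s 0))"
    by (intro dfp_not dfp_weaken[OF assms(2)]) (use assms(1) ordinal_mem ordinal_succ in blast)
  then obtain y where "y \<epsilon> succ a" "\<not> P y" "\<And>w. w \<epsilon> succ a \<Longrightarrow> w \<epsilon> y \<Longrightarrow> P w"
    by (rule min_in[of _ _ a]) (use \<open>\<not> P a\<close> in auto)
  then show False using step[of y] ordinal_succ[OF assms(1)] ordinal_mem ordinal_trans by blast
qed

lemma ordinal_linear: "ordinal a \<Longrightarrow> ordinal b \<Longrightarrow> a \<epsilon> b \<or> a = b \<or> b \<epsilon> a"
proof -
  assume a: "ordinal a" and b: "ordinal b"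
  have "\<forall>b. ordinal b \<longrightarrow> a \<epsilon> b \<or> a = b \<or> b \<epsilon> a"
    using a
  proof (induction rule: ordinal_induct)
    case 1 show ?case by (intro dfi)
  next
    case IH: (2 a)
    show ?case
    proof (intro allI impI)
      fix b assume "ordinal b"
      then show "a \<epsilon> b \<or> a = b \<or> b \<epsilon> a"
      proof (induction rule: ordinal_induct)
        case 1 show ?case by (intro dfi)
      next
        case IH2: (2 b)
        show ?case
        proof (rule ccontr)
          assume n: "\<not> ?thesis"
          have "x \<epsilon> b" if "x \<epsilon> a" for x
            using IH.IH[OF that] IH.hyps n IH2.hyps that ordinal_trans by blast
          moreover have "x \<epsilon> a" if "x \<epsilon> b" for x
            using IH2.IH[OF that] IH2.hyps n that ordinal_trans by blast
          ultimately show False using n extensionality[of a b] by blast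
        qed
      qed
    qed
  qed
  then show ?thesis using b by blast
qed

lemma ordinal_sub_iff: "ordinal a \<Longrightarrow> ordinal b \<Longrightarrow> sub a b \<longleftrightarrow> a \<epsilon> b \<or> a = b"
  using ordinal_linear[of a b] ordinal_trans[of b a] unfolding sub_def by (metis not_mem_self)

lemma succ_neq_empty [simp]: "succ a \<noteq> empty" "empty \<noteq> succ a"
  by (metis mem_succ mem_empty)+

section \<open>Natural numbers of the model\<close>

lemma natural_empty: "natural empty" by (auto simp: natural_def ordinal_empty)

lemma natural_succ: "natural n \<Longrightarrow> natural (succ n)"
  by (auto simp: natural_def ordinal_succ)

lemma natural_mem: "natural n \<Longrightarrow> m \<epsilon> n \<Longrightarrow> natural m"
  unfolding natural_def using ordinal_mem ordinal_trans by (metis mem_succ)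

text \<open>All natural numbers lie in the inductive set \<open>w\<close> given by infinity: an
  \<epsilon>-minimal member of \<open>succ x\<close> outside \<open>w\<close> could be neither empty
  nor a successor.\<close>

lemma isset_natural: "isset natural"
proof -
  obtain w e where e: "e \<epsilon> w" "\<And>u. \<not> u \<epsilon> e"
    and s: "\<And>x. x \<epsilon> w \<Longrightarrow> \<exists>y. y \<epsilon> w \<and> (\<forall>u. u \<epsilon> y \<longleftrightarrow> u \<epsilon> x \<or> u = x)" using infinity by auto
  have e': "empty \<epsilon> w" using e eq_empty by metis
  have s': "succ x \<epsilon> w" if x: "x \<epsilon> w" for x
  proof -
    obtain y where y: "y \<epsilon> w" "\<forall>u. u \<epsilon> y \<longleftrightarrow> u \<epsilon> x \<or> u = x" using s[OF x] by blast
    then have "y = succ x" by (intro extensionality) auto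
    then show ?thesis using y by simp
  qed
  show ?thesis
  proof (rule isset_sep[of w])
    fix x assume x: "natural x"
    show "x \<epsilon> w"
    proof (rule ccontr)
      assume n: "\<not> x \<epsilon> w"
      have "dfp E (\<lambda>s. s 0 \<epsilon> succ x) (\<lambda>s. \<not> s 0 \<epsilon> w)" by (intro dfi)
      then obtain y where y: "y \<epsilon> succ x" "\<not> y \<epsilon> w" "\<And>v. v \<epsilon> succ x \<Longrightarrow> v \<epsilon> y \<Longrightarrow> v \<epsilon> w"
        by (rule min_in[of _ _ x]) (use n in auto)
      then obtain v where v: "y = succ v" using x e' unfolding natural_def by blast
      then have "v \<epsilon> y" by simp
      moreover have "v \<epsilon> succ x" using x y(1) \<open>v \<epsilon> y\<close> unfolding natural_def using ordinal_succ ordinal_trans by blast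
      ultimately show False using y s' v by blast
    qed
  qed (intro dfi)
qed

lemma mem_omega: "n \<epsilon> omega \<longleftrightarrow> natural n"
  unfolding omega_def by (rule mem_setof[OF isset_natural])

lemma omega_empty [simp]: "empty \<epsilon> omega" by (simp add: mem_omega natural_empty)
lemma omega_succ [simp]: "n \<epsilon> omega \<Longrightarrow> succ n \<epsilon> omega" by (simp add: mem_omega natural_succ)
lemma omega_mem: "n \<epsilon> omega \<Longrightarrow> m \<epsilon> n \<Longrightarrow> m \<epsilon> omega" using mem_omega natural_mem by blast
lemma omega_num [simp]: "num k \<epsilon> omega" by (induction k) auto
lemma omega_ordinal: "n \<epsilon> omega \<Longrightarrow> ordinal n" by (simp add: mem_omega natural_def)
lemma ordinal_omega: "ordinal omega"
  unfolding ordinal_def transitive_def by (meson omega_mem omega_ordinal ordinal_trans)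

lemma omega_cases:
  assumes "n \<epsilon> omega" obtains "n = empty" | m where "m \<epsilon> omega" "n = succ m"
proof -
  have "natural n" using assms by (simp add: mem_omega)
  then show ?thesis using that natural_mem[of n] unfolding natural_def mem_omega by (metis mem_succ)
qed

lemma omega_induct [consumes 1, case_names dfp empty succ]:
  assumes n: "n \<epsilon> omega" and P: "dfp E (\<lambda>s. s 0 \<epsilon> omega) (\<lambda>s. P (s 0))"
    and "P empty" and "\<And>n. n \<epsilon> omega \<Longrightarrow> P n \<Longrightarrow> P (succ n)"
  shows "P n"
proof (rule ccontr)
  assume "\<not> P n"
  obtain y where y: "y \<epsilon> omega" "\<not> P y" "\<And>w. w \<epsilon> omega \<Longrightarrow> w \<epsilon> y \<Longrightarrow> P w"
    by (rule min_in[OF dfp_not[OF P], of n]) (use n \<open>\<not> P n\<close> in auto)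
  then show False using assms(3,4) by (metis omega_cases mem_succ)
qed

lemma num_mem_num: "i < k \<Longrightarrow> num i \<epsilon> num k"
  by (induction k) (auto simp: less_Suc_eq)

lemma num_eq [simp]: "num i = num k \<longleftrightarrow> i = k"
  using num_mem_num[of i k] num_mem_num[of k i] by (metis not_mem_self nat_neq_iff)

section \<open>Recursion\<close>

text \<open>Recursion along a set of predecessors \<open>p x\<close> on a class \<open>K\<close>,
  with the earlier values passed to \<open>H\<close> as a function with domain \<open>p x\<close>.
  Assumption \<open>ind\<close> is induction along \<open>p\<close>, and \<open>cl\<close> provides
  the sets on which approximations live. It is used for natural numbers and for transitive
  closures.\<close>

lemma recursion:
  assumes H: "dft E (\<lambda>_. True) (\<lambda>s. H (s 0) (s (Suc 0)))" and p: "dft E (\<lambda>_. True) (\<lambda>s. p (s 0))"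
    and K: "dfp E (\<lambda>_. True) (\<lambda>s. K (s 0))"
    and ind: "\<And>P x. dfp E (\<lambda>_. True) (\<lambda>s. P (s 0)) \<Longrightarrow>
      (\<And>x. K x \<Longrightarrow> (\<And>y. y \<epsilon> p x \<Longrightarrow> P y) \<Longrightarrow> P x) \<Longrightarrow> K x \<Longrightarrow> P x"
    and cl: "\<And>x. K x \<Longrightarrow> \<exists>T. x \<epsilon> T \<and> (\<forall>y. y \<epsilon> T \<longrightarrow> K y \<and> (\<forall>w. w \<epsilon> p y \<longrightarrow> w \<epsilon> T))"
  shows "\<exists>F. dft E (\<lambda>_. True) (\<lambda>s. F (s 0)) \<and> (\<forall>x. K x \<longrightarrow> F x = H x (lam (p x) F))"
proof -
  note H' [dfi] = dft_tot2[where R = H, OF H]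
  note p' [dfi] = dft_tot1[where R = p, OF p]
  note K' [dfi] = dfp_tot1[where R = K, OF K]
  define closed where "closed T \<longleftrightarrow> (\<forall>y. y \<epsilon> T \<longrightarrow> K y \<and> (\<forall>w. w \<epsilon> p y \<longrightarrow> w \<epsilon> T))" for T
  define approx where "approx f T \<longleftrightarrow> closed T \<and> (\<exists>B. func f T B) \<and>
    (\<forall>y. y \<epsilon> T \<longrightarrow> app f y = H y (lam (p y) (\<lambda>w. app f w)))" for f T
  have closed' [dfi]: "dft E G a \<Longrightarrow> dfp E G (\<lambda>s. closed (a s))" for G a
    by (rule dfp_tot1[where R = closed]) (unfold closed_def, intro dfi, auto)
  have approx' [dfi]: "dft E G a \<Longrightarrow> dft E G b \<Longrightarrow> dfp E G (\<lambda>s. approx (a s) (b s))" for G a b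
    by (rule dfp_tot2[where R = approx])
      (unfold approx_def, intro dfi, auto simp: closed_def intro: func_fdef)
  have uniq: "app f x = app g x" if f: "approx f T" "x \<epsilon> T" and g: "approx g U" "x \<epsilon> U" for f g T U x
  proof -
    have "K x" using f by (auto simp: approx_def closed_def)
    then have "x \<epsilon> T \<and> x \<epsilon> U \<longrightarrow> app f x = app g x"
    proof (rule ind[rotated 2])
      show "dfp E (\<lambda>_. True) (\<lambda>s. s 0 \<epsilon> T \<and> s 0 \<epsilon> U \<longrightarrow> app f (s 0) = app g (s 0))"
        using f g by (intro dfi) (auto simp: approx_def intro: func_fdef)
    next
      fix x assume x: "\<And>y. y \<epsilon> p x \<Longrightarrow> y \<epsilon> T \<and> y \<epsilon> U \<longrightarrow> app f y = app g y"
      show "x \<epsilon> T \<and> x \<epsilon> U \<longrightarrow> app f x = app g x"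
      proof
        assume xTU: "x \<epsilon> T \<and> x \<epsilon> U"
        have "lam (p x) (\<lambda>w. app f w) = lam (p x) (\<lambda>w. app g w)"
          by (rule lam_cong) (use x xTU f g in \<open>auto simp: approx_def closed_def\<close>)
        then show "app f x = app g x" using xTU f g by (auto simp: approx_def)
      qed
    qed
    then show ?thesis using f g by blast
  qed
  define R where "R x v \<longleftrightarrow> (\<exists>f T. approx f T \<and> x \<epsilon> T \<and> v = app f x)" for x v
  have R' [dfi]: "dft E G a \<Longrightarrow> dft E G b \<Longrightarrow> dfp E G (\<lambda>s. R (a s) (b s))" for G a b
    by (rule dfp_tot2[where R = R])
      (unfold R_def, intro dfi, auto simp: approx_def intro: func_fdef)
  have R1: "R x v \<Longrightarrow> R x w \<Longrightarrow> v = w" for x v w unfolding R_def using uniq by blast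
  define F where "F x = (if \<exists>v. R x v then THE v. R x v else x)" for x
  have F' [dfi]: "dft E G a \<Longrightarrow> dft E G (\<lambda>s. F (a s))" for G a
    by (rule dft_tot1[where R = F]) (unfold F_def, intro dfi dft_the, auto dest: R1)
  have F: "F x = app f x" if "approx f T" "x \<epsilon> T" for f T x
  proof -
    have "R x (app f x)" using that by (auto simp: R_def)
    then show ?thesis unfolding F_def using R1 by (metis the_equality)
  qed
  have ex: "\<exists>f T. approx f T \<and> x \<epsilon> T" if "K x" for x
    using that
  proof (rule ind[rotated 2])
    show "dfp E (\<lambda>_. True) (\<lambda>s. \<exists>f T. approx f T \<and> s 0 \<epsilon> T)" by (intro dfi)
  next
    fix x assume Kx: "K x" and IH: "\<And>y. y \<epsilon> p x \<Longrightarrow> \<exists>f T. approx f T \<and> y \<epsilon> T"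
    show "\<exists>f T. approx f T \<and> x \<epsilon> T"
    proof (rule ccontr)
      assume n: "\<not> ?thesis"
      obtain T0 where T0: "x \<epsilon> T0" "closed T0" using cl[OF Kx] by (auto simp: closed_def)
      have "dfp E (\<lambda>s. s 0 \<epsilon> T0) (\<lambda>s. s 0 = x \<or> (\<exists>f T. approx f T \<and> s 0 \<epsilon> T))" by (intro dfi)
      \<comment> \<open>All members of \<open>T0\<close> that some approximation already covers,
        together with the new point \<open>x\<close>.\<close>
      from sep[OF this] obtain T where
        T: "\<And>y. y \<epsilon> T \<longleftrightarrow> y \<epsilon> T0 \<and> (y = x \<or> (\<exists>f T. approx f T \<and> y \<epsilon> T))" by auto
      define F2 where "F2 y = (if y = x then H x (lam (p x) (\<lambda>w. F w)) else F y)" for y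
      have F2: "dft E (\<lambda>s. s 0 \<epsilon> T) (\<lambda>s. F2 (s 0))" unfolding F2_def by (intro dfi)
      have cT: "closed T"
        unfolding closed_def
      proof (intro allI impI conjI)
        fix y assume y: "y \<epsilon> T"
        then show "K y" using T0 T by (auto simp: closed_def)
        fix w assume w: "w \<epsilon> p y"
        then have "w \<epsilon> T0" using y T T0 by (auto simp: closed_def)
        moreover have "\<exists>f T. approx f T \<and> w \<epsilon> T"
        proof (cases "y = x")
          case True then show ?thesis using IH w by blast
        next
          case False
          then obtain f U where fU: "approx f U" "y \<epsilon> U" using y T by blast
          then have "w \<epsilon> U" using w by (auto simp: approx_def closed_def)
          then show ?thesis using fU by blast
        qed
        ultimately show "w \<epsilon> T" using T by blast
      qed
      \<comment> \<open>Here the contradiction hypothesis enters: a predecessor equal to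
        \<open>x\<close> would already be covered by an approximation. So the predecessors avoid the
        exceptional value of \<open>F2\<close> at \<open>x\<close>.\<close>
      have nx: "w \<noteq> x" if wy: "w \<epsilon> p y" and yT: "y \<epsilon> T" for w y
      proof (cases "y = x")
        case True
        then obtain f U where "approx f U" "w \<epsilon> U" using IH[of w] wy True by blast
        then show ?thesis using n by blast
      next
        case False
        then obtain f U where fU: "approx f U" "y \<epsilon> U" using yT T[of y] by blast
        then have "w \<epsilon> U" using wy by (auto simp: approx_def closed_def)
        then show ?thesis using fU n by blast
      qed
      have "approx (lam T F2) T"
        unfolding approx_def
      proof (intro conjI allI impI cT lam_ex_cod[OF F2])
        fix y assume y: "y \<epsilon> T"
        have e: "lam (p y) (app (lam T F2)) = lam (p y) F"
          by (rule lam_cong) (use y cT nx in \<open>auto simp: closed_def app_lam[OF F2] F2_def\<close>)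
        show "app (lam T F2) y = H y (lam (p y) (\<lambda>w. app (lam T F2) w))"
        proof (cases "y = x")
          case True then show ?thesis using y e by (simp add: app_lam[OF F2] F2_def)
        next
          case False
          then obtain f U where fU: "approx f U" "y \<epsilon> U" using y T by blast
          have "lam (p y) F = lam (p y) (app f)"
            by (rule lam_cong) (use fU F in \<open>auto simp: approx_def closed_def\<close>)
          then show ?thesis using y e False fU F[OF fU] by (simp add: app_lam[OF F2] F2_def approx_def)
        qed
      qed
      moreover have "x \<epsilon> T" using T T0 by blast
      ultimately show False using n by blast
    qed
  qed
  show ?thesis
  proof (intro exI[of _ F] conjI allI impI)
    show "dft E (\<lambda>_. True) (\<lambda>s. F (s 0))" by (intro dfi)
    fix x assume "K x"
    then obtain f T where f: "approx f T" "x \<epsilon> T" using ex by blast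
    have "lam (p x) F = lam (p x) (app f)"
      by (rule lam_cong) (use f F in \<open>auto simp: approx_def closed_def\<close>)
    then show "F x = H x (lam (p x) F)" using f F[OF f] by (simp add: approx_def)
  qed
qed

lemma omega_recursion:
  assumes G: "dft E (\<lambda>_. True) (\<lambda>s. G (s 0))"
  shows "\<exists>f. (\<exists>B. func f omega B) \<and> app f empty = a \<and> (\<forall>n. n \<epsilon> omega \<longrightarrow> app f (succ n) = G (app f n))"
proof -
  note G' [dfi] = dft_tot1[where R = G, OF G]
  \<comment> \<open>For nonzero \<open>n\<close> the union \<open>Cup n\<close> is the predecessor
    of \<open>n\<close>, so this instance of \<open>recursion\<close> looks only at the previous
    value.\<close>
  have "\<exists>F. dft E (\<lambda>_. True) (\<lambda>s. F (s 0)) \<and>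
    (\<forall>n. n \<epsilon> omega \<longrightarrow> F n = (\<lambda>n g. if n = empty then a else G (appt g (Cup n))) n (lam n F))"
  proof (rule recursion[where H = "\<lambda>n g. if n = empty then a else G (appt g (Cup n))" and p = "\<lambda>n. n" and K = "\<lambda>n. n \<epsilon> omega"])
    fix P n assume P: "dfp E (\<lambda>_. True) (\<lambda>s. P (s 0))"
      "\<And>x. x \<epsilon> omega \<Longrightarrow> (\<And>y. y \<epsilon> x \<Longrightarrow> P y) \<Longrightarrow> P x" and n: "n \<epsilon> omega"
    have "n \<epsilon> omega \<longrightarrow> P n"
      using omega_ordinal[OF n]
    proof (induction rule: ordinal_induct)
      case 1 show ?case by (intro dfi dfp_weaken[OF P(1)]) auto
    next
      case (2 a) then show ?case using P(2) omega_mem by blast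
    qed
    then show "P n" using n by blast
  next
    fix x assume "x \<epsilon> omega"
    then show "\<exists>T. x \<epsilon> T \<and> (\<forall>y. y \<epsilon> T \<longrightarrow> y \<epsilon> omega \<and> (\<forall>w. w \<epsilon> y \<longrightarrow> w \<epsilon> T))"
      using omega_mem by blast
  qed (intro dfi)+
  then obtain F where F: "dft E (\<lambda>_. True) (\<lambda>s. F (s 0))"
    "\<And>n. n \<epsilon> omega \<Longrightarrow> F n = (if n = empty then a else G (appt (lam n F) (Cup n)))" by auto
  have F': "dft E H (\<lambda>s. F (s 0))" for H by (rule dft_weaken[OF F(1)]) auto
  obtain B where B: "func (lam omega F) omega B" using lam_ex_cod[OF F'] by blast
  have "F (succ n) = G (F n)" if n: "n \<epsilon> omega" for n
  proof -
    obtain C where C: "func (lam (succ n) F) (succ n) C" using lam_ex_cod[OF F'] by blast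
    have "Cup (succ n) = n"
      using omega_ordinal[OF n] ordinal_trans by (intro extensionality) auto
    then show ?thesis using F(2)[of "succ n"] n by (simp add: appt_eq[OF C] app_lam[OF F'])
  qed
  moreover have "F empty = a" using F(2)[of empty] by simp
  ultimately show ?thesis using B by (intro exI[of _ "lam omega F"]) (auto simp: app_lam[OF F'])
qed

text \<open>The union of the sets obtained by iterating \<open>Cup\<close> from \<open>x\<close> is
  transitive; it exists because the whole iteration is a set of the model.\<close>

lemma ex_transitive: "\<exists>T. transitive T \<and> sub x T"
proof -
  have "dft E (\<lambda>_. True) (\<lambda>s. Cup (s 0))" by (intro dfi)
  from omega_recursion[OF this, of x] obtain f B where
    f: "func f omega B" "app f empty = x" "\<And>n. n \<epsilon> omega \<Longrightarrow> app f (succ n) = Cup (app f n)" by auto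
  have "isset (\<lambda>u. \<exists>n. n \<epsilon> omega \<and> u \<epsilon> app f n)"
    by (rule isset_sep[of "Cup B"], intro dfi) (auto intro: func_fdef[OF f(1)] func_app[OF f(1)])
  then obtain T where T: "\<And>u. u \<epsilon> T \<longleftrightarrow> (\<exists>n. n \<epsilon> omega \<and> u \<epsilon> app f n)" by (auto simp: isset_def)
  have "transitive T" unfolding transitive_def T using f(3) by (metis mem_Cup omega_succ)
  moreover have "sub x T" unfolding sub_def T using f(2) omega_empty by metis
  ultimately show ?thesis by blast
qed

lemma mem_induct [consumes 0, case_names dfp mem]:
  assumes P: "dfp E (\<lambda>_. True) (\<lambda>s. P (s 0))" and step: "\<And>x. (\<And>y. y \<epsilon> x \<Longrightarrow> P y) \<Longrightarrow> P x"
  shows "P x"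
proof (rule ccontr)
  assume "\<not> P x"
  obtain T where T: "transitive T" "x \<epsilon> T"
    using ex_transitive[of "upair x x"] by (auto simp: sub_def)
  have "dfp E (\<lambda>s. s 0 \<epsilon> T) (\<lambda>s. \<not> P (s 0))" by (intro dfi dfp_weaken[OF P]) auto
  then obtain y where "y \<epsilon> T" "\<not> P y" "\<And>w. w \<epsilon> T \<Longrightarrow> w \<epsilon> y \<Longrightarrow> P w"
    by (rule min_in[of _ _ x]) (use T \<open>\<not> P x\<close> in auto)
  then show False using step T transitiveD by blast
qed

text \<open>The closure does not contain \<open>x\<close> itself; the transitive closure of the
  singleton of \<open>x\<close> is written \<open>TC (upair x x)\<close>.\<close>

definition TC :: "'v \<Rightarrow> 'v" where
  "TC x = setof (\<lambda>u. \<forall>T. transitive T \<and> sub x T \<longrightarrow> u \<epsilon> T)"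

lemma dft_TC [dfi]: "dft E G a \<Longrightarrow> dft E G (\<lambda>s. TC (a s))"
  by (rule dft_tot1[where R = TC]) (unfold TC_def, intro dfi, auto)

lemma mem_TC: "u \<epsilon> TC x \<longleftrightarrow> (\<forall>T. transitive T \<and> sub x T \<longrightarrow> u \<epsilon> T)"
proof -
  obtain T where "transitive T" "sub x T" using ex_transitive by blast
  then show ?thesis unfolding TC_def by (intro mem_setof isset_sep[of T]) (intro dfi, auto)
qed

lemma TC_sub: "sub x (TC x)" by (auto simp: sub_def mem_TC)
lemma TC_transitive: "transitive (TC x)"
  unfolding transitive_def mem_TC by (metis transitive_def)
lemma TC_least: "transitive T \<Longrightarrow> sub x T \<Longrightarrow> sub (TC x) T"
  by (auto simp: sub_def mem_TC)

lemma TC_cases: "y \<epsilon> TC x \<Longrightarrow> y \<epsilon> x \<or> (\<exists>w. w \<epsilon> x \<and> y \<epsilon> TC w)"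
proof -
  assume y: "y \<epsilon> TC x"
  have "isset (\<lambda>y. y \<epsilon> x \<or> (\<exists>w. w \<epsilon> x \<and> y \<epsilon> TC w))"
    by (rule isset_sep[of "TC x"], intro dfi)
      (meson TC_least TC_sub TC_transitive sub_def transitive_def)
  then obtain T where T: "\<And>y. y \<epsilon> T \<longleftrightarrow> y \<epsilon> x \<or> (\<exists>w. w \<epsilon> x \<and> y \<epsilon> TC w)" by (auto simp: isset_def)
  have "transitive T" unfolding transitive_def T by (meson TC_sub TC_transitive sub_def transitive_def)
  then show ?thesis using y T unfolding mem_TC[of y x] sub_def by blast
qed

lemma TC_induct [consumes 0, case_names dfp TC]:
  assumes P: "dfp E (\<lambda>_. True) (\<lambda>s. P (s 0))" and step: "\<And>x. (\<And>y. y \<epsilon> TC x \<Longrightarrow> P y) \<Longrightarrow> P x"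
  shows "P x"
proof -
  note P' [dfi] = dfp_tot1[where R = P, OF P]
  have "\<forall>y. y \<epsilon> TC x \<longrightarrow> P y"
  proof (induction x rule: mem_induct)
    case dfp show ?case by (intro dfi)
  next
    case (mem x) then show ?case using TC_cases step by blast
  qed
  then show ?thesis using step by blast
qed

text \<open>Values on the whole transitive closure are available, not only on elements. This is
  needed for codes of formulas, whose subformulas lie several ordered pairs deep.\<close>

lemma TC_recursion:
  assumes H: "dft E (\<lambda>_. True) (\<lambda>s. H (s 0) (s (Suc 0)))"
  shows "\<exists>F. dft E (\<lambda>_. True) (\<lambda>s. F (s 0)) \<and> (\<forall>x. F x = H x (lam (TC x) F))"
proof -
  have "\<exists>F. dft E (\<lambda>_. True) (\<lambda>s. F (s 0)) \<and> (\<forall>x. True \<longrightarrow> F x = H x (lam (TC x) F))"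
  proof (rule recursion[OF H])
    fix x :: 'v
    show "\<exists>T. x \<epsilon> T \<and> (\<forall>y. y \<epsilon> T \<longrightarrow> True \<and> (\<forall>w. w \<epsilon> TC y \<longrightarrow> w \<epsilon> T))"
    proof (rule exI[of _ "TC (upair x x)"], intro conjI allI impI TrueI)
      show "x \<epsilon> TC (upair x x)" using TC_sub[of "upair x x"] by (simp add: sub_def)
      show "w \<epsilon> TC (upair x x)" if "y \<epsilon> TC (upair x x)" "w \<epsilon> TC y" for y w
        using that TC_least[of "TC (upair x x)" y] TC_transitive[of "upair x x"]
        unfolding sub_def transitive_def by blast
    qed
  next
    fix P x assume "dfp E (\<lambda>_. True) (\<lambda>s. P (s 0))" "\<And>x. True \<Longrightarrow> (\<And>y. y \<epsilon> TC x \<Longrightarrow> P y) \<Longrightarrow> P x"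
    then show "P x" by (rule TC_induct) simp_all
  qed (intro dfi)+
  then show ?thesis by simp
qed

section \<open>Rank and the cumulative hierarchy\<close>

lemma appt_lam: "dft E (\<lambda>_. True) (\<lambda>s. F (s 0)) \<Longrightarrow> x \<epsilon> A \<Longrightarrow> appt (lam A F) x = F x"
proof -
  assume F: "dft E (\<lambda>_. True) (\<lambda>s. F (s 0))" and x: "x \<epsilon> A"
  have F': "dft E (\<lambda>s. s 0 \<epsilon> A) (\<lambda>s. F (s 0))" by (rule dft_weaken[OF F]) simp
  obtain B where "func (lam A F) A B" using lam_ex_cod[OF F'] by blast
  then show ?thesis using x app_lam[OF F' x] by (simp add: appt_eq)
qed

text \<open>\<open>rank\<close> is a description, which says nothing before unique existence is
  known. A function \<open>F\<close> with the recursion equation is therefore built independently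
  and then shown to be the only solution of \<open>is_rank\<close>.\<close>

lemma rank_aux:
  obtains F where "dft E (\<lambda>_. True) (\<lambda>s. F (s 0))"
    "\<And>u x. u \<epsilon> F x \<longleftrightarrow> (\<exists>w. w \<epsilon> x \<and> u \<epsilon> succ (F w))" "\<And>x \<alpha>. is_rank x \<alpha> \<longleftrightarrow> \<alpha> = F x"
proof -
  have "dft E (\<lambda>_. True) (\<lambda>s. setof (\<lambda>u. \<exists>w. w \<epsilon> s 0 \<and> u \<epsilon> succ (appt (s (Suc 0)) w)))" by (intro dfi)
  from TC_recursion[of "\<lambda>x g. setof (\<lambda>u. \<exists>w. w \<epsilon> x \<and> u \<epsilon> succ (appt g w))", OF this]
  obtain F where F: "dft E (\<lambda>_. True) (\<lambda>s. F (s 0))"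
    and Fx: "\<And>x. F x = setof (\<lambda>u. \<exists>w. w \<epsilon> x \<and> u \<epsilon> succ (appt (lam (TC x) F) w))" by blast
  note F' [dfi] = dft_tot1[where R = F, OF F]
  have Fx': "F x = setof (\<lambda>u. \<exists>w. w \<epsilon> x \<and> u \<epsilon> succ (F w))" for x
    unfolding Fx[of x] by (rule arg_cong[of _ _ setof], rule ext, rule ex_cong1)
      (use appt_lam[OF F] TC_sub[of x] in \<open>auto simp: sub_def\<close>)
  have mem: "u \<epsilon> F x \<longleftrightarrow> (\<exists>w. w \<epsilon> x \<and> u \<epsilon> succ (F w))" for u x
  proof -
    have "dft E (\<lambda>s. s 0 \<epsilon> x) (\<lambda>s. succ (F (s 0)))" by (intro dfi)
    from isset_repl[OF this] obtain a where "\<And>y. y \<epsilon> a \<longleftrightarrow> (\<exists>w. w \<epsilon> x \<and> y = succ (F w))" by (auto simp: isset_def)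
    then have "isset (\<lambda>u. \<exists>w. w \<epsilon> x \<and> u \<epsilon> succ (F w))"
      by (intro isset_sep[of "Cup a"], intro dfi) (simp del: mem_succ, blast)
    then show ?thesis unfolding Fx'[of x] by (rule mem_setof)
  qed
  have "\<alpha> = F x" if ir: "is_rank x \<alpha>" for x \<alpha>
  proof -
    obtain T B f where T: "transitive T" "x \<epsilon> T" "func f T B" "\<alpha> = app f x"
      and f: "\<And>y. y \<epsilon> T \<Longrightarrow> app f y = setof (\<lambda>u. \<exists>w. w \<epsilon> y \<and> u \<epsilon> succ (app f w))"
      using ir unfolding is_rank_def by blast
    have "y \<epsilon> T \<longrightarrow> app f y = F y" for y
    proof (induction y rule: mem_induct)
      case dfp show ?case by (intro dfi) (simp add: func_fdef[OF T(3)])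
    next
      case (mem y)
      show ?case
      proof
        assume y: "y \<epsilon> T"
        have "app f w = F w" if "w \<epsilon> y" for w using mem that y T(1) transitiveD by blast
        then show "app f y = F y" unfolding f[OF y] Fx'[of y]
          by (intro arg_cong[of _ _ setof] ext ex_cong1) auto
      qed
    qed
    then show ?thesis using T by blast
  qed
  moreover have "is_rank x (F x)" for x
  proof -
    define T where "T = TC (upair x x)"
    have T: "transitive T" "x \<epsilon> T" using TC_transitive TC_sub[of "upair x x"] by (auto simp: T_def sub_def)
    have d: "dft E (\<lambda>s. s 0 \<epsilon> T) (\<lambda>s. F (s 0))" by (intro dfi)
    have "\<exists>B. func (lam T F) T B" by (rule lam_ex_cod[OF d])
    moreover have "app (lam T F) y = setof (\<lambda>u. \<exists>w. w \<epsilon> y \<and> u \<epsilon> succ (app (lam T F) w))" if y: "y \<epsilon> T" for y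
    proof -
      have "app (lam T F) w = F w" if "w \<epsilon> y" for w using app_lam[OF d] transitiveD[OF T(1) y that] by blast
      then show ?thesis unfolding app_lam[OF d y] Fx'[of y]
        by (intro arg_cong[of _ _ setof] ext ex_cong1) auto
    qed
    moreover have "F x = app (lam T F) x" using app_lam[OF d T(2)] by simp
    ultimately show ?thesis unfolding is_rank_def using T by blast
  qed
  ultimately have "is_rank x \<alpha> \<longleftrightarrow> \<alpha> = F x" for x \<alpha> by blast
  then show ?thesis using that F mem by blast
qed

lemma rank_facts:
  shows mem_rank: "u \<epsilon> rank x \<longleftrightarrow> (\<exists>w. w \<epsilon> x \<and> (u \<epsilon> rank w \<or> u = rank w))"
    and dft_rank [dfi]: "dft E G a \<Longrightarrow> dft E G (\<lambda>s. rank (a s))"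
proof -
  obtain F where F: "dft E (\<lambda>_. True) (\<lambda>s. F (s 0))"
    "\<And>u x. u \<epsilon> F x \<longleftrightarrow> (\<exists>w. w \<epsilon> x \<and> u \<epsilon> succ (F w))" "\<And>x \<alpha>. is_rank x \<alpha> \<longleftrightarrow> \<alpha> = F x"
    by (rule rank_aux) blast
  have r: "rank = F" unfolding rank_def F(3) by auto
  show "u \<epsilon> rank x \<longleftrightarrow> (\<exists>w. w \<epsilon> x \<and> (u \<epsilon> rank w \<or> u = rank w))" unfolding r by (subst F(2)) simp
  show "dft E G a \<Longrightarrow> dft E G (\<lambda>s. rank (a s))" unfolding r
    by (rule dft_tot1[where R = F, OF F(1)])
qed

lemma rank_mem: "y \<epsilon> x \<Longrightarrow> rank y \<epsilon> rank x"
  by (subst mem_rank) blast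

lemma ordinal_rank [simp]: "ordinal (rank x)"
proof (induction x rule: mem_induct)
  case dfp show ?case by (intro dfi)
next
  case (mem x)
  have o: "ordinal u" if "u \<epsilon> rank x" for u
    using that mem ordinal_mem unfolding mem_rank[of u x] by blast
  have "v \<epsilon> rank x" if "u \<epsilon> rank x" "v \<epsilon> u" for u v
    using that mem ordinal_trans unfolding mem_rank[of _ x] by blast
  then show ?case using o unfolding ordinal_def transitive_def by blast
qed

lemma rank_le: "ordinal \<alpha> \<Longrightarrow> (\<And>w. w \<epsilon> x \<Longrightarrow> rank w \<epsilon> \<alpha>) \<Longrightarrow> sub (rank x) \<alpha>"
  unfolding sub_def mem_rank[of _ x] using ordinal_trans by blast

lemma rank_sub: "sub x y \<Longrightarrow> sub (rank x) (rank y)"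
  by (rule rank_le) (auto simp: sub_def intro: rank_mem)

lemma rank_ordinal: "ordinal \<alpha> \<Longrightarrow> rank \<alpha> = \<alpha>"
proof (induction \<alpha> rule: ordinal_induct)
  case 1 show ?case by (intro dfi)
next
  case (2 a)
  have "u \<epsilon> rank a \<longleftrightarrow> u \<epsilon> a" for u
    unfolding mem_rank[of u a] using 2 ordinal_trans by metis
  then show ?case by (rule extensionality[OF allI])
qed

lemma dft_V [dfi]: "dft E G a \<Longrightarrow> dft E G (\<lambda>s. V (a s))"
  by (rule dft_tot1[where R = V]) (unfold V_def, intro dfi, auto)

text \<open>By induction, every set of rank below \<open>a\<close> is a subset of some
  \<open>V w\<close> with \<open>w \<epsilon> a\<close>, hence lies in the union of the power sets
  of these earlier levels.\<close>

lemma isset_V: "ordinal \<alpha> \<Longrightarrow> isset (\<lambda>x. rank x \<epsilon> \<alpha>)"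
proof (induction \<alpha> rule: ordinal_induct)
  case 1 show ?case unfolding isset_def by (intro dfi)
next
  case (2 a)
  have "dft E (\<lambda>s. s 0 \<epsilon> a) (\<lambda>s. pset (V (s 0)))" by (intro dfi)
  from isset_repl[OF this] obtain b where b: "\<And>y. y \<epsilon> b \<longleftrightarrow> (\<exists>w. w \<epsilon> a \<and> y = pset (V w))" by (auto simp: isset_def)
  show ?case
  proof (rule isset_sep[of "Cup b"])
    fix x assume x: "rank x \<epsilon> a"
    have "w \<epsilon> V (rank x)" if "w \<epsilon> x" for w
      unfolding V_def using mem_setof[OF 2(2)[OF x]] rank_mem[OF that] by blast
    then have "x \<epsilon> pset (V (rank x))" by (simp add: sub_def)
    then show "x \<epsilon> Cup b" using x b by (simp only: mem_Cup) blast
  qed (intro dfi)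
qed

lemma mem_V: "ordinal \<alpha> \<Longrightarrow> x \<epsilon> V \<alpha> \<longleftrightarrow> rank x \<epsilon> \<alpha>"
  unfolding V_def by (rule mem_setof[OF isset_V])

lemma V_transitive: "ordinal \<alpha> \<Longrightarrow> transitive (V \<alpha>)"
  unfolding transitive_def using rank_mem ordinal_trans by (simp add: mem_V)

lemma V_mem: "ordinal \<alpha> \<Longrightarrow> x \<epsilon> V \<alpha> \<Longrightarrow> y \<epsilon> x \<Longrightarrow> y \<epsilon> V \<alpha>"
  using V_transitive transitiveD by blast

lemma V_sub: "ordinal \<alpha> \<Longrightarrow> x \<epsilon> V \<alpha> \<Longrightarrow> sub y x \<Longrightarrow> y \<epsilon> V \<alpha>"
  using rank_sub[of y x] ordinal_sub_iff[of "rank y" "rank x"] ordinal_trans[of \<alpha> "rank x" "rank y"]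
  by (auto simp: mem_V)

lemma V_mono: "ordinal \<alpha> \<Longrightarrow> \<beta> \<epsilon> \<alpha> \<Longrightarrow> x \<epsilon> V \<beta> \<Longrightarrow> x \<epsilon> V \<alpha>"
  using ordinal_mem ordinal_trans by (metis mem_V)

lemma ordinal_mem_V: "ordinal \<alpha> \<Longrightarrow> ordinal \<beta> \<Longrightarrow> \<beta> \<epsilon> V \<alpha> \<longleftrightarrow> \<beta> \<epsilon> \<alpha>"
  by (simp add: mem_V rank_ordinal)

lemma rank_V: "ordinal \<alpha> \<Longrightarrow> rank (V \<alpha>) = \<alpha>"
proof (rule extensionality[OF allI])
  fix u assume a: "ordinal \<alpha>"
  have "u \<epsilon> rank (V \<alpha>) \<longleftrightarrow> (\<exists>w. rank w \<epsilon> \<alpha> \<and> (u \<epsilon> rank w \<or> u = rank w))"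
    unfolding mem_rank[of u "V \<alpha>"] mem_V[OF a] ..
  also have "\<dots> \<longleftrightarrow> u \<epsilon> \<alpha>" using a ordinal_trans ordinal_mem rank_ordinal by metis
  finally show "u \<epsilon> rank (V \<alpha>) \<longleftrightarrow> u \<epsilon> \<alpha>" .
qed

definition limit :: "'v \<Rightarrow> bool" where
  "limit \<theta> \<longleftrightarrow> ordinal \<theta> \<and> empty \<epsilon> \<theta> \<and> (\<forall>\<alpha>. \<alpha> \<epsilon> \<theta> \<longrightarrow> succ \<alpha> \<epsilon> \<theta>)"

lemma limitD: "limit \<theta> \<Longrightarrow> ordinal \<theta>" "limit \<theta> \<Longrightarrow> empty \<epsilon> \<theta>" "limit \<theta> \<Longrightarrow> \<alpha> \<epsilon> \<theta> \<Longrightarrow> succ \<alpha> \<epsilon> \<theta>"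
  by (simp_all add: limit_def)

lemma limit_max: "limit \<theta> \<Longrightarrow> \<alpha> \<epsilon> \<theta> \<Longrightarrow> \<beta> \<epsilon> \<theta> \<Longrightarrow> \<exists>\<gamma>. \<gamma> \<epsilon> \<theta> \<and> \<alpha> \<epsilon> \<gamma> \<and> \<beta> \<epsilon> \<gamma>"
proof -
  assume l: "limit \<theta>" "\<alpha> \<epsilon> \<theta>" "\<beta> \<epsilon> \<theta>"
  have "\<alpha> \<epsilon> succ \<alpha> \<and> \<beta> \<epsilon> succ \<alpha> \<or> \<alpha> \<epsilon> succ \<beta> \<and> \<beta> \<epsilon> succ \<beta>"
    using ordinal_linear[of \<alpha> \<beta>] ordinal_mem[OF limitD(1)[OF l(1)]] l by auto
  then show ?thesis using limitD(3)[OF l(1)] l by blast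
qed

lemma limit_VI: "limit \<theta> \<Longrightarrow> \<alpha> \<epsilon> \<theta> \<Longrightarrow> (\<And>w. w \<epsilon> x \<Longrightarrow> rank w \<epsilon> \<alpha>) \<Longrightarrow> x \<epsilon> V \<theta>"
proof -
  assume l: "limit \<theta>" "\<alpha> \<epsilon> \<theta>" and x: "\<And>w. w \<epsilon> x \<Longrightarrow> rank w \<epsilon> \<alpha>"
  have a: "ordinal \<alpha>" using l limitD ordinal_mem by blast
  have "rank x \<epsilon> \<alpha> \<or> rank x = \<alpha>" using rank_le[OF a x] ordinal_sub_iff[of "rank x" \<alpha>] a by simp
  then show ?thesis using l limitD(1) ordinal_trans mem_V by metis
qed

lemma V_upair: "limit \<theta> \<Longrightarrow> x \<epsilon> V \<theta> \<Longrightarrow> y \<epsilon> V \<theta> \<Longrightarrow> upair x y \<epsilon> V \<theta>"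
  using limit_max[of \<theta> "rank x" "rank y"] limit_VI[of \<theta> _ "upair x y"] limitD(1) by (auto simp: mem_V)

lemma V_opair: "limit \<theta> \<Longrightarrow> x \<epsilon> V \<theta> \<Longrightarrow> y \<epsilon> V \<theta> \<Longrightarrow> opair x y \<epsilon> V \<theta>"
  unfolding opair_def by (intro V_upair)

lemma V_opairD: "ordinal \<theta> \<Longrightarrow> opair x y \<epsilon> V \<theta> \<Longrightarrow> x \<epsilon> V \<theta> \<and> y \<epsilon> V \<theta>"
  using V_mem[of \<theta> "opair x y" "upair x y"] V_mem[of \<theta> "upair x y" x] V_mem[of \<theta> "upair x y" y]
  by (simp add: opair_def)

lemma V_union2: "limit \<theta> \<Longrightarrow> x \<epsilon> V \<theta> \<Longrightarrow> y \<epsilon> V \<theta> \<Longrightarrow> union2 x y \<epsilon> V \<theta>"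
proof -
  assume l: "limit \<theta>" and x: "x \<epsilon> V \<theta>" "y \<epsilon> V \<theta>"
  have o: "ordinal \<theta>" using l limitD by blast
  obtain \<gamma> where g: "\<gamma> \<epsilon> \<theta>" "rank x \<epsilon> \<gamma>" "rank y \<epsilon> \<gamma>" using limit_max[OF l] x o by (auto simp: mem_V)
  have "ordinal \<gamma>" using g o ordinal_mem by blast
  then have "rank w \<epsilon> \<gamma>" if "w \<epsilon> union2 x y" for w
    using that rank_mem[of w x] rank_mem[of w y] ordinal_trans g by auto
  then show ?thesis using limit_VI[OF l g(1)] by blast
qed

lemma V_pset: "limit \<theta> \<Longrightarrow> x \<epsilon> V \<theta> \<Longrightarrow> pset x \<epsilon> V \<theta>"
  by (rule limit_VI[of \<theta> "succ (rank x)"])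
    (auto simp: mem_V limitD ordinal_sub_iff[symmetric] intro: rank_sub)

definition prods :: "'v \<Rightarrow> 'v \<Rightarrow> 'v" where
  "prods A B = setof (\<lambda>p. \<exists>x y. x \<epsilon> A \<and> y \<epsilon> B \<and> p = opair x y)"

lemma opair_pset: "x \<epsilon> A \<Longrightarrow> y \<epsilon> B \<Longrightarrow> opair x y \<epsilon> pset (pset (union2 A B))"
  by (auto simp: opair_def sub_def)

lemma mem_prods: "p \<epsilon> prods A B \<longleftrightarrow> (\<exists>x y. x \<epsilon> A \<and> y \<epsilon> B \<and> p = opair x y)"
  unfolding prods_def
  by (rule mem_setof, rule isset_sep[of "pset (pset (union2 A B))"], intro dfi) (use opair_pset in blast)

lemma V_prods: "limit \<theta> \<Longrightarrow> A \<epsilon> V \<theta> \<Longrightarrow> B \<epsilon> V \<theta> \<Longrightarrow> prods A B \<epsilon> V \<theta>"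
  by (rule V_sub[of _ "pset (pset (union2 A B))"])
    (auto simp: sub_def[of "prods A B"] mem_prods simp del: mem_pset intro!: opair_pset V_pset V_union2 limitD(1))

lemma func_sub_prods: "func f A B \<Longrightarrow> sub f (prods A B)"
  using func_pair[of f A B] by (auto simp: sub_def mem_prods)

lemma V_func: "limit \<theta> \<Longrightarrow> A \<epsilon> V \<theta> \<Longrightarrow> B \<epsilon> V \<theta> \<Longrightarrow> func f A B \<Longrightarrow> f \<epsilon> V \<theta>"
  using V_sub[OF limitD(1) V_prods func_sub_prods] by blast

lemma mem_tuples: "s \<epsilon> tuples k U \<longleftrightarrow> func s k U"
  unfolding tuples_def
  by (rule mem_setof, rule isset_sep[of "pset (prods k U)"], intro dfi) (simp add: func_sub_prods)

text \<open>The height is the limit of the ordinals obtained from \<open>succ (rank x)\<close> by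
  iterating the successor.\<close>

lemma ex_limit: "\<exists>\<theta>. limit \<theta> \<and> x \<epsilon> V \<theta>"
proof -
  have "dft E (\<lambda>_. True) (\<lambda>s. succ (s 0))" by (intro dfi)
  from omega_recursion[OF this, of "succ (rank x)"] obtain f B where
    f: "func f omega B" "app f empty = succ (rank x)" "\<And>n. n \<epsilon> omega \<Longrightarrow> app f (succ n) = succ (app f n)" by auto
  have "isset (\<lambda>u. \<exists>n. n \<epsilon> omega \<and> u \<epsilon> app f n)"
    by (rule isset_sep[of "Cup B"], intro dfi) (auto intro: func_fdef[OF f(1)] func_app[OF f(1)])
  then obtain T where T: "\<And>u. u \<epsilon> T \<longleftrightarrow> (\<exists>n. n \<epsilon> omega \<and> u \<epsilon> app f n)" by (auto simp: isset_def)
  have o: "ordinal (app f n)" if "n \<epsilon> omega" for n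
    using that
  proof (induction rule: omega_induct)
    case dfp show ?case by (intro dfi) (rule func_fdef[OF f(1)])
  qed (auto simp: f ordinal_succ)
  have "transitive T" unfolding transitive_def T using o ordinal_trans by blast
  moreover have "ordinal y" if "y \<epsilon> T" for y using that o ordinal_mem unfolding T by blast
  ultimately have "ordinal T" unfolding ordinal_def by blast
  moreover have r: "rank x \<epsilon> T" unfolding T using f(2) omega_empty mem_succ by metis
  moreover have "empty \<epsilon> T"
    using ordinal_linear[OF ordinal_empty \<open>ordinal T\<close>] r by auto
  moreover have "succ \<alpha> \<epsilon> T" if aT: "\<alpha> \<epsilon> T" for \<alpha>
  proof -
    obtain n where n: "n \<epsilon> omega" "\<alpha> \<epsilon> app f n" using aT T by blast
    have a: "ordinal \<alpha>" using n o ordinal_mem by blast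
    have "sub (succ \<alpha>) (app f n)" using n(2) ordinal_trans[OF o[OF n(1)]] by (auto simp: sub_def)
    then have "succ \<alpha> \<epsilon> app f (succ n)"
      using f(3)[OF n(1)] ordinal_sub_iff[OF ordinal_succ[OF a] o[OF n(1)]] by simp
    then show ?thesis using T[of "succ \<alpha>"] omega_succ[OF n(1)] by blast
  qed
  ultimately show ?thesis using mem_V by (intro exI[of _ T]) (simp add: limit_def)
qed

lemma limit_omega: "limit \<theta> \<Longrightarrow> n \<epsilon> omega \<Longrightarrow> n \<epsilon> \<theta>"
proof -
  assume l: "limit \<theta>" and "n \<epsilon> omega"
  from this(2) show ?thesis by (induction rule: omega_induct) (auto simp: limitD[OF l] intro: dfi)
qed

section \<open>Satisfaction of set-theoretic formulas in a set\<close>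

lemma mem_num2 [simp]: "x \<epsilon> num 2 \<longleftrightarrow> x = num 0 \<or> x = num 1"
  by (auto simp: numeral_2_eq_2)

lemma lam_fin_dft: "dft E (\<lambda>s. s 0 \<epsilon> A) (\<lambda>s. if s 0 = k then a else b)"
  by (intro dfi)

lemma fmem_inj: "fmem i k = fmem i' k' \<longleftrightarrow> i = i' \<and> k = k'"
proof
  let ?f = "\<lambda>i k. lam (num 2) (\<lambda>m. if m = num 0 then tvar i else tvar k)"
  assume "fmem i k = fmem i' k'"
  then have "?f i k = ?f i' k'" by (simp add: fmem_def frel_def)
  then have "app (?f i k) m = app (?f i' k') m" for m by simp
  from this[of "num 0"] this[of "num 1"] show "i = i' \<and> k = k'"
    unfolding app_lam[OF lam_fin_dft] by (simp add: app_lam[OF lam_fin_dft] tvar_def)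
qed simp

lemma code_distinct [simp]:
  "feq t u \<noteq> frel R ts" "feq t u \<noteq> fneg c" "feq t u \<noteq> fconj c d" "feq t u \<noteq> fex k c"
  "frel R ts \<noteq> fneg c" "frel R ts \<noteq> fconj c d" "frel R ts \<noteq> fex k c"
  "fneg c \<noteq> fconj d e" "fneg c \<noteq> fex k d" "fconj c d \<noteq> fex k e"
  "frel R ts \<noteq> feq t u" "fneg c \<noteq> feq t u" "fconj c d \<noteq> feq t u" "fex k c \<noteq> feq t u"
  "fneg c \<noteq> frel R ts" "fconj c d \<noteq> frel R ts" "fex k c \<noteq> frel R ts"
  "fconj d e \<noteq> fneg c" "fex k d \<noteq> fneg c" "fex k e \<noteq> fconj c d"
  unfolding feq_def frel_def fneg_def fconj_def fex_def opair_inj num_eq by simp_all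

lemma code_inj [simp]:
  "feq t u = feq t' u' \<longleftrightarrow> t = t' \<and> u = u'" "frel R ts = frel R' ts' \<longleftrightarrow> R = R' \<and> ts = ts'"
  "fneg c = fneg c' \<longleftrightarrow> c = c'" "fconj c d = fconj c' d' \<longleftrightarrow> c = c' \<and> d = d'"
  "fex k c = fex k' c' \<longleftrightarrow> k = k' \<and> c = c'" "tvar i = tvar i' \<longleftrightarrow> i = i'"
  unfolding feq_def frel_def fneg_def fconj_def fex_def tvar_def by simp_all

lemma dft_tvar [dfi]: "dft E G a \<Longrightarrow> dft E G (\<lambda>s. tvar (a s))"
  unfolding tvar_def by (intro dfi)
lemma dft_feq [dfi]: "dft E G a \<Longrightarrow> dft E G b \<Longrightarrow> dft E G (\<lambda>s. feq (a s) (b s))"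
  unfolding feq_def by (intro dfi)
lemma dft_frel [dfi]: "dft E G a \<Longrightarrow> dft E G b \<Longrightarrow> dft E G (\<lambda>s. frel (a s) (b s))"
  unfolding frel_def by (intro dfi)
lemma dft_fneg [dfi]: "dft E G a \<Longrightarrow> dft E G (\<lambda>s. fneg (a s))"
  unfolding fneg_def by (intro dfi)
lemma dft_fconj [dfi]: "dft E G a \<Longrightarrow> dft E G b \<Longrightarrow> dft E G (\<lambda>s. fconj (a s) (b s))"
  unfolding fconj_def by (intro dfi)
lemma dft_fex [dfi]: "dft E G a \<Longrightarrow> dft E G b \<Longrightarrow> dft E G (\<lambda>s. fex (a s) (b s))"
  unfolding fex_def by (intro dfi)
lemma dft_fmem [dfi]: "dft E G a \<Longrightarrow> dft E G b \<Longrightarrow> dft E G (\<lambda>s. fmem (a s) (b s))"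
  by (rule dft_tot2[where R = fmem]) (unfold fmem_def, intro dfi, auto)

lemma upd_dft: "func s omega B \<Longrightarrow> dft E (\<lambda>t. t 0 \<epsilon> omega) (\<lambda>t. if t 0 = k then a else app s (t 0))"
  by (intro dfi) (auto intro: func_fdef)

lemma app_upd: "func s omega B \<Longrightarrow> m \<epsilon> omega \<Longrightarrow> app (upd s k a) m = (if m = k then a else app s m)"
  unfolding upd_def by (rule app_lam[OF upd_dft])

lemma func_upd: "func s omega B \<Longrightarrow> a \<epsilon> B \<Longrightarrow> func (upd s k a) omega B"
  unfolding upd_def by (rule func_lam[OF upd_dft]) (auto intro: func_app)

lemma dft_upd [dfi]:
  assumes "dft E G a" "dft E G b" "dft E G c" "\<And>s. G s \<Longrightarrow> \<exists>B. func (a s) omega B"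
  shows "dft E G (\<lambda>s. upd (a s) (b s) (c s))"
  by (rule dft_sub3[where R = upd and H = "\<lambda>s k a. \<exists>B. func s omega B"])
    (unfold upd_def, intro dfi, use assms in \<open>auto intro: func_fdef\<close>)

lemma sub_TC: "x \<epsilon> y \<Longrightarrow> x \<epsilon> TC y" "x \<epsilon> TC y \<Longrightarrow> y \<epsilon> TC z \<Longrightarrow> x \<epsilon> TC z"
  using TC_sub[of y] TC_least[OF TC_transitive[of z], of y] TC_transitive[of z] unfolding sub_def transitive_def
  by blast+

lemma opair_TC: "x \<epsilon> TC (opair x y)" "y \<epsilon> TC (opair x y)"
  by (rule sub_TC(2)[OF sub_TC(1)[of _ "upair x y"] sub_TC(1)]; simp add: opair_def)+

lemma code_TC: "c \<epsilon> TC (fneg c)" "c \<epsilon> TC (fconj c d)" "d \<epsilon> TC (fconj c d)" "c \<epsilon> TC (fex k c)"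
  unfolding fneg_def fconj_def fex_def using opair_TC sub_TC(2) by blast+

text \<open>Puts an arbitrary argument list of length 2 into the canonical shape used in
  \<open>fmem\<close>, so that each atomic relational formula of \<open>in_lang\<close> is some
  \<open>fmem i k\<close>.\<close>

lemma pair_func:
  assumes "func ts (num 2) B"
  shows "ts = lam (num 2) (\<lambda>m. if m = num 0 then app ts (num 0) else app ts (num 1))"
proof -
  have "ts = lam (num 2) (app ts)" using lam_app[OF assms] by simp
  also have "\<dots> = lam (num 2) (\<lambda>m. if m = num 0 then app ts (num 0) else app ts (num 1))"
    by (rule lam_cong) auto
  finally show ?thesis .
qed

lemma rels_in_lang: "rels in_lang = upair empty empty" "funs in_lang = empty"
  by (simp_all add: in_lang_def)

lemma ar_in_lang: "ar in_lang empty = num 2"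
  unfolding ar_def in_lang_def language.sel by (subst app_lam; (intro dfi | simp))

lemma in_lang_term: "is_term in_lang t \<longleftrightarrow> (\<exists>k. k \<epsilon> omega \<and> t = tvar k)"
proof
  have "dft E (\<lambda>s. s 0 \<epsilon> omega) (\<lambda>s. tvar (s 0))" by (intro dfi)
  from isset_repl[OF this] obtain X where X: "\<And>t. t \<epsilon> X \<longleftrightarrow> (\<exists>k. k \<epsilon> omega \<and> t = tvar k)"
    by (auto simp: isset_def)
  assume "is_term in_lang t"
  then have "t \<epsilon> X" unfolding is_term_def rels_in_lang using X by auto
  then show "\<exists>k. k \<epsilon> omega \<and> t = tvar k" using X by blast
qed (auto simp: is_term_def)

lemma in_lang_all_terms: "t \<epsilon> all_terms in_lang \<longleftrightarrow> (\<exists>k. k \<epsilon> omega \<and> t = tvar k)"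
proof -
  have "dft E (\<lambda>s. s 0 \<epsilon> omega) (\<lambda>s. tvar (s 0))" by (intro dfi)
  from isset_repl[OF this] have "isset (is_term in_lang)" by (simp add: isset_def in_lang_term)
  from mem_setof[OF this] show ?thesis unfolding all_terms_def in_lang_term by simp
qed

lemma univ_opair [simp]: "univ (opair U I) = U"
  unfolding univ_def by auto

lemma interp_opair [simp]: "interp (opair U I) x = app I x"
  unfolding interp_def by simp

lemma univ_in_struct [simp]: "univ (in_struct M) = M" by (simp add: in_struct_def)

lemma interp_in_struct: "s \<epsilon> interp (in_struct M) empty \<longleftrightarrow> func s (num 2) M \<and> app s (num 0) \<epsilon> app s (num 1)"
proof -
  have "isset (\<lambda>s. func s (num 2) M \<and> app s (num 0) \<epsilon> app s (num 1))"
    by (rule isset_sep[of "tuples (num 2) M"], intro dfi) (auto simp: mem_tuples intro: func_fdef)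
  note s = mem_setof[OF this]
  show ?thesis unfolding in_struct_def interp_opair
    by (subst app_lam) ((intro dfi; auto intro: func_fdef)[1], simp, rule s)
qed

lemma in_lang_tval: "func s omega M \<Longrightarrow> k \<epsilon> omega \<Longrightarrow> tval in_lang (in_struct M) s (tvar k) = app s k"
proof -
  assume s: "func s omega M" and k: "k \<epsilon> omega"
  have "dft E (\<lambda>u. u 0 \<epsilon> omega) (\<lambda>u. opair (tvar (u 0)) (app s (u 0)))"
    by (intro dfi) (rule func_fdef[OF s])
  from isset_repl[OF this] obtain e where
    e: "\<And>p. p \<epsilon> e \<longleftrightarrow> (\<exists>k. k \<epsilon> omega \<and> p = opair (tvar k) (app s k))" by (auto simp: isset_def)
  have f: "func e (all_terms in_lang) M"
    unfolding func_def e in_lang_all_terms using func_app[OF s] by auto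
  have "app e (tvar k) = app s k" if "k \<epsilon> omega" for k
    using func_mem[OF f, of "tvar k" "app s k"] e that by auto
  then have "evaluates in_lang (in_struct M) s e"
    unfolding evaluates_def using f by (simp add: rels_in_lang)
  moreover have "app e' (tvar k) = app s k" if "evaluates in_lang (in_struct M) s e'" for e'
    using that k by (simp add: evaluates_def)
  ultimately show ?thesis unfolding tval_def by (intro the_equality) metis+
qed

lemma is_formula_intros:
  "is_term L t \<Longrightarrow> is_term L u \<Longrightarrow> is_formula L (feq t u)"
  "R \<epsilon> rels L \<Longrightarrow> func ts (ar L R) (all_terms L) \<Longrightarrow> is_formula L (frel R ts)"
  "is_formula L c \<Longrightarrow> is_formula L (fneg c)"
  "is_formula L c \<Longrightarrow> is_formula L d \<Longrightarrow> is_formula L (fconj c d)"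
  "k \<epsilon> omega \<Longrightarrow> is_formula L c \<Longrightarrow> is_formula L (fex k c)"
  unfolding is_formula_def by blast+

text \<open>A \<open>V \<theta>\<close> of limit height is closed under the formation of codes, so
  it is a legitimate choice of \<open>X\<close> in \<open>is_formula\<close>. The bound is needed
  for a satisfaction relation to be a set.\<close>

lemma in_lang_formula_bound: "\<exists>X. \<forall>c. is_formula in_lang c \<longrightarrow> c \<epsilon> X"
proof -
  obtain \<theta> where t: "limit \<theta>" "union2 omega (all_terms in_lang) \<epsilon> V \<theta>" using ex_limit by blast
  have o: "ordinal \<theta>" using t limitD by blast
  have om: "omega \<epsilon> V \<theta>" "all_terms in_lang \<epsilon> V \<theta>"
    by (rule V_sub[OF o t(2)], simp add: sub_def)+
  have n: "k \<epsilon> omega \<Longrightarrow> k \<epsilon> V \<theta>" for k using V_mem[OF o om(1)] .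
  show ?thesis
  proof (rule exI[of _ "V \<theta>"], intro allI impI)
    fix c assume c: "is_formula in_lang c"
    have "feq u v \<epsilon> V \<theta>" if "is_term in_lang u" "is_term in_lang v" for u v
      using that n unfolding feq_def in_lang_term tvar_def by (auto intro!: V_opair[OF t(1)] simp del: num.simps)
    moreover have "frel R ts \<epsilon> V \<theta>" if "R \<epsilon> rels in_lang" "func ts (ar in_lang R) (all_terms in_lang)" for R ts
    proof -
      have "R = empty" using that by (simp add: rels_in_lang)
      then have "func ts (num 2) (all_terms in_lang)" using that ar_in_lang by simp
      from V_func[OF t(1) n om(2) this] have "ts \<epsilon> V \<theta>" by (simp del: num.simps)
      then show ?thesis using n unfolding frel_def \<open>R = empty\<close>
        by (auto intro!: V_opair[OF t(1)] simp del: num.simps)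
    qed
    moreover have "fneg d \<epsilon> V \<theta>" if "d \<epsilon> V \<theta>" for d
      using that n unfolding fneg_def by (auto intro!: V_opair[OF t(1)] simp del: num.simps)
    moreover have "fconj d e \<epsilon> V \<theta>" if "d \<epsilon> V \<theta>" "e \<epsilon> V \<theta>" for d e
      using that n unfolding fconj_def by (auto intro!: V_opair[OF t(1)] simp del: num.simps)
    moreover have "fex k d \<epsilon> V \<theta>" if "k \<epsilon> omega" "d \<epsilon> V \<theta>" for k d
      using that n unfolding fex_def by (auto intro!: V_opair[OF t(1)] simp del: num.simps)
    ultimately show "c \<epsilon> V \<theta>" using c[unfolded is_formula_def, rule_format, of "V \<theta>"] by blast
  qed
qed

text \<open>Since \<open>sat\<close> asks for some set satisfying the Tarski clauses, this existence
  is what gives it content. Codes may be nonstandard, so the set of assignments satisfying a code is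
  defined by recursion on the code inside the model.\<close>

lemma tarski_exists: "\<exists>S. tarski in_lang (in_struct M) S"
proof -
  define W where "W = tuples omega M"
  have W: "s \<epsilon> W \<longleftrightarrow> func s omega M" for s by (simp add: W_def mem_tuples)
  \<comment> \<open>Here \<open>g\<close> supplies the sets of assignments that satisfy the
    subformulas; \<open>appt\<close> keeps the clauses definable for every \<open>g\<close>.\<close>
  define T where "T c g s \<longleftrightarrow>
    (\<exists>i k. i \<epsilon> omega \<and> k \<epsilon> omega \<and> c = feq (tvar i) (tvar k) \<and> app s i = app s k) \<or>
    (\<exists>i k. i \<epsilon> omega \<and> k \<epsilon> omega \<and> c = fmem i k \<and> app s i \<epsilon> app s k) \<or>
    (\<exists>d. c = fneg d \<and> \<not> s \<epsilon> appt g d) \<or>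
    (\<exists>d e. c = fconj d e \<and> s \<epsilon> appt g d \<and> s \<epsilon> appt g e) \<or>
    (\<exists>k d. k \<epsilon> omega \<and> c = fex k d \<and> (\<exists>a. a \<epsilon> M \<and> upd s k a \<epsilon> appt g d))" for c g s
  define H where "H c g = setof (\<lambda>s. s \<epsilon> W \<and> T c g s)" for c g
  have "dft E (\<lambda>_. True) (\<lambda>s. H (s 0) (s (Suc 0)))" unfolding H_def T_def
    by (intro dfi) (auto simp: W intro: func_fdef)
  from TC_recursion[of H, OF this] obtain F where F: "dft E (\<lambda>_. True) (\<lambda>s. F (s 0))"
    and Fc: "\<And>c. F c = H c (lam (TC c) F)" by blast
  note F' [dfi] = dft_tot1[where R = F, OF F]
  have mem: "s \<epsilon> F c \<longleftrightarrow> s \<epsilon> W \<and> T c (lam (TC c) F) s" for s c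
    unfolding Fc[of c] H_def T_def
    by (rule mem_setof, rule isset_sep[of W], intro dfi) (auto simp: W intro: func_fdef)
  have Feq: "s \<epsilon> F (feq (tvar i) (tvar k)) \<longleftrightarrow> app s i = app s k"
    if "s \<epsilon> W" "i \<epsilon> omega" "k \<epsilon> omega" for s i k
    unfolding mem[of s "feq (tvar i) (tvar k)"] using that by (auto simp: T_def fmem_def)
  have Fmem: "s \<epsilon> F (fmem i k) \<longleftrightarrow> app s i \<epsilon> app s k"
    if "s \<epsilon> W" "i \<epsilon> omega" "k \<epsilon> omega" for s i k
    unfolding mem[of s "fmem i k"] using that by (auto simp: T_def fmem_inj) (auto simp: fmem_def)
  have Fneg: "s \<epsilon> F (fneg d) \<longleftrightarrow> \<not> s \<epsilon> F d" if "s \<epsilon> W" for s d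
    unfolding mem[of s "fneg d"] using that by (auto simp: T_def fmem_def appt_lam[OF F code_TC(1)])
  have Fconj: "s \<epsilon> F (fconj d e) \<longleftrightarrow> s \<epsilon> F d \<and> s \<epsilon> F e" if "s \<epsilon> W" for s d e
    unfolding mem[of s "fconj d e"] using that
    by (auto simp: T_def fmem_def appt_lam[OF F code_TC(2)] appt_lam[OF F code_TC(3)])
  have Fex: "s \<epsilon> F (fex k d) \<longleftrightarrow> (\<exists>a. a \<epsilon> M \<and> upd s k a \<epsilon> F d)" if "s \<epsilon> W" "k \<epsilon> omega" for s k d
    unfolding mem[of s "fex k d"] using that by (auto simp: T_def fmem_def appt_lam[OF F code_TC(4)])
  obtain Fo where Fo: "\<And>c. is_formula in_lang c \<Longrightarrow> c \<epsilon> Fo"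
    using in_lang_formula_bound by blast
  have "isset (\<lambda>p. \<exists>c s. c \<epsilon> Fo \<and> s \<epsilon> W \<and> p = opair c s \<and> s \<epsilon> F c)"
    by (rule isset_sep[of "prods Fo W"], intro dfi) (auto simp: mem_prods)
  then obtain S where "\<And>p. p \<epsilon> S \<longleftrightarrow> (\<exists>c s. c \<epsilon> Fo \<and> s \<epsilon> W \<and> p = opair c s \<and> s \<epsilon> F c)"
    by (auto simp: isset_def)
  then have S: "opair c s \<epsilon> S \<longleftrightarrow> c \<epsilon> Fo \<and> s \<epsilon> W \<and> s \<epsilon> F c" for c s
    by auto
  have "tarski in_lang (in_struct M) S"
    unfolding tarski_def univ_in_struct
  proof (intro allI impI conjI)
    fix s assume s: "func s omega M"
    then have sW: "s \<epsilon> W" by (simp add: W)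
    { fix t u assume tu: "is_term in_lang t" "is_term in_lang u"
      then obtain i k where ik: "i \<epsilon> omega" "k \<epsilon> omega" "t = tvar i" "u = tvar k" by (auto simp: in_lang_term)
      show "opair (feq t u) s \<epsilon> S \<longleftrightarrow> tval in_lang (in_struct M) s t = tval in_lang (in_struct M) s u"
        using is_formula_intros(1)[OF tu] Feq[OF sW ik(1,2)] sW ik by (simp add: S Fo in_lang_tval[OF s]) }
    { fix R ts assume R: "R \<epsilon> rels in_lang" and ts: "func ts (ar in_lang R) (all_terms in_lang)"
      have R0: "R = empty" using R by (simp add: rels_in_lang)
      have ts': "func ts (num 2) (all_terms in_lang)" using ts R0 ar_in_lang by simp
      obtain i k where ik: "i \<epsilon> omega" "k \<epsilon> omega" "app ts (num 0) = tvar i" "app ts (num 1) = tvar k"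
        using func_app[OF ts', of "num 0"] func_app[OF ts', of "num 1"] in_lang_all_terms by auto
      have code: "frel R ts = fmem i k"
        unfolding fmem_def R0 by (rule arg_cong[OF pair_func[OF ts', unfolded ik(3,4)], of "frel empty"])
      have "lam (ar in_lang R) (\<lambda>i. tval in_lang (in_struct M) s (app ts i)) =
          lam (num 2) (\<lambda>m. if m = num 0 then app s i else app s k)"
        unfolding R0 ar_in_lang by (rule lam_cong) (use ik in_lang_tval[OF s] in auto)
      moreover have "func (lam (num 2) (\<lambda>m. if m = num 0 then app s i else app s k)) (num 2) M"
        by (rule func_lam[OF lam_fin_dft]) (use ik func_app[OF s] in auto)
      ultimately have "lam (ar in_lang R) (\<lambda>i. tval in_lang (in_struct M) s (app ts i)) \<epsilon> interp (in_struct M) R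
          \<longleftrightarrow> app s i \<epsilon> app s k"
        unfolding R0 interp_in_struct by (simp add: app_lam[OF lam_fin_dft] del: num.simps)
      then show "opair (frel R ts) s \<epsilon> S \<longleftrightarrow>
          lam (ar in_lang R) (\<lambda>i. tval in_lang (in_struct M) s (app ts i)) \<epsilon> interp (in_struct M) R"
        using is_formula_intros(2)[OF R ts] code Fmem[OF sW ik(1,2)] sW by (simp add: S Fo) }
    { fix c assume "is_formula in_lang c"
      then show "opair (fneg c) s \<epsilon> S \<longleftrightarrow> \<not> opair c s \<epsilon> S"
        using sW by (simp add: S Fo is_formula_intros Fneg) }
    { fix c d assume "is_formula in_lang c" "is_formula in_lang d"
      then show "opair (fconj c d) s \<epsilon> S \<longleftrightarrow> opair c s \<epsilon> S \<and> opair d s \<epsilon> S"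
        using sW by (simp add: S Fo is_formula_intros Fconj) }
    { fix k c assume "k \<epsilon> omega" "is_formula in_lang c"
      then show "opair (fex k c) s \<epsilon> S \<longleftrightarrow> (\<exists>a. a \<epsilon> M \<and> opair c (upd s k a) \<epsilon> S)"
        using sW func_upd[OF s] by (auto simp: S Fo is_formula_intros Fex W) }
  qed
  then show ?thesis by blast
qed

text \<open>Only actual formulas are reached, not the nonstandard codes; this suffices to apply an
  internal elementary embedding to formulas written in HOL.\<close>

primrec code :: "fm \<Rightarrow> 'v" where
  "code (FIn i k) = fmem (num i) (num k)"
| "code (FEq i k) = feq (tvar (num i)) (tvar (num k))"
| "code (FNot p) = fneg (code p)"
| "code (FAnd p q) = fconj (code p) (code q)"
| "code (FEx i p) = fex (num i) (code p)"

lemma fmem_func: "i \<epsilon> omega \<Longrightarrow> k \<epsilon> omega \<Longrightarrow>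
  func (lam (num 2) (\<lambda>m. if m = num 0 then tvar i else tvar k)) (num 2) (all_terms in_lang)"
  by (rule func_lam[OF lam_fin_dft]) (auto simp: in_lang_all_terms)

lemma code_formula: "is_formula in_lang (code p)"
proof (induction p)
  case (FIn i k)
  show ?case unfolding code.simps fmem_def
    by (rule is_formula_intros) (use fmem_func ar_in_lang in \<open>auto simp: rels_in_lang\<close>)
qed (auto intro!: is_formula_intros simp: in_lang_term)

text \<open>On codes of actual formulas any two sets satisfying the Tarski clauses agree, because
  HOL induction over the formula determines the answer. The choice of the witness in
  \<open>sat\<close> is therefore immaterial for them.\<close>

lemma tarski_code:
  assumes S: "tarski in_lang (in_struct M) S" and s: "func s omega M"
  shows "opair (code p) s \<epsilon> S \<longleftrightarrow> rholds E (\<lambda>x. x \<epsilon> M) p (\<lambda>i. app s (num i))"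
  using s
proof (induction p arbitrary: s)
  case (FIn i k)
  let ?ts = "lam (num 2) (\<lambda>m. if m = num 0 then tvar (num i) else tvar (num k))"
  have ts: "func ?ts (num 2) (all_terms in_lang)" by (rule fmem_func) simp_all
  have "opair (code (FIn i k)) s \<epsilon> S \<longleftrightarrow>
      lam (num 2) (\<lambda>i. tval in_lang (in_struct M) s (app ?ts i)) \<epsilon> interp (in_struct M) empty"
    using S FIn ts ar_in_lang unfolding tarski_def univ_in_struct code.simps fmem_def
    by (simp add: rels_in_lang del: num.simps)
  also have "lam (num 2) (\<lambda>i. tval in_lang (in_struct M) s (app ?ts i)) =
      lam (num 2) (\<lambda>m. if m = num 0 then app s (num i) else app s (num k))"
    by (rule lam_cong) (simp add: app_lam[OF lam_fin_dft] in_lang_tval[OF FIn] del: num.simps)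
  also have "\<dots> \<epsilon> interp (in_struct M) empty \<longleftrightarrow> app s (num i) \<epsilon> app s (num k)"
  proof -
    have "func (lam (num 2) (\<lambda>m. if m = num 0 then app s (num i) else app s (num k))) (num 2) M"
      by (rule func_lam[OF lam_fin_dft]) (use func_app[OF FIn] in auto)
    then show ?thesis unfolding interp_in_struct by (simp add: app_lam[OF lam_fin_dft] del: num.simps)
  qed
  finally show ?case by simp
next
  case (FEq i k)
  then show ?case using S in_lang_tval[OF FEq] unfolding tarski_def univ_in_struct code.simps
    by (simp add: in_lang_term)
next
  case (FNot p)
  then show ?case using S code_formula unfolding tarski_def univ_in_struct by simp
next
  case (FAnd p q)
  then show ?case using S code_formula unfolding tarski_def univ_in_struct by simp
next
  case (FEx i p)
  have "opair (code (FEx i p)) s \<epsilon> S \<longleftrightarrow> (\<exists>a. a \<epsilon> M \<and> opair (code p) (upd s (num i) a) \<epsilon> S)"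
    using S code_formula FEx.prems unfolding tarski_def univ_in_struct by simp
  moreover have "(\<lambda>m. app (upd s (num i) a) (num m)) = (\<lambda>m. app s (num m))(i := a)" for a
    using app_upd[OF FEx.prems] by (auto simp: fun_eq_iff)
  ultimately show ?case using FEx.IH[OF func_upd[OF FEx.prems]] by auto
qed

lemma sat_code:
  assumes "func s omega M"
  shows "sat in_lang (in_struct M) (code p) s \<longleftrightarrow> rholds E (\<lambda>x. x \<epsilon> M) p (\<lambda>i. app s (num i))"
  unfolding sat_def using tarski_code[OF _ assms] tarski_exists[of M] by auto

text \<open>The external sequence \<sigma> need not be represented in the model, so only finitely
  many of its values can be prescribed.\<close>

lemma assignment_exists:
  assumes "\<And>i. \<sigma> i \<epsilon> M"
  shows "\<exists>s. func s omega M \<and> (\<forall>i<N. app s (num i) = \<sigma> i)"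
proof (induction N)
  case 0
  have "dft E (\<lambda>s. s 0 \<epsilon> omega) (\<lambda>s. \<sigma> 0)" by (intro dfi)
  from func_lam[OF this, of M] assms show ?case by auto
next
  case (Suc N)
  then obtain s where s: "func s omega M" "\<forall>i<N. app s (num i) = \<sigma> i" by blast
  show ?case by (rule exI[of _ "upd s (num N) (\<sigma> N)"])
      (use s app_upd[OF s(1)] func_upd[OF s(1) assms] in \<open>auto simp: less_Suc_eq\<close>)
qed

lemma elementary_rholds:
  assumes j: "elementary in_lang (in_struct M) (in_struct N) j" and s: "\<And>i. \<sigma> i \<epsilon> M"
  shows "rholds E (\<lambda>x. x \<epsilon> M) p \<sigma> \<longleftrightarrow> rholds E (\<lambda>x. x \<epsilon> N) p (\<lambda>i. app j (\<sigma> i))"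
proof -
  obtain s where s: "func s omega M" "\<And>i. i < vbound p \<Longrightarrow> app s (num i) = \<sigma> i"
    using assignment_exists[of \<sigma> M "vbound p", OF s] by blast
  have jf: "func j M N" using j by (simp add: elementary_def)
  let ?t = "lam omega (\<lambda>m. app j (app s m))"
  have d: "dft E (\<lambda>u. u 0 \<epsilon> omega) (\<lambda>u. app j (app s (u 0)))"
    by (intro dfi) (auto intro: func_fdef[OF s(1)] func_fdef[OF jf] func_app[OF s(1)])
  have t: "func ?t omega N" by (rule func_lam[OF d]) (intro func_app[OF jf] func_app[OF s(1)])
  have "rholds E (\<lambda>x. x \<epsilon> M) p \<sigma> \<longleftrightarrow> sat in_lang (in_struct M) (code p) s"
    unfolding sat_code[OF s(1)] by (rule rholds_vbound) (simp add: s)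
  also have "\<dots> \<longleftrightarrow> sat in_lang (in_struct N) (code p) ?t"
    using j code_formula s(1) by (simp add: elementary_def)
  also have "\<dots> \<longleftrightarrow> rholds E (\<lambda>x. x \<epsilon> N) p (\<lambda>i. app j (\<sigma> i))"
    unfolding sat_code[OF t] by (rule rholds_vbound) (simp add: s app_lam[OF d])
  finally show ?thesis .
qed

section \<open>Embeddings given by a Berkeley cardinal\<close>

definition top_fm :: fm where "top_fm = FNot (FEx 1 (FIn 0 1))"

definition iff_fm :: "fm \<Rightarrow> fm \<Rightarrow> fm" where
  "iff_fm p q = FAnd (FNot (FAnd p (FNot q))) (FNot (FAnd q (FNot p)))"

definition or_fm :: "fm \<Rightarrow> fm \<Rightarrow> fm" where "or_fm p q = FNot (FAnd (FNot p) (FNot q))"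
definition all_fm :: "nat \<Rightarrow> fm \<Rightarrow> fm" where "all_fm i p = FNot (FEx i (FNot p))"

text \<open>Variable 0 is the Kuratowski pair of variables 1 and 2; variables 3 and 4 are the
  singleton and the unordered pair of which it consists.\<close>

definition pair_fm :: fm where
  "pair_fm = FEx 3 (FEx 4 (FAnd (all_fm 5 (iff_fm (FIn 5 0) (or_fm (FEq 5 3) (FEq 5 4))))
    (FAnd (all_fm 5 (iff_fm (FIn 5 3) (FEq 5 1)))
      (all_fm 5 (iff_fm (FIn 5 4) (or_fm (FEq 5 1) (FEq 5 2)))))))"

lemma rholds_connectives:
  "rholds E M (iff_fm p q) s \<longleftrightarrow> (rholds E M p s \<longleftrightarrow> rholds E M q s)"
  "rholds E M (or_fm p q) s \<longleftrightarrow> (rholds E M p s \<or> rholds E M q s)"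
  "rholds E M (all_fm i p) s \<longleftrightarrow> (\<forall>x. M x \<longrightarrow> rholds E M p (s(i := x)))"
  by (auto simp: iff_fm_def or_fm_def all_fm_def)

lemma rholds_pair_fm:
  assumes M: "transitive M" and z: "s 0 \<epsilon> M" "s 1 \<epsilon> M" "s 2 \<epsilon> M"
  shows "rholds E (\<lambda>x. x \<epsilon> M) pair_fm s \<longleftrightarrow> s 0 = opair (s 1) (s 2)"
proof -
  have eq: "(\<forall>w. w \<epsilon> M \<longrightarrow> (w \<epsilon> a \<longleftrightarrow> w = b \<or> w = c)) \<longleftrightarrow> a = upair b c"
    if "a \<epsilon> M" "b \<epsilon> M" "c \<epsilon> M" for a b c
  proof
    assume a: "\<forall>w. w \<epsilon> M \<longrightarrow> (w \<epsilon> a \<longleftrightarrow> w = b \<or> w = c)"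
    show "a = upair b c"
    proof (rule extensionality[OF allI])
      fix u show "u \<epsilon> a \<longleftrightarrow> u \<epsilon> upair b c"
        using a that transitiveD[OF M, of a u] by (cases "u \<epsilon> M") auto
    qed
  qed simp
  have "rholds E (\<lambda>x. x \<epsilon> M) pair_fm s \<longleftrightarrow> (\<exists>u. u \<epsilon> M \<and> (\<exists>v. v \<epsilon> M \<and>
      (\<forall>w. w \<epsilon> M \<longrightarrow> (w \<epsilon> s 0 \<longleftrightarrow> w = u \<or> w = v)) \<and>
      (\<forall>w. w \<epsilon> M \<longrightarrow> (w \<epsilon> u \<longleftrightarrow> w = s 1 \<or> w = s 1)) \<and>
      (\<forall>w. w \<epsilon> M \<longrightarrow> (w \<epsilon> v \<longleftrightarrow> w = s 1 \<or> w = s 2))))"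
    by (simp add: pair_fm_def rholds_connectives)
  also have "\<dots> \<longleftrightarrow> (\<exists>u. u \<epsilon> M \<and> (\<exists>v. v \<epsilon> M \<and> s 0 = upair u v \<and> u = upair (s 1) (s 1) \<and> v = upair (s 1) (s 2)))"
    using z by (simp only: eq cong: conj_cong)
  also have "\<dots> \<longleftrightarrow> s 0 = opair (s 1) (s 2)"
    using transitiveD[OF M z(1), of "upair (s 1) (s 1)"] transitiveD[OF M z(1), of "upair (s 1) (s 2)"]
    by (auto simp: opair_def)
  finally show ?thesis .
qed

text \<open>A member of the closure has rank at most that of \<open>t\<close>, so it cannot contain
  \<open>t\<close>. Conversely, deleting some \<open>x \<noteq> t\<close> that belongs to no member
  would leave a smaller transitive set containing \<open>t\<close>, against minimality of the
  closure.\<close>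

lemma TC_singleton:
  shows "transitive (TC (upair t t))" "t \<epsilon> TC (upair t t)"
    and "y \<epsilon> TC (upair t t) \<Longrightarrow> \<not> t \<epsilon> y"
    and "x \<epsilon> TC (upair t t) \<Longrightarrow> (\<And>y. y \<epsilon> TC (upair t t) \<Longrightarrow> \<not> x \<epsilon> y) \<Longrightarrow> x = t"
proof -
  let ?M = "TC (upair t t)"
  show M: "transitive ?M" by (rule TC_transitive)
  show t: "t \<epsilon> ?M" using TC_sub[of "upair t t"] by (simp add: sub_def)
  show "\<not> t \<epsilon> y" if y: "y \<epsilon> ?M"
  proof
    assume ty: "t \<epsilon> y"
    have o: "ordinal (succ (rank t))" by (simp add: ordinal_succ)
    have "sub ?M (V (succ (rank t)))"
      by (rule TC_least[OF V_transitive[OF o]]) (simp add: sub_def mem_V[OF o])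
    then have "rank y \<epsilon> succ (rank t)" using y mem_V[OF o] by (simp add: sub_def)
    then show False using rank_mem[OF ty] no_mem_cycle[of "rank t" "rank y"] by auto
  qed
  show "x = t" if x: "x \<epsilon> ?M" "\<And>y. y \<epsilon> ?M \<Longrightarrow> \<not> x \<epsilon> y"
  proof (rule ccontr)
    assume n: "x \<noteq> t"
    have "dfp E (\<lambda>s. s 0 \<epsilon> ?M) (\<lambda>s. s 0 \<noteq> x)" by (intro dfi)
    from sep[OF this] obtain N where N: "\<And>y. y \<epsilon> N \<longleftrightarrow> y \<epsilon> ?M \<and> y \<noteq> x" by blast
    have "transitive N"
      unfolding transitive_def
    proof (intro allI impI)
      fix y u assume yu: "y \<epsilon> N" "u \<epsilon> y"
      then have "y \<epsilon> ?M" using N by blast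
      then show "u \<epsilon> N" using N[of u] x(2) transitiveD[OF M, of y u] yu(2) by blast
    qed
    moreover have "sub (upair t t) N" using n t N by (simp add: sub_def)
    ultimately have "sub ?M N" by (rule TC_least)
    then show False using x N unfolding sub_def by blast
  qed
qed

text \<open>\<open>t\<close> is the only element of the transitive closure of \<open>{t}\<close> that belongs to no other element.\<close>

lemma berkeley_fixing:
  assumes b: "berkeley \<delta>" and eta: "\<eta> \<epsilon> \<delta>" and d: "\<delta> \<epsilon> TC (upair t t)"
  obtains j \<kappa> where "func j (TC (upair t t)) (TC (upair t t))" "app j t = t"
    "\<And>x y. x \<epsilon> TC (upair t t) \<Longrightarrow> y \<epsilon> TC (upair t t) \<Longrightarrow> x \<epsilon> y \<longleftrightarrow> app j x \<epsilon> app j y"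
    "\<And>x y. opair x y \<epsilon> TC (upair t t) \<Longrightarrow> app j (opair x y) = opair (app j x) (app j y)"
    "ordinal \<kappa>" "\<eta> \<epsilon> \<kappa>" "\<kappa> \<epsilon> \<delta>" "app j \<kappa> \<noteq> \<kappa>" "\<And>\<alpha>. \<alpha> \<epsilon> \<kappa> \<Longrightarrow> app j \<alpha> = \<alpha>"
proof -
  define M where "M = TC (upair t t)"
  note M = TC_singleton[where t = t, folded M_def]
  obtain j \<kappa> where j: "elementary in_lang (in_struct M) (in_struct M) j"
    and k: "is_crit M j \<kappa>" "\<eta> \<epsilon> \<kappa>" "\<kappa> \<epsilon> \<delta>"
    using b eta d M(1) unfolding berkeley_def M_def by blast
  have jf: "func j M M" using j by (simp add: elementary_def)
  note el = elementary_rholds[OF j]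
  have jt: "app j t = t"
  proof (rule M(4))
    show "app j t \<epsilon> M" using func_app[OF jf M(2)] .
    have "rholds E (\<lambda>x. x \<epsilon> M) top_fm (\<lambda>_. t)" using M(3) by (simp add: top_fm_def)
    then have "rholds E (\<lambda>x. x \<epsilon> M) top_fm (\<lambda>_. app j t)" using el[of "\<lambda>_. t" top_fm] M(2) by blast
    then show "\<not> app j t \<epsilon> y" if "y \<epsilon> M" for y using that by (simp add: top_fm_def)
  qed
  have e: "x \<epsilon> y \<longleftrightarrow> app j x \<epsilon> app j y" if "x \<epsilon> M" "y \<epsilon> M" for x y
    using el[of "\<lambda>i. if i = 0 then x else y" "FIn 0 1"] that by simp
  have p: "app j (opair x y) = opair (app j x) (app j y)" if xy: "opair x y \<epsilon> M" for x y
  proof -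
    have "upair x y \<epsilon> M" by (rule transitiveD[OF M(1) xy]) (simp add: opair_def)
    then have m: "x \<epsilon> M" "y \<epsilon> M" by (rule transitiveD[OF M(1)]; simp)+
    let ?s = "\<lambda>i. if i = 0 then opair x y else if i = 1 then x else y"
    have "rholds E (\<lambda>x. x \<epsilon> M) pair_fm ?s"
      by (subst rholds_pair_fm) (use M(1) xy m in auto)
    then have "rholds E (\<lambda>x. x \<epsilon> M) pair_fm (\<lambda>i. app j (?s i))"
      by (subst el[symmetric]) (use xy m in auto)
    then show ?thesis by (subst (asm) rholds_pair_fm) (use M(1) xy m func_app[OF jf] in auto)
  qed
  show ?thesis
    by (rule that[of j \<kappa>, folded M_def, OF jf jt e p]) (use k in \<open>auto simp: is_crit_def\<close>)
qed

text \<open>Relations have four arguments; those of smaller arity ignore the remaining ones.\<close>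

type_synonym 'a rel4 = "'a \<Rightarrow> 'a \<Rightarrow> 'a \<Rightarrow> 'a \<Rightarrow> bool"

definition preserves :: "'v \<Rightarrow> 'v \<Rightarrow> 'v rel4 \<Rightarrow> bool" where
  "preserves \<theta> j Q \<longleftrightarrow> (\<forall>a b c d. a \<epsilon> V \<theta> \<longrightarrow> b \<epsilon> V \<theta> \<longrightarrow> c \<epsilon> V \<theta> \<longrightarrow> d \<epsilon> V \<theta> \<longrightarrow>
    (Q a b c d \<longleftrightarrow> Q (app j a) (app j b) (app j c) (app j d)))"

abbreviation definable4 :: "'v rel4 \<Rightarrow> bool" where
  "definable4 Q \<equiv> dfp E (\<lambda>_. True) (\<lambda>s. Q (s 0) (s (Suc 0)) (s (Suc (Suc 0))) (s (Suc (Suc (Suc 0)))))"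

definition emb :: "'v \<Rightarrow> 'v rel4 set \<Rightarrow> 'v \<Rightarrow> 'v \<Rightarrow> bool" where
  "emb \<theta> Qs j \<kappa> \<longleftrightarrow> func j (V \<theta>) (V \<theta>) \<and>
    (\<forall>Q\<in>Qs. preserves \<theta> j Q) \<and>
    ordinal \<kappa> \<and> app j \<kappa> \<noteq> \<kappa> \<and> (\<forall>\<alpha>. \<alpha> \<epsilon> \<kappa> \<longrightarrow> app j \<alpha> = \<alpha>)"

definition graph4 :: "'v \<Rightarrow> 'v rel4 \<Rightarrow> 'v" where
  "graph4 \<theta> Q = setof (\<lambda>p. \<exists>a b c d. a \<epsilon> V \<theta> \<and> b \<epsilon> V \<theta> \<and> c \<epsilon> V \<theta> \<and> d \<epsilon> V \<theta> \<and>
     p = opair a (opair b (opair c d)) \<and> Q a b c d)"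

lemma mem_graph4:
  assumes "limit \<theta>" "definable4 Q"
    and "a \<epsilon> V \<theta>" "b \<epsilon> V \<theta>" "c \<epsilon> V \<theta>" "d \<epsilon> V \<theta>"
  shows "opair a (opair b (opair c d)) \<epsilon> graph4 \<theta> Q \<longleftrightarrow> Q a b c d"
proof -
  have Q' [dfi]: "dft E G a \<Longrightarrow> dft E G b \<Longrightarrow> dft E G c \<Longrightarrow> dft E G d \<Longrightarrow>
      dfp E G (\<lambda>s. Q (a s) (b s) (c s) (d s))" for G a b c d
    by (rule dfp_sub4[where R = Q and H = "\<lambda>_ _ _ _. True", OF assms(2)]) auto
  have "isset (\<lambda>p. \<exists>a b c d. a \<epsilon> V \<theta> \<and> b \<epsilon> V \<theta> \<and> c \<epsilon> V \<theta> \<and> d \<epsilon> V \<theta> \<and>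
     p = opair a (opair b (opair c d)) \<and> Q a b c d)"
    by (rule isset_sep[of "V \<theta>"], intro dfi) (use V_opair[OF assms(1)] in blast)
  from mem_setof[OF this] assms(3-) show ?thesis unfolding graph4_def by auto
qed

text \<open>All graphs to be fixed are packed into one set \<open>t\<close>. An embedding that fixes
  \<open>t\<close> fixes each graph, and a relation whose graph is fixed is preserved.\<close>

lemma berkeley_emb:
  assumes b: "berkeley \<delta>" and eta: "\<eta> \<epsilon> \<delta>" and th: "limit \<theta>" "\<delta> \<epsilon> \<theta>"
    and Qs: "\<And>Q. Q \<in> set Qs \<Longrightarrow>
      definable4 Q"
  shows "\<exists>j \<kappa>. emb \<theta> (set Qs) j \<kappa> \<and> \<eta> \<epsilon> \<kappa> \<and> \<kappa> \<epsilon> \<delta>"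
proof -
  \<comment> \<open>A right-nested list of ordered pairs that ends in \<open>V \<theta>\<close>, so
    that \<open>V \<theta>\<close> is fixed too and the embedding restricts to it.\<close>
  define t where "t = foldr (\<lambda>Q u. opair (graph4 \<theta> Q) u) Qs (V \<theta>)"
  define M where "M = TC (upair t t)"
  note M = TC_singleton[where t = t, folded M_def]
  have o: "ordinal \<theta>" using th limitD by blast
  have od: "ordinal \<delta>" using b by (simp add: berkeley_def)
  have pM: "x \<epsilon> M \<and> y \<epsilon> M" if xy: "opair x y \<epsilon> M" for x y
  proof -
    have "upair x y \<epsilon> M" by (rule transitiveD[OF M(1) xy]) (simp add: opair_def)
    then show ?thesis using transitiveD[OF M(1), of "upair x y"] by simp
  qed
  have sub: "V \<theta> \<epsilon> M \<and> (\<forall>Q\<in>set Qs'. graph4 \<theta> Q \<epsilon> M)"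
    if "foldr (\<lambda>Q u. opair (graph4 \<theta> Q) u) Qs' (V \<theta>) \<epsilon> M" for Qs'
    using that by (induction Qs') (auto dest: pM)
  have VM: "V \<theta> \<epsilon> M" and GM: "\<And>Q. Q \<in> set Qs \<Longrightarrow> graph4 \<theta> Q \<epsilon> M"
    using sub[of Qs] M(2) unfolding t_def by auto
  have VM': "x \<epsilon> M" if "x \<epsilon> V \<theta>" for x using transitiveD[OF M(1) VM that] .
  have dM: "\<delta> \<epsilon> M" by (rule VM') (simp add: ordinal_mem_V[OF o od] th)
  obtain j \<kappa> where jf: "func j M M" and jt: "app j t = t"
    and je: "\<And>x y. x \<epsilon> M \<Longrightarrow> y \<epsilon> M \<Longrightarrow> x \<epsilon> y \<longleftrightarrow> app j x \<epsilon> app j y"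
    and jp: "\<And>x y. opair x y \<epsilon> M \<Longrightarrow> app j (opair x y) = opair (app j x) (app j y)"
    and k: "ordinal \<kappa>" "\<eta> \<epsilon> \<kappa>" "\<kappa> \<epsilon> \<delta>" "app j \<kappa> \<noteq> \<kappa>" "\<And>\<alpha>. \<alpha> \<epsilon> \<kappa> \<Longrightarrow> app j \<alpha> = \<alpha>"
    by (rule berkeley_fixing[OF b eta dM[unfolded M_def], folded M_def]) blast
  \<comment> \<open>The list is unpacked from the left: j commutes with ordered pairs in
    \<open>M\<close>, so fixing a pair means fixing both components.\<close>
  have fix': "app j (V \<theta>) = V \<theta> \<and> (\<forall>Q\<in>set Qs'. app j (graph4 \<theta> Q) = graph4 \<theta> Q)"
    if "foldr (\<lambda>Q u. opair (graph4 \<theta> Q) u) Qs' (V \<theta>) \<epsilon> M"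
      "app j (foldr (\<lambda>Q u. opair (graph4 \<theta> Q) u) Qs' (V \<theta>)) = foldr (\<lambda>Q u. opair (graph4 \<theta> Q) u) Qs' (V \<theta>)" for Qs'
    using that
  proof (induction Qs')
    case (Cons Q Qs')
    have m: "opair (graph4 \<theta> Q) (foldr (\<lambda>Q u. opair (graph4 \<theta> Q) u) Qs' (V \<theta>)) \<epsilon> M"
      using Cons.prems(1) by simp
    then show ?case using Cons.IH Cons.prems(2) pM[OF m] jp[OF m] by simp
  qed simp
  have jV: "app j (V \<theta>) = V \<theta>" and jG: "\<And>Q. Q \<in> set Qs \<Longrightarrow> app j (graph4 \<theta> Q) = graph4 \<theta> Q"
    using fix'[of Qs] M(2) jt unfolding t_def by auto
  have jVV: "app j x \<epsilon> V \<theta>" if "x \<epsilon> V \<theta>" for x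
    using je[OF VM'[OF that] VM] that jV by simp
  have dj: "dft E (\<lambda>s. s 0 \<epsilon> V \<theta>) (\<lambda>s. app j (s 0))"
    by (intro dfi) (rule func_fdef[OF jf VM'])
  define j' where "j' = lam (V \<theta>) (app j)"
  have j': "app j' x = app j x" if "x \<epsilon> V \<theta>" for x unfolding j'_def by (rule app_lam[OF dj that])
  have kV: "\<kappa> \<epsilon> V \<theta>"
    using ordinal_mem_V[OF o k(1)] ordinal_trans[OF o th(2) k(3)] by simp
  have "func j' (V \<theta>) (V \<theta>)" unfolding j'_def by (rule func_lam[OF dj jVV])
  \<comment> \<open>\<open>Q\<close> holds iff the quadruple lies in its graph, hence iff the image
    of the quadruple lies in the image of the graph, which is the same graph.\<close>
  moreover have "Q a b c d \<longleftrightarrow> Q (app j' a) (app j' b) (app j' c) (app j' d)"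
    if Q: "Q \<in> set Qs" and v: "a \<epsilon> V \<theta>" "b \<epsilon> V \<theta>" "c \<epsilon> V \<theta>" "d \<epsilon> V \<theta>" for Q a b c d
  proof -
    have m: "opair c d \<epsilon> V \<theta>" "opair b (opair c d) \<epsilon> V \<theta>" "opair a (opair b (opair c d)) \<epsilon> V \<theta>"
      using v by (auto intro!: V_opair[OF th(1)])
    have "app j (opair a (opair b (opair c d))) = opair (app j a) (opair (app j b) (opair (app j c) (app j d)))"
      using m VM' jp by simp
    then show ?thesis
      using mem_graph4[OF th(1) Qs[OF Q] v] mem_graph4[OF th(1) Qs[OF Q] v[THEN jVV]]
        je[OF VM'[OF m(3)] GM[OF Q]] jG[OF Q] v j' by simp
  qed
  moreover have "app j' \<alpha> = \<alpha>" if "\<alpha> \<epsilon> \<kappa>" for \<alpha>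
    using j'[OF V_mem[OF o kV that]] k(5)[OF that] by simp
  ultimately have "emb \<theta> (set Qs) j' \<kappa>" unfolding emb_def preserves_def using k j'[OF kV] by auto
  then show ?thesis using k by blast
qed

section \<open>Definability of semantic notions\<close>

lemma dfp_injective [dfi]:
  assumes "dft E G f" "dft E G a" "\<And>s. G s \<Longrightarrow> \<exists>B. func (f s) (a s) B"
  shows "dfp E G (\<lambda>s. injective (f s) (a s))"
  by (rule dfp_sub2[where R = injective and H = "\<lambda>f a. \<exists>B. func f a B"])
    (unfold injective_def, intro dfi, use assms in \<open>auto intro: func_fdef\<close>)

lemma dfp_surjective [dfi]:
  assumes "dft E G f" "dft E G a" "dft E G b" "\<And>s. G s \<Longrightarrow> \<exists>B. func (f s) (a s) B"
  shows "dfp E G (\<lambda>s. surjective (f s) (a s) (b s))"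
  by (rule dfp_sub3[where R = surjective and H = "\<lambda>f a b. \<exists>B. func f a B"])
    (unfold surjective_def, intro dfi, use assms in \<open>auto intro: func_fdef\<close>)

lemma dfp_cardinal [dfi]: "dft E G a \<Longrightarrow> dfp E G (\<lambda>s. cardinal (a s))"
  by (rule dfp_tot1[where R = cardinal]) (unfold cardinal_def, intro dfi, auto)

lemma dft_tuples [dfi]: "dft E G a \<Longrightarrow> dft E G b \<Longrightarrow> dft E G (\<lambda>s. tuples (a s) (b s))"
  by (rule dft_tot2[where R = tuples]) (unfold tuples_def, intro dfi, auto)

lemma dft_tapp [dfi]: "dft E G a \<Longrightarrow> dft E G b \<Longrightarrow> dft E G (\<lambda>s. tapp (a s) (b s))"
  unfolding tapp_def by (intro dfi)

lemma dft_fall [dfi]: "dft E G a \<Longrightarrow> dft E G b \<Longrightarrow> dft E G (\<lambda>s. fall (a s) (b s))"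
  unfolding fall_def by (intro dfi)

lemma dft_univ [dfi]:
  assumes "dft E G a" "\<And>s. G s \<Longrightarrow> \<exists>U I. a s = opair U I"
  shows "dft E G (\<lambda>s. univ (a s))"
  by (rule dft_sub1[where R = univ and H = "\<lambda>a. \<exists>U I. a = opair U I"])
    (unfold univ_def, intro dfi dft_the, use assms in auto)

lemma dft_interp [dfi]:
  assumes "dft E G a" "dft E G x" "\<And>s. G s \<Longrightarrow> \<exists>U I. a s = opair U I \<and> fdef I (x s)"
  shows "dft E G (\<lambda>s. interp (a s) (x s))"
  by (rule dft_sub2[where R = interp and H = "\<lambda>a x. \<exists>U I. a = opair U I \<and> fdef I x"])
    (unfold interp_def, intro dfi dft_the, use assms in auto)

lemma dft_seq_sup [dfi]:
  assumes "dft E G a" "\<And>s. G s \<Longrightarrow> \<exists>B. func (a s) omega B"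
  shows "dft E G (\<lambda>s. seq_sup (a s))"
  by (rule dft_sub1[where R = seq_sup and H = "\<lambda>l. \<exists>B. func l omega B"])
    (unfold seq_sup_def, intro dfi, use assms in \<open>auto intro: func_fdef\<close>)

text \<open>Induction inside the model on initial segments of the tuple: at each step one more rank
  is absorbed below the limit. The argument makes no assumption on the cofinality of
  \<theta>.\<close>

lemma tuple_bounded:
  assumes t: "limit \<theta>" and n: "n \<epsilon> omega" and ts: "func ts n (V \<theta>)"
  shows "\<exists>\<alpha>. \<alpha> \<epsilon> \<theta> \<and> func ts n (V \<alpha>)"
proof -
  have o: "ordinal \<theta>" using t limitD by blast
  have "sub m n \<longrightarrow> (\<exists>\<alpha>. \<alpha> \<epsilon> \<theta> \<and> (\<forall>i. i \<epsilon> m \<longrightarrow> rank (app ts i) \<epsilon> \<alpha>))" if "m \<epsilon> omega" for m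
    using that
  proof (induction rule: omega_induct)
    case dfp show ?case by (intro dfi) (auto simp: sub_def intro: func_fdef[OF ts])
  next
    case empty show ?case using limitD(2)[OF t] by auto
  next
    case (succ m)
    show ?case
    proof
      assume s: "sub (succ m) n"
      then obtain \<alpha> where a: "\<alpha> \<epsilon> \<theta>" "\<And>i. i \<epsilon> m \<Longrightarrow> rank (app ts i) \<epsilon> \<alpha>" using succ by (auto simp: sub_def)
      have "rank (app ts m) \<epsilon> \<theta>" using func_app[OF ts, of m] s mem_V[OF o] by (simp add: sub_def)
      then obtain \<gamma> where g: "\<gamma> \<epsilon> \<theta>" "\<alpha> \<epsilon> \<gamma>" "rank (app ts m) \<epsilon> \<gamma>" using limit_max[OF t a(1)] by blast
      have "ordinal \<gamma>" using g o ordinal_mem by blast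
      then have "rank (app ts i) \<epsilon> \<gamma>" if "i \<epsilon> succ m" for i
        using that g a(2)[of i] ordinal_trans[of \<gamma> \<alpha>] by auto
      then show "\<exists>\<alpha>. \<alpha> \<epsilon> \<theta> \<and> (\<forall>i. i \<epsilon> succ m \<longrightarrow> rank (app ts i) \<epsilon> \<alpha>)" using g by blast
    qed
  qed
  from this[OF n] obtain \<alpha> where a: "\<alpha> \<epsilon> \<theta>" "\<And>i. i \<epsilon> n \<Longrightarrow> rank (app ts i) \<epsilon> \<alpha>" by (auto simp: sub_def)
  have oa: "ordinal \<alpha>" using a o ordinal_mem by blast
  have "func ts n (V \<alpha>)" by (rule func_cod[OF ts]) (simp add: mem_V[OF oa] a)
  then show ?thesis using a by blast
qed

lemma V_V: "ordinal \<theta> \<Longrightarrow> \<alpha> \<epsilon> \<theta> \<Longrightarrow> V \<alpha> \<epsilon> V \<theta>"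
  using ordinal_mem[of \<theta> \<alpha>] by (simp add: mem_V[of \<theta>] rank_V)

lemma V_omega: "limit \<theta> \<Longrightarrow> n \<epsilon> omega \<Longrightarrow> n \<epsilon> V \<theta>"
  by (simp add: ordinal_mem_V limitD omega_ordinal limit_omega)

lemma V_tuple: "limit \<theta> \<Longrightarrow> n \<epsilon> omega \<Longrightarrow> func ts n (V \<theta>) \<Longrightarrow> ts \<epsilon> V \<theta>"
  using tuple_bounded[of \<theta> n ts] V_func[of \<theta> n _ ts] V_V[of \<theta>] V_omega[of \<theta> n] limitD(1)[of \<theta>] by blast

lemma structureE:
  assumes "is_structure L A"
  obtains U I B where "A = opair U I" "func I (symbols L) B" "univ A = U" "\<exists>x. x \<epsilon> U"
    "\<And>R s. R \<epsilon> rels L \<Longrightarrow> s \<epsilon> app I R \<Longrightarrow> func s (ar L R) U"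
    "\<And>F. F \<epsilon> funs L \<Longrightarrow> func (app I F) (tuples (ar L F) U) U"
proof -
  obtain U I B where "A = opair U I" "\<exists>x. x \<epsilon> U" "func I (symbols L) B"
    "\<forall>R. R \<epsilon> rels L \<longrightarrow> (\<forall>s. s \<epsilon> app I R \<longrightarrow> func s (ar L R) U)"
    "\<forall>F. F \<epsilon> funs L \<longrightarrow> func (app I F) (tuples (ar L F) U) U"
    using assms unfolding is_structure_def by blast
  then show ?thesis by (intro that[of U I B]) simp_all
qed

lemma structure_pair: "is_structure L A \<Longrightarrow> \<exists>U I. A = opair U I"
  by (erule structureE) blast

lemma structure_interp:
  "is_structure L A \<Longrightarrow> x \<epsilon> rels L \<or> x \<epsilon> funs L \<Longrightarrow> \<exists>U I. A = opair U I \<and> fdef I x"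
  by (erule structureE) (auto simp: symbols_def intro: func_fdef)

lemma structure_fun:
  "is_structure L A \<Longrightarrow> F \<epsilon> funs L \<Longrightarrow> func (interp A F) (tuples (ar L F) (univ A)) (univ A)"
  by (erule structureE) simp

section \<open>Syntax and semantics of a fixed first-order language of the model\<close>

context
  fixes L :: "'v language"
  assumes L: "is_language L"
begin

lemma ar_omega: "x \<epsilon> rels L \<or> x \<epsilon> funs L \<Longrightarrow> ar L x \<epsilon> omega"
  using L func_app[of "arity L" "symbols L" omega x] by (auto simp: is_language_def ar_def symbols_def)

lemma dft_ar:
  assumes "dft E G x" "\<And>s. G s \<Longrightarrow> x s \<epsilon> rels L \<or> x s \<epsilon> funs L"
  shows "dft E G (\<lambda>s. ar L (x s))"
  unfolding ar_def using assms L
  by (intro dfi) (auto simp: is_language_def symbols_def intro!: func_fdef[of "arity L" "symbols L" omega])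

lemma dfp_term: "dft E G a \<Longrightarrow> dfp E G (\<lambda>s. is_term L (a s))"
  by (rule dfp_tot1[where R = "is_term L"]) (unfold is_term_def, intro dfi dft_ar, auto)

lemma term_tvar: "k \<epsilon> omega \<Longrightarrow> is_term L (tvar k)"
  unfolding is_term_def by blast

text \<open>A limit level containing the natural numbers and the function symbols is closed under
  term formation (\<open>V_tuple\<close>), so the terms form a set and \<open>all_terms\<close>
  denotes it.\<close>

lemma mem_all_terms: "t \<epsilon> all_terms L \<longleftrightarrow> is_term L t"
proof -
  obtain \<theta> where t: "limit \<theta>" "union2 omega (funs L) \<epsilon> V \<theta>" using ex_limit by blast
  have o: "ordinal \<theta>" using t limitD by blast
  have m: "x \<epsilon> omega \<Longrightarrow> x \<epsilon> V \<theta>" "x \<epsilon> funs L \<Longrightarrow> x \<epsilon> V \<theta>" for x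
    by (rule V_mem[OF o t(2)], simp)+
  have "isset (is_term L)"
  proof (rule isset_sep[of "V \<theta>"])
    show "dfp E (\<lambda>s. s 0 \<epsilon> V \<theta>) (\<lambda>s. is_term L (s 0))" by (intro dfp_term dfi)
    have a: "tvar k \<epsilon> V \<theta>" if "k \<epsilon> omega" for k
      unfolding tvar_def using that m by (intro V_opair[OF t(1)]) (auto simp del: num.simps)
    have b: "tapp F ts \<epsilon> V \<theta>" if "F \<epsilon> funs L" "func ts (ar L F) (V \<theta>)" for F ts
      unfolding tapp_def using m V_tuple[OF t(1) ar_omega, of F ts] that
      by (intro V_opair[OF t(1)]) (simp_all del: num.simps)
    show "u \<epsilon> V \<theta>" if "is_term L u" for u
      using that[unfolded is_term_def, rule_format, of "V \<theta>"] a b by blast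
  qed
  from mem_setof[OF this] show ?thesis unfolding all_terms_def .
qed

lemma term_tapp: "F \<epsilon> funs L \<Longrightarrow> func ts (ar L F) (all_terms L) \<Longrightarrow> is_term L (tapp F ts)"
  unfolding is_term_def
proof (intro allI impI)
  fix X assume F: "F \<epsilon> funs L" and ts: "func ts (ar L F) (all_terms L)"
    and X: "(\<forall>k. k \<epsilon> omega \<longrightarrow> tvar k \<epsilon> X) \<and>
      (\<forall>F ts. F \<epsilon> funs L \<longrightarrow> func ts (ar L F) X \<longrightarrow> tapp F ts \<epsilon> X)"
  have "u \<epsilon> X" if "u \<epsilon> all_terms L" for u using that X unfolding mem_all_terms is_term_def by blast
  then have "func ts (ar L F) X" using func_cod[OF ts] func_app[OF ts] by blast
  then show "tapp F ts \<epsilon> X" using X F by blast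
qed

lemma dfp_formula: "dft E G a \<Longrightarrow> dfp E G (\<lambda>s. is_formula L (a s))"
  by (rule dfp_tot1[where R = "is_formula L"])
    (unfold is_formula_def, intro dfi dft_ar dfp_term, auto)

lemma dfp_structure: "dft E G a \<Longrightarrow> dfp E G (\<lambda>s. is_structure L (a s))"
  by (rule dfp_tot1[where R = "is_structure L"])
    (unfold is_structure_def, intro dfi dft_ar, auto simp: symbols_def intro: func_fdef)

lemma eval_args:
  assumes "func ts (ar L F) (all_terms L)" "func e (all_terms L) U"
  shows "lam (ar L F) (\<lambda>i. app e (app ts i)) \<epsilon> tuples (ar L F) U"
proof -
  have "dft E (\<lambda>s. s 0 \<epsilon> ar L F) (\<lambda>s. app e (app ts (s 0)))"
    by (intro dfi) (auto intro: func_fdef[OF assms(1)] func_fdef[OF assms(2)] func_app[OF assms(1)])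
  then show ?thesis unfolding mem_tuples
    by (rule func_lam) (intro func_app[OF assms(2)] func_app[OF assms(1)])
qed

lemma dfp_evaluates:
  assumes "dft E G a" "dft E G b" "dft E G c" "\<And>s. G s \<Longrightarrow> is_structure L (a s) \<and> func (b s) omega (univ (a s))"
  shows "dfp E G (\<lambda>s. evaluates L (a s) (b s) (c s))"
  by (rule dfp_sub3[where R = "evaluates L" and H = "\<lambda>A s e. is_structure L A \<and> func s omega (univ A)"])
    (unfold evaluates_def, intro dfi dft_ar,
      use assms in \<open>auto simp: mem_all_terms term_tvar term_tapp structure_pair structure_interp
        intro: func_fdef func_fdef[OF structure_fun eval_args] func_app\<close>)

text \<open>The terms on which two evaluations agree form a set closed under term formation, which
  may be used as \<open>X\<close> in \<open>is_term\<close>.\<close>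

lemma evaluates_unique:
  assumes A: "is_structure L A" and e: "evaluates L A s e" and f: "evaluates L A s f" and t: "is_term L t"
  shows "app e t = app f t"
proof -
  have ef: "func e (all_terms L) (univ A)" "func f (all_terms L) (univ A)"
    using e f by (auto simp: evaluates_def)
  have "dfp E (\<lambda>s. s 0 \<epsilon> all_terms L) (\<lambda>s. app e (s 0) = app f (s 0))"
    by (intro dfi) (auto intro: func_fdef[OF ef(1)] func_fdef[OF ef(2)])
  from sep[OF this] obtain X where X: "\<And>t. t \<epsilon> X \<longleftrightarrow> t \<epsilon> all_terms L \<and> app e t = app f t" by blast
  have 1: "tvar k \<epsilon> X" if "k \<epsilon> omega" for k
    using that e f X mem_all_terms term_tvar by (simp add: evaluates_def)
  have 2: "tapp F ts \<epsilon> X" if F: "F \<epsilon> funs L" and ts: "func ts (ar L F) X" for F ts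
  proof -
    have ts': "func ts (ar L F) (all_terms L)" by (rule func_cod[OF ts]) (use func_app[OF ts] X in blast)
    have "lam (ar L F) (\<lambda>i. app e (app ts i)) = lam (ar L F) (\<lambda>i. app f (app ts i))"
      by (rule lam_cong) (use func_app[OF ts] X in blast)
    then show ?thesis using e f F ts' term_tapp[OF F ts'] X mem_all_terms by (simp add: evaluates_def)
  qed
  have "t \<epsilon> X" using t[unfolded is_term_def, rule_format, of X] 1 2 by blast
  then show ?thesis using X by blast
qed

lemma dft_tval:
  assumes "dft E G a" "dft E G b" "dft E G c"
    "\<And>s. G s \<Longrightarrow> is_structure L (a s) \<and> func (b s) omega (univ (a s)) \<and> is_term L (c s)"
  shows "dft E G (\<lambda>s. tval L (a s) (b s) (c s))"
proof (rule dft_sub3[where R = "tval L" and H = "\<lambda>A s t. is_structure L A \<and> func s omega (univ A) \<and> is_term L t"])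
  let ?G = "\<lambda>u :: nat \<Rightarrow> 'v. is_structure L (u (Suc 0)) \<and> func (u (Suc (Suc 0))) omega (univ (u (Suc 0))) \<and>
    is_term L (u (Suc (Suc (Suc 0))))"
  \<comment> \<open>Both cases of the description are covered: without an evaluation,
    \<open>tval\<close> has the fixed value \<open>THE x. False\<close>.\<close>
  let ?V = "\<lambda>A s t v. (\<exists>e. evaluates L A s e \<and> v = app e t) \<or>
    (\<not> (\<exists>e. evaluates L A s e) \<and> v = (THE x. False))"
  have "dfp E ?G (\<lambda>u. ?V (u (Suc 0)) (u (Suc (Suc 0))) (u (Suc (Suc (Suc 0)))) (u 0))"
    by (intro dfi dfp_evaluates) (auto simp: evaluates_def mem_all_terms intro: func_fdef)
  then have "dfp E ?G (\<lambda>u. u 0 = tval L (u (Suc 0)) (u (Suc (Suc 0))) (u (Suc (Suc (Suc 0)))))"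
  proof (rule dfp_cong)
    fix u :: "nat \<Rightarrow> 'v" assume G: "?G u"
    define A s t where d: "A = u (Suc 0)" "s = u (Suc (Suc 0))" "t = u (Suc (Suc (Suc 0)))"
    show "(u 0 = tval L (u (Suc 0)) (u (Suc (Suc 0))) (u (Suc (Suc (Suc 0))))) =
      ?V (u (Suc 0)) (u (Suc (Suc 0))) (u (Suc (Suc (Suc 0)))) (u 0)"
      unfolding d[symmetric]
    proof (cases "\<exists>e. evaluates L A s e")
      case True
      then obtain e where e: "evaluates L A s e" by blast
      have u: "app f t = app e t" if "evaluates L A s f" for f
        using evaluates_unique[OF _ that e] G d by blast
      then have "tval L A s t = app e t" unfolding tval_def using e u by (intro the_equality) metis+
      then show "(u 0 = tval L A s t) = ?V A s t (u 0)" using e u by metis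
    next
      case False
      then show "(u 0 = tval L A s t) = ?V A s t (u 0)" unfolding tval_def by simp
    qed
  qed
  then show "dft E (\<lambda>s. is_structure L (s 0) \<and> func (s (Suc 0)) omega (univ (s 0)) \<and> is_term L (s (Suc (Suc 0))))
     (\<lambda>s. tval L (s 0) (s (Suc 0)) (s (Suc (Suc 0))))" by (rule dftI)
qed (use assms in auto)

lemma dfp_tarski:
  assumes "dft E G a" "dft E G b" "\<And>s. G s \<Longrightarrow> is_structure L (a s)"
  shows "dfp E G (\<lambda>s. tarski L (a s) (b s))"
  by (rule dfp_sub2[where R = "tarski L" and H = "\<lambda>A S. is_structure L A"])
    (unfold tarski_def, intro dfi dft_ar dft_tval dfp_term dfp_formula,
      use assms in \<open>auto simp: mem_all_terms[symmetric] structure_pair structure_interp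
        intro: func_fdef func_app\<close>)

lemma dfp_sat:
  assumes "dft E G a" "dft E G b" "dft E G c" "\<And>s. G s \<Longrightarrow> is_structure L (a s)"
  shows "dfp E G (\<lambda>s. sat L (a s) (b s) (c s))"
  by (rule dfp_sub3[where R = "sat L" and H = "\<lambda>A c s. is_structure L A"])
    (unfold sat_def, intro dfi dfp_tarski, use assms in auto)

lemma dfp_elementary:
  assumes "dft E G a" "dft E G b" "dft E G c" "\<And>s. G s \<Longrightarrow> is_structure L (a s) \<and> is_structure L (b s)"
  shows "dfp E G (\<lambda>s. elementary L (a s) (b s) (c s))"
  by (rule dfp_sub3[where R = "elementary L" and H = "\<lambda>A B h. is_structure L A \<and> is_structure L B"])
    (unfold elementary_def, intro dfi dfp_sat dfp_formula,
      use assms in \<open>auto simp: structure_pair intro: func_fdef func_app\<close>)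

lemma dft_pred_ext:
  assumes "dft E G a" "dft E G b" "\<And>s. G s \<Longrightarrow> is_structure L (a s) \<and> b s \<epsilon> rels L"
  shows "dft E G (\<lambda>s. pred_ext (a s) (b s))"
  by (rule dft_sub2[where R = pred_ext and H = "\<lambda>A R. is_structure L A \<and> R \<epsilon> rels L"])
    (unfold pred_ext_def, intro dfi, use assms in \<open>auto simp: structure_pair structure_interp\<close>)

lemma dfp_has_type:
  assumes "dft E G a" "dft E G b" "\<And>s. G s \<Longrightarrow> is_structure L (a s) \<and> (\<exists>B. func (b s) omega B)"
    and P: "unary_predicates L P"
  shows "dfp E G (\<lambda>s. has_type P (a s) (b s))"
  by (rule dfp_sub2[where R = "has_type P" and H = "\<lambda>A l. is_structure L A \<and> (\<exists>B. func l omega B)"])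
    (unfold has_type_def, intro dfi dft_pred_ext,
      use assms in \<open>auto simp: structure_pair unary_predicates_def intro: func_fdef func_app\<close>)

end

lemma V_inter2: "ordinal \<theta> \<Longrightarrow> \<alpha> \<epsilon> \<theta> \<Longrightarrow> inter2 r (V \<alpha>) \<epsilon> V \<theta>"
  using rank_le[of \<alpha> "inter2 r (V \<alpha>)"] ordinal_mem[of \<theta> \<alpha>] mem_V[of \<alpha>] mem_V[of \<theta>]
    ordinal_sub_iff[of "rank (inter2 r (V \<alpha>))" \<alpha>] ordinal_trans[of \<theta> \<alpha>] by auto

lemma dfp_square_root:
  assumes "dft E G a" "dft E G b" "dft E G c" "\<And>s. G s \<Longrightarrow> ordinal (a s)"
  shows "dfp E G (\<lambda>s. square_root (a s) (b s) (c s))"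
  by (rule dfp_sub3[where R = square_root and H = "\<lambda>\<theta> f r. ordinal \<theta>"])
    (unfold square_root_def plus_ext_def, intro dfi, use assms in \<open>auto intro: func_fdef V_inter2\<close>)

lemma in_lang_language: "is_language in_lang"
proof -
  have e: "symbols in_lang = upair empty empty"
    by (rule extensionality[OF allI]) (simp add: symbols_def rels_in_lang)
  have "func (lam (upair empty empty) (\<lambda>x. num 2)) (upair empty empty) omega"
    by (rule func_lam) (intro dfi, simp del: num.simps)
  then show ?thesis unfolding is_language_def e by (simp add: rels_in_lang) (simp add: in_lang_def)
qed

lemma in_struct_structure:
  assumes "x \<epsilon> M" shows "is_structure in_lang (in_struct M)"
proof -
  have e: "symbols in_lang = upair empty empty"
    by (rule extensionality[OF allI]) (simp add: symbols_def rels_in_lang)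
  let ?I = "lam (upair empty empty) (\<lambda>x. setof (\<lambda>s. func s (num 2) M \<and> app s (num 0) \<epsilon> app s (num 1)))"
  have "dft E (\<lambda>u. u 0 \<epsilon> upair empty empty)
      (\<lambda>u. setof (\<lambda>s. func s (num 2) M \<and> app s (num 0) \<epsilon> app s (num 1)))"
    by (rule dft_const)
  from lam_ex_cod[OF this] obtain B where B: "func ?I (upair empty empty) B" by blast
  have "func s (ar in_lang R) M" if "R \<epsilon> rels in_lang" "s \<epsilon> app ?I R" for R s
    using that interp_in_struct[of s M] ar_in_lang unfolding in_struct_def interp_opair by (simp add: rels_in_lang)
  then show ?thesis unfolding is_structure_def e using B assms
    by (intro exI[of _ M] exI[of _ ?I] exI[of _ B]) (auto simp: in_struct_def rels_in_lang)
qed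

lemma dft_in_struct [dfi]: "dft E G a \<Longrightarrow> dft E G (\<lambda>s. in_struct (a s))"
  by (rule dft_tot1[where R = in_struct])
    (unfold in_struct_def, intro dfi, auto intro: func_fdef)

lemma dfp_delta0_true [dfi]: "dft E G a \<Longrightarrow> dft E G b \<Longrightarrow> dfp E G (\<lambda>s. delta0_true (a s) (b s))"
  by (rule dfp_tot2[where R = delta0_true])
    (unfold delta0_true_def, intro dfi dfp_sat[OF in_lang_language],
      auto intro!: in_struct_structure func_app[OF _ omega_empty])

text \<open>Each actual \<open>n\<close> receives its own defining formula, by HOL induction on
  \<open>n\<close>. The guard makes \<open>upd\<close> applicable to the assignment.\<close>

lemma dfp_sigma_pi:
  "dfp E (\<lambda>s. \<exists>B. func (s (Suc 0)) omega B) (\<lambda>s. sigma_true n (s 0) (s (Suc 0))) \<and>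
   dfp E (\<lambda>s. \<exists>B. func (s (Suc 0)) omega B) (\<lambda>s. pi_true n (s 0) (s (Suc 0)))"
proof (induction n)
  case 0 show ?case unfolding sigma_true.simps pi_true.simps by (intro conjI dfi)
next
  case (Suc n)
  have s: "dft E G a \<Longrightarrow> dft E G b \<Longrightarrow> (\<And>s. G s \<Longrightarrow> \<exists>B. func (b s) omega B) \<Longrightarrow>
      dfp E G (\<lambda>s. sigma_true n (a s) (b s))" for G a b
    by (rule dfp_sub2[where R = "sigma_true n" and H = "\<lambda>_ s. \<exists>B. func s omega B"]) (use Suc in auto)
  have p: "dft E G a \<Longrightarrow> dft E G b \<Longrightarrow> (\<And>s. G s \<Longrightarrow> \<exists>B. func (b s) omega B) \<Longrightarrow>
      dfp E G (\<lambda>s. pi_true n (a s) (b s))" for G a b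
    by (rule dfp_sub2[where R = "pi_true n" and H = "\<lambda>_ s. \<exists>B. func s omega B"]) (use Suc in auto)
  have u: "\<exists>B. func (upd s k x) omega B" if sB: "\<exists>B. func s omega B" for s k x
  proof -
    obtain B where "func s omega B" using sB by blast
    then show ?thesis using lam_ex_cod[OF upd_dft] unfolding upd_def by blast
  qed
  show ?case unfolding sigma_true.simps pi_true.simps by (intro conjI dfi s p) (auto intro: u)
qed

lemma dfp_sigma_true [dfi]:
  "dft E G a \<Longrightarrow> dft E G b \<Longrightarrow> (\<And>s. G s \<Longrightarrow> \<exists>B. func (b s) omega B) \<Longrightarrow>
    dfp E G (\<lambda>s. sigma_true n (a s) (b s))"
  by (rule dfp_sub2[where R = "sigma_true n" and H = "\<lambda>_ s. \<exists>B. func s omega B"])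
    (use dfp_sigma_pi in auto)

section \<open>The critical sequence\<close>

text \<open>The instances of elementarity needed to develop the critical sequence. The conjuncts
  about \<open>func\<close> restrict \<open>surjective\<close> and \<open>seq_sup\<close> to
  arguments for which they are definable; the parameter \<delta> is listed so that j fixes
  it.\<close>

definition base_rels :: "'v \<Rightarrow> 'v rel4 list" where
  "base_rels \<delta> = [\<lambda>a b c d. a \<epsilon> b, \<lambda>a b c d. a = \<delta>, \<lambda>a b c d. a = empty,
    \<lambda>a b c d. a = omega, \<lambda>a b c d. b = succ a, \<lambda>a b c d. b = rank a, \<lambda>a b c d. cardinal a,
    \<lambda>a b c d. c = opair a b, \<lambda>a b c d. b = V a, \<lambda>a b c d. c = inter2 a b, \<lambda>a b c d. func a b c,
    \<lambda>a b c d. func a b c \<and> surjective a b c, \<lambda>a b c d. (\<exists>B. func a omega B) \<and> b = seq_sup a]"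

lemma base_rels_dfp: "Q \<in> set (base_rels \<delta>) \<Longrightarrow>
    definable4 Q"
proof -
  have "list_all (\<lambda>Q. definable4 Q) (base_rels \<delta>)"
    unfolding base_rels_def list.pred_inject(2)
    by (intro conjI list.pred_inject(1); intro dfi; auto)
  then show "Q \<in> set (base_rels \<delta>) \<Longrightarrow> ?thesis" by (simp add: list_all_iff)
qed

section \<open>A single embedding that preserves the base relations\<close>

context
  fixes \<delta> \<theta> j \<kappa> :: 'v and Qs :: "'v rel4 list"
  assumes th: "limit \<theta>" "\<delta> \<epsilon> \<theta>" and e: "emb \<theta> (set (base_rels \<delta> @ Qs)) j \<kappa>" and kd: "\<kappa> \<epsilon> \<delta>"
begin

lemma theta_ordinal: "ordinal \<theta>" using th limitD by blast
lemma delta_ordinal: "ordinal \<delta>" using th theta_ordinal ordinal_mem by blast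
lemma delta_V: "\<delta> \<epsilon> V \<theta>" using ordinal_mem_V[OF theta_ordinal delta_ordinal] th by simp
lemma below_delta_V: "\<alpha> \<epsilon> \<delta> \<Longrightarrow> \<alpha> \<epsilon> V \<theta>" using V_mem[OF theta_ordinal delta_V] .
lemma empty_V: "empty \<epsilon> V \<theta>" using V_omega[OF th(1)] by simp
lemma crit_ordinal: "ordinal \<kappa>" using e by (simp add: emb_def)
lemma crit_V: "\<kappa> \<epsilon> V \<theta>" using below_delta_V kd .

lemma omega_V: "omega \<epsilon> V \<theta>" if "omega \<epsilon> \<theta>"
  using that ordinal_mem_V[OF theta_ordinal ordinal_omega] by simp

lemma j_func: "func j (V \<theta>) (V \<theta>)" using e by (simp add: emb_def)
lemma j_V: "x \<epsilon> V \<theta> \<Longrightarrow> app j x \<epsilon> V \<theta>" using func_app[OF j_func] .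
lemma crit_moved: "app j \<kappa> \<noteq> \<kappa>" using e by (simp add: emb_def)
lemma crit_fixed: "\<alpha> \<epsilon> \<kappa> \<Longrightarrow> app j \<alpha> = \<alpha>" using e by (simp add: emb_def)

lemma j_preserves: "Q \<in> set (base_rels \<delta> @ Qs) \<Longrightarrow> a \<epsilon> V \<theta> \<Longrightarrow> b \<epsilon> V \<theta> \<Longrightarrow> c \<epsilon> V \<theta> \<Longrightarrow> d \<epsilon> V \<theta> \<Longrightarrow>
    Q a b c d \<longleftrightarrow> Q (app j a) (app j b) (app j c) (app j d)"
  using e unfolding emb_def preserves_def by blast

lemma j_mem: "x \<epsilon> V \<theta> \<Longrightarrow> y \<epsilon> V \<theta> \<Longrightarrow> app j x \<epsilon> app j y \<longleftrightarrow> x \<epsilon> y"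
  using j_preserves[of "\<lambda>a b c d. a \<epsilon> b" x y empty empty] empty_V by (simp add: base_rels_def)

lemma j_delta: "app j \<delta> = \<delta>"
  using j_preserves[of "\<lambda>a b c d. a = \<delta>" \<delta> empty empty empty] empty_V delta_V by (simp add: base_rels_def)

lemma j_empty: "app j empty = empty"
  using j_preserves[of "\<lambda>a b c d. a = empty" empty empty empty empty] empty_V by (simp add: base_rels_def)

lemma j_succ: "x \<epsilon> V \<theta> \<Longrightarrow> succ x \<epsilon> V \<theta> \<Longrightarrow> app j (succ x) = succ (app j x)"
  using j_preserves[of "\<lambda>a b c d. b = succ a" x "succ x" empty empty] empty_V by (simp add: base_rels_def)

lemma j_rank: "x \<epsilon> V \<theta> \<Longrightarrow> rank (app j x) = app j (rank x)"
  using j_preserves[of "\<lambda>a b c d. b = rank a" x "rank x" empty empty] empty_V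
    ordinal_mem_V[OF theta_ordinal, of "rank x"] mem_V[OF theta_ordinal, of x] by (simp add: base_rels_def)

lemma j_cardinal: "x \<epsilon> V \<theta> \<Longrightarrow> cardinal (app j x) \<longleftrightarrow> cardinal x"
  using j_preserves[of "\<lambda>a b c d. cardinal a" x empty empty empty] empty_V by (simp add: base_rels_def)

lemma j_opair: "x \<epsilon> V \<theta> \<Longrightarrow> y \<epsilon> V \<theta> \<Longrightarrow> app j (opair x y) = opair (app j x) (app j y)"
  using j_preserves[of "\<lambda>a b c d. c = opair a b" x y "opair x y" empty] empty_V V_opair[OF th(1)]
  by (simp add: base_rels_def)

lemma j_hier: "\<alpha> \<epsilon> \<theta> \<Longrightarrow> app j (V \<alpha>) = V (app j \<alpha>)"
  using j_preserves[of "\<lambda>a b c d. b = V a" \<alpha> "V \<alpha>" empty empty] empty_V V_V[OF theta_ordinal]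
    ordinal_mem_V[OF theta_ordinal ordinal_mem[OF theta_ordinal]] by (simp add: base_rels_def)

lemma j_inter2:
  assumes "x \<epsilon> V \<theta>" "y \<epsilon> V \<theta>" shows "app j (inter2 x y) = inter2 (app j x) (app j y)"
proof -
  have "inter2 x y \<epsilon> V \<theta>" by (rule V_sub[OF theta_ordinal assms(1)]) (simp add: sub_def)
  moreover have "(\<lambda>a b c d. c = inter2 a b) \<in> set (base_rels \<delta> @ Qs)" by (simp add: base_rels_def)
  ultimately show ?thesis using j_preserves[of "\<lambda>a b c d. c = inter2 a b" x y "inter2 x y" empty] empty_V assms by blast
qed

lemma j_image_func: "func f A B \<Longrightarrow> A \<epsilon> V \<theta> \<Longrightarrow> B \<epsilon> V \<theta> \<Longrightarrow> func (app j f) (app j A) (app j B)"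
  using j_preserves[of "\<lambda>a b c d. func a b c" f A B empty] empty_V V_func[OF th(1), of A B f]
  by (simp add: base_rels_def)

lemma j_app:
  assumes f: "func f A B" "A \<epsilon> V \<theta>" "B \<epsilon> V \<theta>" and x: "x \<epsilon> A"
  shows "app (app j f) (app j x) = app j (app f x)"
proof -
  have v: "f \<epsilon> V \<theta>" "x \<epsilon> V \<theta>" "app f x \<epsilon> V \<theta>"
    using V_func[OF th(1) f(2,3,1)] V_mem[OF theta_ordinal] f x func_app[OF f(1) x] by blast+
  have "opair x (app f x) \<epsilon> f" using func_mem[OF f(1)] x by simp
  then have "opair (app j x) (app j (app f x)) \<epsilon> app j f"
    using j_mem[OF V_opair[OF th(1) v(2,3)] v(1)] j_opair[OF v(2,3)] by simp
  then show ?thesis using func_mem[OF j_image_func[OF f]] by simp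
qed

text \<open>The induction is internal, so nonstandard natural numbers are fixed as well.\<close>

lemma j_nat: "n \<epsilon> omega \<Longrightarrow> app j n = n"
proof (induction rule: omega_induct)
  case dfp show ?case by (intro dfi) (rule func_fdef[OF j_func V_omega[OF th(1)]])
next
  case empty show ?case by (rule j_empty)
next
  case (succ n)
  then show ?case using j_succ[of n] V_omega[OF th(1)] omega_succ by metis
qed

text \<open>j fixes \<open>omega\<close> and all its elements, so the first ordinal that is moved
  lies beyond \<open>omega\<close>.\<close>

lemma omega_below_crit: assumes "omega \<epsilon> \<theta>" shows "omega \<epsilon> \<kappa>"
proof -
  have "app j omega = omega"
    using j_preserves[of "\<lambda>a b c d. a = omega" omega empty empty empty] empty_V omega_V[OF assms]
    by (simp add: base_rels_def)
  then show ?thesis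
    using ordinal_linear[OF ordinal_omega crit_ordinal] j_nat crit_moved by blast
qed

lemma j_ordinal: "ordinal \<alpha> \<Longrightarrow> \<alpha> \<epsilon> V \<theta> \<Longrightarrow> ordinal (app j \<alpha>)"
  using j_rank[of \<alpha>] rank_ordinal[of \<alpha>] ordinal_rank by metis

text \<open>Least counterexample: if \<alpha> were mapped to a smaller ordinal \<beta>, then \<beta>
  would be mapped below \<beta>.\<close>

lemma j_not_less: "ordinal \<alpha> \<Longrightarrow> \<alpha> \<epsilon> V \<theta> \<Longrightarrow> \<not> app j \<alpha> \<epsilon> \<alpha>"
proof -
  assume a: "ordinal \<alpha>" "\<alpha> \<epsilon> V \<theta>"
  have "\<alpha> \<epsilon> V \<theta> \<longrightarrow> \<not> app j \<alpha> \<epsilon> \<alpha>"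
    using a(1)
  proof (induction rule: ordinal_induct)
    case 1 show ?case by (intro dfi) (auto intro: func_fdef[OF j_func])
  next
    case (2 a)
    then show ?case using j_mem[of "app j a" a] j_V[of a] by blast
  qed
  then show ?thesis using a by blast
qed

lemma crit_less: "\<kappa> \<epsilon> app j \<kappa>"
  using ordinal_linear[OF crit_ordinal j_ordinal[OF crit_ordinal crit_V]] crit_moved j_not_less[OF crit_ordinal crit_V] by auto

text \<open>For a surjection \<open>g\<close> from \<alpha> < \<kappa> onto \<kappa>, its image
  under j is a surjection from \<alpha> onto a set containing \<kappa>. If it takes the value
  \<kappa> at \<xi>, then, since j fixes \<xi> and \<open>app g \<xi>\<close>, already
  \<open>app g \<xi> = \<kappa>\<close>, although the values of \<open>g\<close> lie in
  \<kappa>.\<close>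

lemma crit_cardinal: "cardinal \<kappa>"
  unfolding cardinal_def
proof (intro conjI notI crit_ordinal; elim exE conjE)
  fix \<alpha> g assume a: "\<alpha> \<epsilon> \<kappa>" and g: "func g \<alpha> \<kappa>" "surjective g \<alpha> \<kappa>"
  have aV: "\<alpha> \<epsilon> V \<theta>" using V_mem[OF theta_ordinal crit_V a] .
  have "surjective (app j g) (app j \<alpha>) (app j \<kappa>)"
    using j_preserves[of "\<lambda>a b c d. func a b c \<and> surjective a b c" g \<alpha> \<kappa> empty] empty_V g aV crit_V V_func[OF th(1) aV crit_V g(1)]
    by (simp add: base_rels_def)
  then obtain \<xi> where x: "\<xi> \<epsilon> \<alpha>" "app (app j g) \<xi> = \<kappa>"
    using crit_less crit_fixed[OF a] by (auto simp: surjective_def)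
  have "app j \<xi> = \<xi>" using crit_fixed ordinal_trans[OF crit_ordinal a x(1)] by blast
  then have "\<kappa> = app g \<xi>"
    using x j_app[OF g(1) aV crit_V x(1)] crit_fixed func_app[OF g(1) x(1)] by simp
  then show False using func_app[OF g(1) x(1)] by simp
qed

text \<open>The iterates stay below \<delta> because j fixes \<delta>; they inherit being a cardinal
  from \<kappa> and strict growth from \<open>crit_less\<close> by preservation.\<close>

lemma critical_sequence:
  assumes om: "omega \<epsilon> \<theta>"
  shows "\<exists>l. func l omega \<delta> \<and> app l empty = \<kappa> \<and> (\<forall>n. n \<epsilon> omega \<longrightarrow> app l (succ n) = app j (app l n)) \<and>
    (\<forall>n. n \<epsilon> omega \<longrightarrow> app l n \<epsilon> app l (succ n)) \<and> card_sequence l"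
proof -
  have "dft E (\<lambda>_. True) (\<lambda>s. appt j (s 0))" by (intro dfi)
  from omega_recursion[OF this, of \<kappa>] obtain l B where l: "func l omega B" "app l empty = \<kappa>"
    and ls: "\<And>n. n \<epsilon> omega \<Longrightarrow> app l (succ n) = appt j (app l n)" by blast
  have ld: "app l n \<epsilon> \<delta>" if "n \<epsilon> omega" for n
    using that
  proof (induction rule: omega_induct)
    case dfp show ?case by (intro dfi) (rule func_fdef[OF l(1)])
  next
    case empty show ?case using l kd by simp
  next
    case (succ n)
    then show ?case
      using ls[OF succ(1)] below_delta_V[OF succ(2)] j_mem[OF below_delta_V[OF succ(2)] delta_V] j_delta
        appt_eq[OF j_func] by simp
  qed
  have ls': "app l (succ n) = app j (app l n)" if "n \<epsilon> omega" for n
    using ls[OF that] appt_eq[OF j_func below_delta_V[OF ld[OF that]]] by simp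
  have lf: "func l omega \<delta>" using func_cod[OF l(1) ld] .
  have lc: "cardinal (app l n)" if "n \<epsilon> omega" for n
    using that
  proof (induction rule: omega_induct)
    case dfp show ?case by (intro dfi) (rule func_fdef[OF l(1)])
  next
    case empty show ?case using l crit_cardinal by simp
  next
    case (succ n) then show ?case using ls' j_cardinal below_delta_V ld by simp
  qed
  have li: "app l n \<epsilon> app l (succ n)" if "n \<epsilon> omega" for n
    using that
  proof (induction rule: omega_induct)
    case dfp show ?case by (intro dfi) (auto intro: func_fdef[OF l(1)])
  next
    case empty show ?case using l crit_less ls' by simp
  next
    case (succ n)
    then show ?case using ls'[of n] ls'[of "succ n"]
        j_mem[OF below_delta_V[OF ld[OF succ(1)]] below_delta_V[OF ld[OF omega_succ[OF succ(1)]]]] by simp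
  qed
  have "m \<epsilon> k \<longrightarrow> app l m \<epsilon> app l k" if m: "m \<epsilon> omega" and k: "k \<epsilon> omega" for m k
    using k
  proof (induction rule: omega_induct)
    case dfp show ?case by (intro dfi) (auto intro: func_fdef[OF l(1)] m)
  next
    case (succ k)
    have "ordinal (app l (succ k))" using lc succ(1) by (auto simp: cardinal_def)
    then show ?case using succ li[OF succ(1)] ordinal_trans by auto
  qed simp
  then have "card_sequence l" unfolding card_sequence_def using lf lc omega_mem by blast
  then show ?thesis using lf l(2) ls' li by blast
qed

section \<open>Supremum and shift of the critical sequence; sets fixed by the embedding\<close>

context
  fixes l
  assumes om: "omega \<epsilon> \<theta>"
    and l: "func l omega \<delta>" "app l empty = \<kappa>" "\<And>n. n \<epsilon> omega \<Longrightarrow> app l (succ n) = app j (app l n)"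
      "\<And>n. n \<epsilon> omega \<Longrightarrow> app l n \<epsilon> app l (succ n)"
begin

lemma seq_ordinal: "n \<epsilon> omega \<Longrightarrow> ordinal (app l n)"
  using func_app[OF l(1)] delta_ordinal ordinal_mem by blast

lemma seq_V: "l \<epsilon> V \<theta>" using V_func[OF th(1) omega_V[OF om] delta_V l(1)] .

lemma shift_dft: "dft E (\<lambda>s. s 0 \<epsilon> omega) (\<lambda>s. app l (succ (s 0)))"
  by (intro dfi) (rule func_fdef[OF l(1) omega_succ])

lemma func_shift: "func (shift l) omega \<delta>"
  unfolding shift_def by (rule func_lam[OF shift_dft]) (intro func_app[OF l(1)] omega_succ)

lemma app_shift: "n \<epsilon> omega \<Longrightarrow> app (shift l) n = app l (succ n)"
  unfolding shift_def by (rule app_lam[OF shift_dft])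

lemma j_omega: "app j omega = omega"
  using crit_fixed omega_below_crit[OF om] by blast

text \<open>Since j fixes every natural number \<open>n\<close>, the image of \<open>l\<close> takes
  at \<open>n\<close> the value j(\<open>app l n\<close>), which is the next term of the critical
  sequence.\<close>

lemma j_seq: "app j l = shift l"
proof (rule func_eqI[OF _ func_shift])
  show "func (app j l) omega \<delta>"
    using j_image_func[OF l(1) omega_V[OF om] delta_V] j_delta j_omega by simp
  show "app (app j l) n = app (shift l) n" if "n \<epsilon> omega" for n
    using j_app[OF l(1) omega_V[OF om] delta_V that] app_shift[OF that] j_nat[OF that] l(3)[OF that] by simp
qed

lemma isset_seq_sup: "func f omega \<delta> \<Longrightarrow> isset (\<lambda>x. \<exists>m. m \<epsilon> omega \<and> x \<epsilon> app f m)"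
  by (rule isset_sep[of \<delta>], intro dfi)
    (auto intro: func_fdef ordinal_trans[OF delta_ordinal func_app])

lemma mem_sup: "x \<epsilon> seq_sup l \<longleftrightarrow> (\<exists>n. n \<epsilon> omega \<and> x \<epsilon> app l n)"
  unfolding seq_sup_def by (rule mem_setof[OF isset_seq_sup[OF l(1)]])

lemma seq_mem_sup: "n \<epsilon> omega \<Longrightarrow> app l n \<epsilon> seq_sup l"
  unfolding mem_sup using l(4) omega_succ by blast

lemma sup_shift: "seq_sup (shift l) = seq_sup l"
proof (rule extensionality[OF allI])
  fix x
  have "x \<epsilon> seq_sup (shift l) \<longleftrightarrow> (\<exists>n. n \<epsilon> omega \<and> x \<epsilon> app (shift l) n)"
    unfolding seq_sup_def by (rule mem_setof[OF isset_seq_sup[OF func_shift]])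
  also have "\<dots> \<longleftrightarrow> (\<exists>n. n \<epsilon> omega \<and> x \<epsilon> app l (succ n))" using app_shift by auto
  also have "\<dots> \<longleftrightarrow> (\<exists>n. n \<epsilon> omega \<and> x \<epsilon> app l n)"
    using l(4) seq_ordinal ordinal_trans omega_succ by meson
  finally show "x \<epsilon> seq_sup (shift l) \<longleftrightarrow> x \<epsilon> seq_sup l" unfolding mem_sup .
qed

lemma sup_ordinal: "ordinal (seq_sup l)"
  unfolding ordinal_def[of "seq_sup l"] transitive_def[of "seq_sup l"] mem_sup
  using seq_ordinal ordinal_trans ordinal_mem unfolding ordinal_def[symmetric] by (meson ordinal_def)

text \<open>Closes \<open>V (seq_sup l)\<close> under ordered pairs, so that a function from this
  level to itself is also a subset of it.\<close>

lemma sup_limit: "limit (seq_sup l)"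
  unfolding limit_def
proof (intro conjI allI impI sup_ordinal)
  show "empty \<epsilon> seq_sup l"
    using ordinal_linear[OF ordinal_empty sup_ordinal] seq_mem_sup[OF omega_empty] mem_empty by metis
  fix \<alpha> assume "\<alpha> \<epsilon> seq_sup l"
  then obtain n where n: "n \<epsilon> omega" "\<alpha> \<epsilon> app l n" unfolding mem_sup by blast
  have a: "ordinal \<alpha>" using n seq_ordinal ordinal_mem by blast
  have "sub (succ \<alpha>) (app l n)" using n(2) ordinal_trans[OF seq_ordinal[OF n(1)]] by (auto simp: sub_def)
  then have "succ \<alpha> \<epsilon> app l (succ n)"
    using ordinal_sub_iff[OF ordinal_succ[OF a] seq_ordinal[OF n(1)]] l(4)[OF n(1)]
      ordinal_trans[OF seq_ordinal[OF omega_succ[OF n(1)]]] by metis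
  then show "succ \<alpha> \<epsilon> seq_sup l" unfolding mem_sup using omega_succ[OF n(1)] by blast
qed

lemma sup_le: "seq_sup l \<epsilon> \<delta> \<or> seq_sup l = \<delta>"
proof -
  have "sub (seq_sup l) \<delta>"
    unfolding sub_def mem_sup using ordinal_trans[OF delta_ordinal func_app[OF l(1)]] by blast
  then show ?thesis using ordinal_sub_iff[OF sup_ordinal delta_ordinal] by simp
qed

text \<open>A fixed point \<beta> above \<kappa> traps all iterates: from an iterate below \<beta>
  the next one is below j(\<beta>) = \<beta>.\<close>

lemma sup_below_fixed:
  assumes b: "\<beta> \<epsilon> \<delta>" "app j \<beta> = \<beta>" "\<kappa> \<epsilon> \<beta>"
  shows "seq_sup l \<epsilon> \<delta>"
proof -
  have o: "ordinal \<beta>" using b delta_ordinal ordinal_mem by blast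
  have "app l n \<epsilon> \<beta>" if "n \<epsilon> omega" for n
    using that
  proof (induction rule: omega_induct)
    case dfp show ?case by (intro dfi) (rule func_fdef[OF l(1)])
  next
    case empty show ?case using l b by simp
  next
    case (succ n)
    then show ?case using l(3)[of n] j_mem[OF below_delta_V below_delta_V[OF b(1)], OF func_app[OF l(1)]] b by simp
  qed
  then have "sub (seq_sup l) \<beta>"
    unfolding sub_def mem_sup using ordinal_trans[OF o] by blast
  then show ?thesis
    using ordinal_sub_iff[OF sup_ordinal o] ordinal_trans[OF delta_ordinal b(1)] b(1) by auto
qed

text \<open>Induction on the rank. Because j preserves the rank of \<open>x\<close>, the elements of
  the image of \<open>x\<close> also have smaller rank and are fixed by the induction hypothesis, so
  no new elements appear.\<close>

lemma fixed_below_crit: "x \<epsilon> V \<kappa> \<Longrightarrow> app j x = x"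
proof -
  have *: "\<forall>x. x \<epsilon> V \<theta> \<longrightarrow> rank x = \<alpha> \<longrightarrow> \<alpha> \<epsilon> \<kappa> \<longrightarrow> app j x = x" if "ordinal \<alpha>" for \<alpha>
    using that
  proof (induction rule: ordinal_induct)
    case 1 show ?case by (intro dfi) (auto intro: func_fdef[OF j_func])
  next
    case (2 a)
    show ?case
    proof (intro allI impI)
      fix x assume x: "x \<epsilon> V \<theta>" "rank x = a" and a: "a \<epsilon> \<kappa>"
      have IH: "app j y = y" if "y \<epsilon> V \<theta>" "rank y \<epsilon> rank x" for y
        using 2(2)[of "rank y"] that x(2) ordinal_trans[OF crit_ordinal a] by blast
      have rj: "rank (app j x) = rank x" using j_rank[OF x(1)] crit_fixed[OF a] x(2) by simp
      show "app j x = x"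
      proof (rule extensionality[OF allI])
        fix y
        show "y \<epsilon> app j x \<longleftrightarrow> y \<epsilon> x"
        proof
          assume y: "y \<epsilon> app j x"
          have yV: "y \<epsilon> V \<theta>" using V_mem[OF theta_ordinal j_V[OF x(1)] y] .
          have "app j y = y" using IH[OF yV] rank_mem[OF y] rj by simp
          then show "y \<epsilon> x" using y j_mem[OF yV x(1)] by simp
        next
          assume y: "y \<epsilon> x"
          have yV: "y \<epsilon> V \<theta>" using V_mem[OF theta_ordinal x(1) y] .
          show "y \<epsilon> app j x" using y j_mem[OF yV x(1)] IH[OF yV rank_mem[OF y]] by simp
        qed
      qed
    qed
  qed
  assume "x \<epsilon> V \<kappa>"
  then have x: "rank x \<epsilon> \<kappa>" using mem_V[OF crit_ordinal] by simp
  moreover have "\<kappa> \<epsilon> \<theta>" using crit_V ordinal_mem_V[OF theta_ordinal crit_ordinal] by simp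
  ultimately have "x \<epsilon> V \<theta>" using mem_V[OF theta_ordinal] ordinal_trans[OF theta_ordinal] by blast
  then show "app j x = x" using *[OF ordinal_rank] x by blast
qed

text \<open>A set of the model, so it can be used as the closed set \<open>X\<close> in the
  inductive definitions of terms and formulas. Thus all codes are shown to be fixed, including
  nonstandard ones.\<close>

definition Fix :: 'v where "Fix = setof (\<lambda>x. x \<epsilon> V \<theta> \<and> app j x = x)"

lemma mem_Fix: "x \<epsilon> Fix \<longleftrightarrow> x \<epsilon> V \<theta> \<and> app j x = x"
  unfolding Fix_def by (rule mem_setof, rule isset_sep[of "V \<theta>"], intro dfi) (auto intro: func_fdef[OF j_func])

lemma Fix_opair: "x \<epsilon> Fix \<Longrightarrow> y \<epsilon> Fix \<Longrightarrow> opair x y \<epsilon> Fix"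
  by (simp add: mem_Fix V_opair[OF th(1)] j_opair)

lemma Fix_omega: "n \<epsilon> omega \<Longrightarrow> n \<epsilon> Fix"
  by (simp add: mem_Fix V_omega[OF th(1)] j_nat)

text \<open>The domain, the indices and the entries are all fixed. The bound from
  \<open>tuple_bounded\<close> supplies a codomain inside \<open>V \<theta>\<close>, without which
  the preservation lemmas for functions do not apply.\<close>

lemma Fix_tuple:
  assumes n: "n \<epsilon> omega" and ts: "func ts n Fix"
  shows "ts \<epsilon> Fix"
proof -
  have "func ts n (V \<theta>)" by (rule func_cod[OF ts]) (use func_app[OF ts] mem_Fix in blast)
  then obtain \<alpha> where a: "\<alpha> \<epsilon> \<theta>" "func ts n (V \<alpha>)" using tuple_bounded[OF th(1) n] by blast
  note v = V_omega[OF th(1) n] V_V[OF theta_ordinal a(1)]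
  have "app j ts = ts"
  proof (rule func_eqI[OF _ ts])
    show "func (app j ts) n (app j (V \<alpha>))" using j_image_func[OF a(2) v] j_nat[OF n] by simp
    show "app (app j ts) i = app ts i" if i: "i \<epsilon> n" for i
      using j_app[OF a(2) v i] j_nat[OF omega_mem[OF n i]] func_app[OF ts i] mem_Fix by simp
  qed
  then show ?thesis using V_func[OF th(1) v a(2)] mem_Fix by blast
qed

lemma Fix_codes:
  "k \<epsilon> omega \<Longrightarrow> tvar k \<epsilon> Fix" "x \<epsilon> Fix \<Longrightarrow> y \<epsilon> Fix \<Longrightarrow> tapp x y \<epsilon> Fix"
  "x \<epsilon> Fix \<Longrightarrow> y \<epsilon> Fix \<Longrightarrow> feq x y \<epsilon> Fix" "x \<epsilon> Fix \<Longrightarrow> y \<epsilon> Fix \<Longrightarrow> frel x y \<epsilon> Fix"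
  "x \<epsilon> Fix \<Longrightarrow> fneg x \<epsilon> Fix" "x \<epsilon> Fix \<Longrightarrow> y \<epsilon> Fix \<Longrightarrow> fconj x y \<epsilon> Fix"
  "k \<epsilon> omega \<Longrightarrow> y \<epsilon> Fix \<Longrightarrow> fex k y \<epsilon> Fix" "k \<epsilon> omega \<Longrightarrow> y \<epsilon> Fix \<Longrightarrow> fall k y \<epsilon> Fix"
  unfolding tvar_def tapp_def feq_def frel_def fneg_def fconj_def fex_def fall_def
  by (auto intro!: Fix_opair intro: Fix_omega simp del: num.simps)

lemma Fix_fmem: "i \<epsilon> omega \<Longrightarrow> k \<epsilon> omega \<Longrightarrow> fmem i k \<epsilon> Fix"
  unfolding fmem_def
  by (rule Fix_codes(4)[OF Fix_omega[OF omega_empty] Fix_tuple[OF omega_num[of 2] func_lam[OF lam_fin_dft]]])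
    (auto intro: Fix_codes(1))

text \<open>Hence the code that defines a class is unchanged by j, and a single embedding works for
  all classes.\<close>

lemma Fix_sigma_pi: "(is_sigma m c \<longrightarrow> c \<epsilon> Fix) \<and> (is_pi m c \<longrightarrow> c \<epsilon> Fix)"
proof (induction m arbitrary: c)
  case 0
  have "c \<epsilon> Fix" if "is_delta0 c"
    by (rule that[unfolded is_delta0_def, THEN spec, THEN mp])
      (auto intro!: Fix_codes Fix_fmem)
  then show ?case by simp
next
  case (Suc m)
  then show ?case using Fix_codes(7,8) by auto
qed

section \<open>The restricted embedding as a square root and as an elementary map of
  structures\<close>

context
  fixes L :: "'v language" and P \<alpha> i :: 'v
  assumes L: "is_language L" and symV: "symbols L \<epsilon> V \<theta>" and a: "\<alpha> \<epsilon> \<kappa>"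
    and i: "func i (symbols L) (V \<alpha>)" "injective i (symbols L)"
    and sup_d: "seq_sup l \<epsilon> \<delta>"
    and Q1: "(\<lambda>a b c d. opair a b \<epsilon> i) \<in> set Qs" and Q2: "(\<lambda>a b c d. is_structure L a) \<in> set Qs"
    and Q3: "(\<lambda>a b c d. is_structure L a \<and> sat L a b c) \<in> set Qs"
begin

text \<open>The injection \<open>i\<close> sends symbols into \<open>V \<alpha>\<close>, below the
  critical point, where everything is fixed. As j preserves the graph of \<open>i\<close>, a symbol
  and its image have the same value under \<open>i\<close> and are therefore equal.\<close>

lemma Fix_symbol: "x \<epsilon> rels L \<or> x \<epsilon> funs L \<Longrightarrow> x \<epsilon> Fix"
proof -
  assume "x \<epsilon> rels L \<or> x \<epsilon> funs L"
  then have x: "x \<epsilon> symbols L" by (simp add: symbols_def)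
  have xV: "x \<epsilon> V \<theta>" using V_mem[OF theta_ordinal symV x] .
  have ix: "app i x \<epsilon> V \<kappa>" using V_mono[OF crit_ordinal a func_app[OF i(1) x]] .
  have ixV: "app i x \<epsilon> V \<theta>"
    using V_mono[OF theta_ordinal _ ix] crit_V ordinal_mem_V[OF theta_ordinal crit_ordinal] by blast
  have "opair (app j x) (app j (app i x)) \<epsilon> i"
    using j_preserves[of "\<lambda>a b c d. opair a b \<epsilon> i" x "app i x" empty empty] Q1 xV ixV empty_V func_mem[OF i(1), of x] x by simp
  then have "app j x \<epsilon> symbols L" "app i (app j x) = app i x"
    using func_mem[OF i(1)] fixed_below_crit[OF ix] by auto
  then show ?thesis using i(2) x xV unfolding injective_def mem_Fix by blast
qed

lemma Fix_term: "is_term L t \<Longrightarrow> t \<epsilon> Fix"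
  unfolding is_term_def
  by (drule spec[of _ Fix], erule mp) (auto intro!: Fix_codes(1,2) intro: Fix_symbol Fix_tuple[OF ar_omega[OF L]])

lemma Fix_formula: "is_formula L c \<Longrightarrow> c \<epsilon> Fix"
proof -
  assume c: "is_formula L c"
  have "frel R ts \<epsilon> Fix" if R: "R \<epsilon> rels L" and ts: "func ts (ar L R) (all_terms L)" for R ts
  proof -
    have "func ts (ar L R) Fix"
      by (rule func_cod[OF ts]) (use func_app[OF ts] mem_all_terms[OF L] Fix_term in blast)
    then show ?thesis using Fix_codes(4) Fix_symbol R Fix_tuple[OF ar_omega[OF L]] by blast
  qed
  then show ?thesis
    by (intro c[unfolded is_formula_def, THEN spec, THEN mp]) (auto intro!: Fix_codes(3,5,6,7) intro: Fix_term)
qed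

lemma sup_V: "seq_sup l \<epsilon> \<theta>"
  using sup_d th ordinal_trans[OF theta_ordinal] by blast

lemma Vsup_V: "V (seq_sup l) \<epsilon> V \<theta>" by (rule V_V[OF theta_ordinal sup_V])

text \<open>j commutes with \<open>seq_sup\<close>, and passing from \<open>l\<close> to its image
  merely drops the first term, which does not change the supremum.\<close>

lemma j_sup: "app j (seq_sup l) = seq_sup l"
proof -
  have "app j (seq_sup l) = seq_sup (app j l)"
    using j_preserves[of "\<lambda>a b c d. (\<exists>B. func a omega B) \<and> b = seq_sup a" l "seq_sup l" empty empty]
      empty_V seq_V l(1) below_delta_V[OF sup_d] by (auto simp: base_rels_def)
  then show ?thesis by (simp add: j_seq sup_shift)
qed

definition root :: 'v where "root = lam (V (seq_sup l)) (app j)"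

lemma Vsup_mem: "x \<epsilon> V (seq_sup l) \<Longrightarrow> x \<epsilon> V \<theta>"
  using V_mono[OF theta_ordinal sup_V] .

lemma root_dft: "dft E (\<lambda>s. s 0 \<epsilon> V (seq_sup l)) (\<lambda>s. app j (s 0))"
  by (intro dfi) (rule func_fdef[OF j_func Vsup_mem])

lemma app_root: "x \<epsilon> V (seq_sup l) \<Longrightarrow> app root x = app j x"
  unfolding root_def by (rule app_lam[OF root_dft])

lemma func_root: "func root (V (seq_sup l)) (V (seq_sup l))"
  unfolding root_def
proof (rule func_lam[OF root_dft])
  fix x assume x: "x \<epsilon> V (seq_sup l)"
  then have "app j (rank x) \<epsilon> app j (seq_sup l)"
    using j_mem[of "rank x" "seq_sup l"] mem_V[OF sup_ordinal] mem_V[OF theta_ordinal, of x] Vsup_mem[OF x]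
      ordinal_mem_V[OF theta_ordinal, of "rank x"] below_delta_V[OF sup_d] by simp
  then show "app j x \<epsilon> V (seq_sup l)"
    using j_sup j_rank[OF Vsup_mem[OF x]] by (simp add: mem_V[OF sup_ordinal])
qed

lemma root_V: "root \<epsilon> V \<theta>" using V_func[OF th(1) Vsup_V Vsup_V func_root] .

text \<open>\<open>root\<close> applied to its own initial segments yields initial segments of \<open>j(root)\<close>, whose union is \<open>j(root)\<close>.\<close>

lemma square_root_root: "square_root (seq_sup l) (app j root) root"
proof -
  have fj: "func (app j root) (V (seq_sup l)) (V (seq_sup l))"
    using j_image_func[OF func_root Vsup_V Vsup_V] j_hier[OF sup_V] j_sup by simp
  have seg: "app root (inter2 root (V \<alpha>)) = inter2 (app j root) (V (app j \<alpha>))" if "\<alpha> \<epsilon> seq_sup l" for \<alpha>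
  proof -
    have at: "\<alpha> \<epsilon> \<theta>" using that sup_V ordinal_trans[OF theta_ordinal] by blast
    show ?thesis
      using app_root[OF V_inter2[OF sup_ordinal that, of root]] j_inter2[OF root_V V_V[OF theta_ordinal at]] j_hier[OF at] by simp
  qed
  have "plus_ext (seq_sup l) root root = app j root"
    unfolding plus_ext_def
  proof (rule setof_eqI)
    fix y
    show "y \<epsilon> app j root \<longleftrightarrow> (\<exists>\<alpha>. \<alpha> \<epsilon> seq_sup l \<and> y \<epsilon> app root (inter2 root (V \<alpha>)))"
    proof
      assume y: "y \<epsilon> app j root"
      obtain u v where "u \<epsilon> V (seq_sup l)" "v \<epsilon> V (seq_sup l)" "y = opair u v" using func_pair[OF fj y] by blast
      then have "y \<epsilon> V (seq_sup l)" using V_opair[OF sup_limit] by blast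
      then obtain n where n: "n \<epsilon> omega" "rank y \<epsilon> app l n" using mem_V[OF sup_ordinal] mem_sup by blast
      have oj: "ordinal (app j (app l n))" using seq_ordinal[OF omega_succ[OF n(1)]] l(3)[OF n(1)] by simp
      \<comment> \<open>The cut at \<open>app l n\<close> suffices: j carries it to the next term of
        the sequence, which also exceeds the rank of \<open>y\<close>.\<close>
      have "rank y \<epsilon> app j (app l n)"
        using n l(3,4)[OF n(1)] ordinal_trans[OF oj] by metis
      then have "y \<epsilon> V (app j (app l n))" using mem_V[OF oj] by blast
      then have "y \<epsilon> app root (inter2 root (V (app l n)))"
        unfolding seg[OF seq_mem_sup[OF n(1)]] using y by simp
      then show "\<exists>\<alpha>. \<alpha> \<epsilon> seq_sup l \<and> y \<epsilon> app root (inter2 root (V \<alpha>))" using seq_mem_sup[OF n(1)] by blast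
    next
      assume "\<exists>\<alpha>. \<alpha> \<epsilon> seq_sup l \<and> y \<epsilon> app root (inter2 root (V \<alpha>))"
      then show "y \<epsilon> app j root" using seg by auto
    qed
  qed
  then show ?thesis unfolding square_root_def using func_root by blast
qed

text \<open>The preserved relations see only elements of \<open>V \<theta>\<close>. The universe is
  bounded by hypothesis, and the interpretations lie in \<open>D\<close>, which is built from the
  universe by finitely many products and power sets.\<close>

lemma structure_V:
  assumes B: "is_structure L B" and s: "sub (univ B) (V (seq_sup l))"
  shows "B \<epsilon> V \<theta>"
proof -
  obtain U I C where B': "B = opair U I" "func I (symbols L) C" "univ B = U"
    "\<And>R s. R \<epsilon> rels L \<Longrightarrow> s \<epsilon> app I R \<Longrightarrow> func s (ar L R) U"
    "\<And>F. F \<epsilon> funs L \<Longrightarrow> func (app I F) (tuples (ar L F) U) U" using structureE[OF B] by metis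
  have U: "U \<epsilon> V \<theta>" using V_sub[OF theta_ordinal Vsup_V] s B'(3) by simp
  define T where "T = pset (prods omega U)"
  have T: "s \<epsilon> T" if s: "func s k U" and k: "k \<epsilon> omega" for s k
    unfolding T_def mem_pset sub_def mem_prods using func_pair[OF s] omega_mem[OF k] by metis
  define D where "D = union2 (pset T) (pset (prods T U))"
  have "app I x \<epsilon> D" if "x \<epsilon> symbols L" for x
  proof (cases "x \<epsilon> rels L")
    case True
    then show ?thesis using B'(4)[OF True] T ar_omega[OF L] unfolding D_def by (auto simp: sub_def)
  next
    case False
    then have x: "x \<epsilon> funs L" using that by (simp add: symbols_def)
    have "sub (app I x) (prods T U)"
      unfolding sub_def mem_prods
      using func_pair[OF B'(5)[OF x]] T ar_omega[OF L] x mem_tuples by metis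
    then show ?thesis unfolding D_def by simp
  qed
  then have "func I (symbols L) D" using func_cod[OF B'(2)] by blast
  moreover have "D \<epsilon> V \<theta>"
    unfolding D_def T_def by (intro V_union2 V_pset V_prods th(1) U omega_V[OF om])
  ultimately show ?thesis using V_func[OF th(1) symV] V_opair[OF th(1) U] B'(1) by blast
qed

text \<open>Each formula code is fixed, and the image of an assignment is its composition with j.
  Preservation of \<open>sat\<close> at the structure, the code and the assignment is then exactly
  the elementarity clause.\<close>

lemma root_elementary:
  assumes B: "is_structure L B" and s: "sub (univ B) (V (seq_sup l))"
  shows "elementary L B (app j B) (lam (univ B) (app root))"
proof -
  have BV: "B \<epsilon> V \<theta>" by (rule structure_V[OF B s])
  obtain U I where B': "B = opair U I" using structure_pair[OF B] by blast
  have UI: "U \<epsilon> V \<theta>" "I \<epsilon> V \<theta>" using V_opairD[OF theta_ordinal] BV B' by blast+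
  have uB: "univ B = U" "univ (app j B) = app j U" using B' j_opair[OF UI] by simp_all
  have Us: "x \<epsilon> V (seq_sup l)" if "x \<epsilon> U" for x using s that uB by (simp add: sub_def)
  have d: "dft E (\<lambda>s. s 0 \<epsilon> U) (\<lambda>s. app root (s 0))" by (intro dfi) (rule func_fdef[OF func_root Us])
  let ?h = "lam U (app root)"
  have h: "app ?h x = app j x" if "x \<epsilon> U" for x using app_lam[OF d that] app_root[OF Us[OF that]] by simp
  have jU: "app j x \<epsilon> app j U" if "x \<epsilon> U" for x using j_mem[OF V_mem[OF theta_ordinal UI(1) that] UI(1)] that by simp
  have hf: "func ?h U (app j U)" by (rule func_lam[OF d]) (use app_root[OF Us] jU in simp)
  have "sat L B c s \<longleftrightarrow> sat L (app j B) c (lam omega (\<lambda>m. app ?h (app s m)))"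
    if c: "is_formula L c" and s: "func s omega U" for c s
  proof -
    have cF: "c \<epsilon> V \<theta>" "app j c = c" using Fix_formula[OF c] mem_Fix by blast+
    have sV: "s \<epsilon> V \<theta>" using V_func[OF th(1) omega_V[OF om] UI(1) s] .
    have ds: "dft E (\<lambda>u. u 0 \<epsilon> omega) (\<lambda>u. app ?h (app s (u 0)))"
      by (intro dfi) (auto intro: func_fdef[OF s] func_fdef[OF hf] func_app[OF s])
    have "app j s = lam omega (\<lambda>m. app ?h (app s m))"
    proof (rule func_eqI)
      show "func (app j s) omega (app j U)" using j_image_func[OF s omega_V[OF om] UI(1)] j_omega by simp
      show "func (lam omega (\<lambda>m. app ?h (app s m))) omega (app j U)"
        by (rule func_lam[OF ds]) (use h jU func_app[OF s] in simp)
      show "app (app j s) m = app (lam omega (\<lambda>m. app ?h (app s m))) m" if m: "m \<epsilon> omega" for m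
        using j_app[OF s omega_V[OF om] UI(1) m] j_nat[OF m] h[OF func_app[OF s m]] by (simp add: app_lam[OF ds m])
    qed
    moreover have "is_structure L (app j B)"
      using j_preserves[of "\<lambda>a b c d. is_structure L a" B empty empty empty] Q2 BV empty_V B by simp
    ultimately show ?thesis
      using j_preserves[of "\<lambda>a b c d. is_structure L a \<and> sat L a b c" B c s empty] Q3 BV cF sV empty_V B by simp
  qed
  then show ?thesis unfolding elementary_def uB using hf by blast
qed

text \<open>\<open>R\<close> holds of the images under \<open>j\<close>, witnessed by \<open>A = B\<close> and \<open>r = root\<close>, hence of the originals.\<close>

lemma reflection:
  fixes z :: 'v and n :: nat
  defines "R \<equiv> \<lambda>l B f c. (\<exists>D. func l omega D) \<and> ordinal (seq_sup l) \<and> is_structure L B \<and>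
    (\<exists>A r. is_structure L A \<and> sigma_true n c (lam omega (\<lambda>m. if m = num 0 then A else z)) \<and>
      has_type P A l \<and> square_root (seq_sup l) f r \<and> elementary L A B (lam (univ A) (app r)))"
  assumes Q4: "R \<in> set Qs" and C: "sigma_definable n z C" "\<And>A. C A \<Longrightarrow> is_structure L A"
  shows "sqrt_ESR L P C l"
proof -
  obtain c where c: "is_sigma n c" "\<And>x. C x \<longleftrightarrow> sigma_true n c (lam omega (\<lambda>m. if m = num 0 then x else z))"
    using C(1) unfolding sigma_definable_def by blast
  have cF: "c \<epsilon> V \<theta>" "app j c = c" using Fix_sigma_pi c(1) mem_Fix by blast+
  have "\<exists>A r. C A \<and> has_type P A l \<and> square_root (seq_sup l) root r \<and> elementary L A B (lam (univ A) (app r))"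
    if B: "C B" "has_type P B (shift l)" for B
  proof -
    have Bs: "is_structure L B" using C(2) B by blast
    have "rank (univ B) = seq_sup l" using B(2) sup_shift by (simp add: has_type_def)
    then have u: "sub (univ B) (V (seq_sup l))"
      unfolding sub_def mem_V[OF sup_ordinal] using rank_mem by metis
    have BV: "B \<epsilon> V \<theta>" by (rule structure_V[OF Bs u])
    have "is_structure L (app j B)"
      using j_preserves[of "\<lambda>a b c d. is_structure L a" B empty empty empty] Q2 BV empty_V Bs by simp
    \<comment> \<open>The first argument becomes \<open>shift l\<close>, which is the type of
      \<open>B\<close> and has the same supremum as \<open>l\<close>; the code stays
      \<open>c\<close>, so the same class is meant before and after applying j.\<close>
    then have "R (app j l) (app j B) (app j root) (app j c)"
      unfolding R_def cF(2) j_seq sup_shift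
      using func_shift sup_ordinal Bs B c(2)[of B] square_root_root root_elementary[OF Bs u] by blast
    then have "R l B root c" using j_preserves[of R l B root c] Q4 seq_V BV root_V cF(1) by simp
    then show ?thesis unfolding R_def c(2)[symmetric] by blast
  qed
  then show ?thesis unfolding sqrt_ESR_def using func_root by blast
qed

end

end

end

section \<open>Square root reflection at a Berkeley cardinal\<close>

lemma emb_mono: "emb \<theta> Qs j \<kappa> \<Longrightarrow> Rs \<subseteq> Qs \<Longrightarrow> emb \<theta> Rs j \<kappa>"
  unfolding emb_def by blast

text \<open>
  If the critical sequence of one embedding is cofinal in \<open>\<delta>\<close>, then an embedding that fixes
  this sequence has fixed points cofinal in \<open>\<delta>\<close>, and its own critical sequence is bounded.
\<close>

lemma berkeley_critical_sequence:
  assumes b: "berkeley \<delta>" and eta: "\<eta> \<epsilon> \<delta>" and th: "limit \<theta>" "\<delta> \<epsilon> \<theta>" and om: "omega \<epsilon> \<theta>"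
    and Qs: "\<And>Q. Q \<in> set Qs \<Longrightarrow>
      definable4 Q"
  shows "\<exists>j \<kappa> l. emb \<theta> (set (base_rels \<delta> @ Qs)) j \<kappa> \<and> \<eta> \<epsilon> \<kappa> \<and> \<kappa> \<epsilon> \<delta> \<and> func l omega \<delta> \<and> app l empty = \<kappa> \<and>
    (\<forall>n. n \<epsilon> omega \<longrightarrow> app l (succ n) = app j (app l n)) \<and> (\<forall>n. n \<epsilon> omega \<longrightarrow> app l n \<epsilon> app l (succ n)) \<and>
    card_sequence l \<and> seq_sup l \<epsilon> \<delta>"
proof -
  have "definable4 Q"
    if "Q \<in> set (base_rels \<delta> @ Qs)" for Q using that Qs base_rels_dfp by auto
  from berkeley_emb[OF b eta th, of "base_rels \<delta> @ Qs", OF this]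
  obtain j \<kappa> where e: "emb \<theta> (set (base_rels \<delta> @ Qs)) j \<kappa>" and k: "\<eta> \<epsilon> \<kappa>" "\<kappa> \<epsilon> \<delta>" by blast
  obtain l where l: "func l omega \<delta>" "app l empty = \<kappa>"
    "\<And>n. n \<epsilon> omega \<Longrightarrow> app l (succ n) = app j (app l n)" "\<And>n. n \<epsilon> omega \<Longrightarrow> app l n \<epsilon> app l (succ n)"
    "card_sequence l"
    using critical_sequence[OF th e k(2) om] by blast
  show ?thesis
  proof (cases "seq_sup l \<epsilon> \<delta>")
    case True
    then show ?thesis using e k l by blast
  next
    case False
    then have sup: "seq_sup l = \<delta>" using sup_le[OF th e k(2) om l(1-4)] by blast
    \<comment> \<open>The graph of the cofinal sequence \<open>l\<close>, to be preserved by the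
      second embedding.\<close>
    define Q :: "'v rel4" where "Q = (\<lambda>a b c d. opair a b \<epsilon> l)"
    let ?Rs = "Qs @ [Q]"
    have "definable4 Q"
      unfolding Q_def by (intro dfi)
    then have "definable4 R"
      if "R \<in> set (base_rels \<delta> @ ?Rs)" for R using that Qs base_rels_dfp by auto
    from berkeley_emb[OF b eta th, of "base_rels \<delta> @ ?Rs", OF this]
    obtain j' \<kappa>' where e': "emb \<theta> (set (base_rels \<delta> @ ?Rs)) j' \<kappa>'" and k': "\<eta> \<epsilon> \<kappa>'" "\<kappa>' \<epsilon> \<delta>" by blast
    obtain l' where l': "func l' omega \<delta>" "app l' empty = \<kappa>'"
      "\<And>n. n \<epsilon> omega \<Longrightarrow> app l' (succ n) = app j' (app l' n)" "\<And>n. n \<epsilon> omega \<Longrightarrow> app l' n \<epsilon> app l' (succ n)"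
      "card_sequence l'"
      using critical_sequence[OF th e' k'(2) om] by blast
    obtain m where m: "m \<epsilon> omega" "\<kappa>' \<epsilon> app l m"
      using k'(2) mem_sup[OF th e k(2) om l(1-4)] unfolding sup by blast
    have ld: "app l m \<epsilon> \<delta>" using func_app[OF l(1) m(1)] .
    have "opair (app j' m) (app j' (app l m)) \<epsilon> l"
      using j_preserves[OF th e' k'(2), of Q m "app l m" empty empty] V_omega[OF th(1) m(1)]
        below_delta_V[OF th e' k'(2) ld] empty_V[OF th e' k'(2)] func_mem[OF l(1), of m "app l m"] m(1)
      by (simp add: Q_def)
    \<comment> \<open>The index \<open>m\<close> is a natural number and hence fixed, so
      preservation of the graph of \<open>l\<close> forces the value at \<open>m\<close> to be
      fixed.\<close>
    then have "app j' (app l m) = app l m"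
      using func_mem[OF l(1)] j_nat[OF th e' k'(2) m(1)] by simp
    from sup_below_fixed[OF th e' k'(2) om l'(1-4) ld this m(2)] have "seq_sup l' \<epsilon> \<delta>" .
    moreover have "emb \<theta> (set (base_rels \<delta> @ Qs)) j' \<kappa>'" by (rule emb_mono[OF e']) auto
    ultimately show ?thesis using k' l' by blast
  qed
qed

lemma type_univ: "has_type P A l \<Longrightarrow> ordinal (seq_sup l) \<Longrightarrow> x \<epsilon> univ A \<Longrightarrow> x \<epsilon> V (seq_sup l)"
  using rank_mem[of x "univ A"] by (simp add: has_type_def mem_V)

text \<open>The embedding is chosen before any class is considered; \<open>reflection\<close> then
  applies to each class through its own code.\<close>

lemma sigma_definable_sqrt_ESR:
  assumes b: "berkeley \<delta>" and L: "is_language L" and P: "unary_predicates L P" and s: "small_language L \<delta>"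
  shows "\<exists>l. card_sequence l \<and> seq_sup l \<epsilon> \<delta> \<and>
    (\<forall>C. sigma_definable n z C \<and> (\<forall>A. C A \<longrightarrow> is_structure L A) \<longrightarrow> sqrt_ESR L P C l)"
proof -
  obtain \<alpha> i where a: "\<alpha> \<epsilon> \<delta>" and i: "func i (symbols L) (V \<alpha>)" "injective i (symbols L)"
    using s unfolding small_language_def by blast
  have od: "ordinal \<delta>" using b by (simp add: berkeley_def)
  \<comment> \<open>The level must contain \<delta>, \<open>omega\<close> and the symbols; every
    structure whose universe lies in \<open>V (seq_sup l)\<close> then belongs to it by
    \<open>structure_V\<close>.\<close>
  obtain \<theta> where th: "limit \<theta>" and x: "union2 (upair \<delta> omega) (upair (symbols L) (symbols L)) \<epsilon> V \<theta>"
    using ex_limit by blast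
  have o: "ordinal \<theta>" using th limitD by blast
  have V: "\<delta> \<epsilon> V \<theta>" "omega \<epsilon> V \<theta>" "symbols L \<epsilon> V \<theta>" by (rule V_mem[OF o x], simp)+
  then have dt: "\<delta> \<epsilon> \<theta>" and om: "omega \<epsilon> \<theta>" using ordinal_mem_V[OF o] od ordinal_omega by blast+
  \<comment> \<open>Everything that varies (sequence, structure, function, code) is an argument,
    whereas \<open>L\<close>, \<open>P\<close>, \<open>z\<close> and \<open>n\<close> are built into
    the relation. The witnesses \<open>A\<close> and \<open>r\<close> range over the whole model,
    and \<open>z\<close> need not lie in \<open>V \<theta>\<close>. The opening conjuncts act as
    guards for definability.\<close>
  define R where "R = (\<lambda>l B f c. (\<exists>D. func l omega D) \<and> ordinal (seq_sup l) \<and> is_structure L B \<and>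
    (\<exists>A r. is_structure L A \<and> sigma_true n c (lam omega (\<lambda>m. if m = num 0 then A else z)) \<and>
      has_type P A l \<and> square_root (seq_sup l) f r \<and> elementary L A B (lam (univ A) (app r))))"
  define Qs where "Qs = [\<lambda>a b c d. opair a b \<epsilon> i, \<lambda>a b c d. is_structure L a,
    \<lambda>a b c d. is_structure L a \<and> sat L a b c, R]"
  have 1: "dfp E (\<lambda>_. True) (\<lambda>s. opair (s 0) (s (Suc 0)) \<epsilon> i)" by (intro dfi)
  have 2: "dfp E (\<lambda>_. True) (\<lambda>s. is_structure L (s 0))" by (intro dfi dfp_structure[OF L])
  have 3: "dfp E (\<lambda>_. True) (\<lambda>s. is_structure L (s 0) \<and> sat L (s 0) (s (Suc 0)) (s (Suc (Suc 0))))"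
    by (intro dfi dfp_structure[OF L] dfp_sat[OF L]) auto
  have 4: "definable4 R"
    unfolding R_def
    by (intro dfi dfp_structure[OF L] dfp_has_type[OF L _ _ _ P] dfp_square_root dfp_elementary[OF L])
      (auto simp: structure_pair square_root_def intro: type_univ func_fdef intro!: lam_ex_cod[OF lam_fin_dft])
  have "definable4 Q" if "Q \<in> set Qs" for Q
    using that 1 2 3 4 unfolding Qs_def by auto
  \<comment> \<open>The ordinal \<alpha> of the small language takes the place of \<eta>, which puts
    the critical point above it, as \<open>Fix_symbol\<close> requires.\<close>
  from berkeley_critical_sequence[OF b a th dt om, of Qs, OF this]
  obtain j \<kappa> l where e: "emb \<theta> (set (base_rels \<delta> @ Qs)) j \<kappa>" and k: "\<alpha> \<epsilon> \<kappa>" "\<kappa> \<epsilon> \<delta>"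
    and l: "func l omega \<delta>" "app l empty = \<kappa>"
    "\<And>n. n \<epsilon> omega \<Longrightarrow> app l (succ n) = app j (app l n)" "\<And>n. n \<epsilon> omega \<Longrightarrow> app l n \<epsilon> app l (succ n)"
    "card_sequence l" "seq_sup l \<epsilon> \<delta>" by blast
  have m: "(\<lambda>a b c d. opair a b \<epsilon> i) \<in> set Qs" "(\<lambda>a b c d. is_structure L a) \<in> set Qs"
    "(\<lambda>a b c d. is_structure L a \<and> sat L a b c) \<in> set Qs" "R \<in> set Qs" unfolding Qs_def by simp_all
  have "sqrt_ESR L P C l" if "sigma_definable n z C" "\<And>A. C A \<Longrightarrow> is_structure L A" for C
    by (rule reflection[OF th dt e k(2) om l(1-4) L V(3) k(1) i l(6) m(1-3) m(4)[unfolded R_def] that])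
  then show ?thesis using l(5,6) by blast
qed

end

theorem theorem5p9:
  fixes E :: "'v \<Rightarrow> 'v \<Rightarrow> bool" and L :: "'v language" and P \<delta> z :: 'v and n :: nat
  assumes "ZF E"
    and "n > 0"
    and "membership.least_berkeley E \<delta>"
    and "membership.is_language E L"
    and "membership.unary_predicates E L P"
    and "membership.small_language E L \<delta>"
  shows "\<exists>l. membership.card_sequence E l \<and> E (membership.seq_sup E l) \<delta> \<and>
    (\<forall>C. membership.sigma_definable E n z C \<and> (\<forall>A. C A \<longrightarrow> membership.is_structure E L A) \<longrightarrow>
      membership.sqrt_ESR E L P C l)"
proof -
  interpret ZF E by (rule assms(1))
  show ?thesis
    by (rule sigma_definable_sqrt_ESR) (use assms in \<open>auto simp: least_berkeley_def\<close>)
qed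

end
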